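(* Let $G=GL_2(\mathbb{R})$. (1) Up to the equivalence relation $\sim$ in $G$, the non-trivial connected subgroups of $G$ (those which are equivalent neither to $\{e\}$ nor to $G$) are $$Z,\quad U,\quad A(\alpha),\quad B(\alpha)\qquad(\alpha\in\mathbb{R}).$$ (2) For all $\alpha,\beta\in\mathbb{R}$, the properness in $G$ of pairs of these subgroups is as follows (the relation $\pitchfork$ being symmetric): - $Z\pitchfork Z$ does not hold; $Z\pitchfork A(\beta)$, $Z\pitchfork U$ and $Z\pitchfork B(\beta)$ always hold; - $A(\alpha)\pitchfork A(\beta)$ if and only if $|\alpha|\neq|\beta|$; $A(\alpha)\pitchfork U$ always holds; $A(\alpha)\pitchfork B(\beta)$ if and only if $|\alpha|>|\beta|$; - $U\pitchfork U$ does not hold; $U\pitchfork B(\beta)$ always holds; - $B(\alpha)\pitchfork B(\beta)$ never holds.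
   Context: For subsets $L,H$ of a locally compact group $G$ and $C\subset G$ write $CHC^{-1}=\{chd^{-1}: c,d\in C,\ h\in H\}$. The pair $(L,H)$ is called proper, written $L\pitchfork H$ in $G$, if $L\cap CHC^{-1}$ is relatively compact for every compact subset $C\subset G$. One writes $L\sim H$ (in $G$) if there is a compact subset $C\subset G$ with $L\subset CHC^{-1}$ and $H\subset CLC^{-1}$. Connected subgroup means connected Lie subgroup. For $\alpha\in\mathbb{R}$, the subgroups of $GL_2(\mathbb{R})$ are $$Z=\left\{\begin{pmatrix}e^t & 0 \\ 0 & e^t\end{pmatrix}:t\in\mathbb{R}\right\},\quad U=\left\{\begin{pmatrix}e^t & 0 \\ t e^t & e^t\end{pmatrix}:t\in\mathbb{R}\right\},$$ $$A(\alpha)=\left\{\begin{pmatrix}e^{(\alpha+1)t} & 0 \\ 0 & e^{(\alpha-1)t}\end{pmatrix}:t\in\mathbb{R}\right\},\quad B(\alpha)=\left\{\begin{pmatrix}e^{(\alpha+1)t} & 0 \\ s & e^{(\alpha-1)t}\end{pmatrix}:s,t\in\mathbb{R}\right\}.$$ *)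

theory Defs
  imports "HOL-Analysis.Analysis" "HOL-Algebra.Group"
begin

definition topological_group :: "('a, 'b) monoid_scheme \<Rightarrow> 'a topology \<Rightarrow> bool" where
  "topological_group G X \<longleftrightarrow>
     group G \<and> topspace X = carrier G \<and>
     continuous_map (prod_topology X X) X (\<lambda>(x, y). x \<otimes>\<^bsub>G\<^esub> y) \<and>
     continuous_map X X (\<lambda>x. inv\<^bsub>G\<^esub> x)"

definition sandwich :: "('a, 'b) monoid_scheme \<Rightarrow> 'a set \<Rightarrow> 'a set \<Rightarrow> 'a set" where
  "sandwich G C H = {c \<otimes>\<^bsub>G\<^esub> h \<otimes>\<^bsub>G\<^esub> inv\<^bsub>G\<^esub> d | c h d. c \<in> C \<and> h \<in> H \<and> d \<in> C}"

text \<open>The closure is taken in \<open>X\<close>: for \<open>GL\<^sub>2(\<real>)\<close>, not in the space of all matrices.\<close>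

definition relatively_compact_in :: "'a topology \<Rightarrow> 'a set \<Rightarrow> bool" where
  "relatively_compact_in X S \<longleftrightarrow> S \<subseteq> topspace X \<and> compactin X (X closure_of S)"

definition proper_pair ::
  "('a, 'b) monoid_scheme \<Rightarrow> 'a topology \<Rightarrow> 'a set \<Rightarrow> 'a set \<Rightarrow> bool" where
  "proper_pair G X L H \<longleftrightarrow>
     (\<forall>C. compactin X C \<longrightarrow> relatively_compact_in X (L \<inter> sandwich G C H))"

definition sim_in ::
  "('a, 'b) monoid_scheme \<Rightarrow> 'a topology \<Rightarrow> 'a set \<Rightarrow> 'a set \<Rightarrow> bool" where
  "sim_in G X L H \<longleftrightarrow>
     (\<exists>C. compactin X C \<and> L \<subseteq> sandwich G C H \<and> H \<subseteq> sandwich G C L)"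

definition GL2 :: "(real^2^2) monoid" where
  "GL2 = \<lparr>carrier = {A. invertible A}, mult = (**), one = mat 1\<rparr>"

definition GL2_top :: "(real^2^2) topology" where
  "GL2_top = top_of_set (carrier GL2)"

abbreviation proper_GL2 :: "(real^2^2) set \<Rightarrow> (real^2^2) set \<Rightarrow> bool" where
  "proper_GL2 \<equiv> proper_pair GL2 GL2_top"

abbreviation sim_GL2 :: "(real^2^2) set \<Rightarrow> (real^2^2) set \<Rightarrow> bool" where
  "sim_GL2 \<equiv> sim_in GL2 GL2_top"

text \<open>
  \<open>C_infinity V W f\<close>: \<open>f\<close> is of class \<open>C\<^sup>\<infinity>\<close> on \<open>W\<close>, where \<open>W\<close> is a (relatively) open subset of
  the linear subspace \<open>V\<close>. Coinductively: \<open>f\<close> is differentiable on \<open>W\<close> and all its directional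
  derivatives along \<open>V\<close> are again \<open>C\<^sup>\<infinity>\<close>. The values of \<open>D x\<close> off \<open>V\<close> are irrelevant.
\<close>

coinductive C_infinity ::
  "'a::euclidean_space set \<Rightarrow> 'a set \<Rightarrow> ('a \<Rightarrow> 'b::real_normed_vector) \<Rightarrow> bool"
  for V W where
  "\<lbrakk>\<And>x. x \<in> W \<Longrightarrow> (f has_derivative D x) (at x within W);
    \<And>v. v \<in> V \<Longrightarrow> C_infinity V W (\<lambda>x. D x v)\<rbrakk> \<Longrightarrow> C_infinity V W f"

definition immersion_on ::
  "'a::euclidean_space set \<Rightarrow> 'a set \<Rightarrow> ('a \<Rightarrow> 'b::real_normed_vector) \<Rightarrow> bool" where
  "immersion_on V W f \<longleftrightarrow>
     C_infinity V W f \<and> (\<forall>x\<in>W. \<exists>D. (f has_derivative D) (at x within W) \<and> inj_on D V)"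

text \<open>
  \<open>T\<close> is the manifold topology of a smooth manifold structure on \<open>M\<close> for which the inclusion of
  \<open>M\<close> into the ambient space is an immersion; \<open>T\<close> may be strictly finer than the subspace topology.
  The maps \<open>\<phi>\<close> are inverses of charts. Their model space \<open>\<real>\<^sup>k\<close> is a subspace \<open>V\<close> of the ambient space,
  which is no restriction since an immersion forces \<open>k\<close> to be at most the ambient dimension.
  Smoothness of the coordinate changes need not be required: each \<open>\<phi>\<close> locally has a smooth left
  inverse defined on the ambient space, so continuous coordinate changes are smooth.
\<close>

definition immersed_submanifold :: "'a::euclidean_space set \<Rightarrow> 'a topology \<Rightarrow> bool" where
  "immersed_submanifold M T \<longleftrightarrow>
     topspace T = M \<and> Hausdorff_space T \<and> second_countable T \<and>
     (\<exists>V :: 'a set. subspace V \<and>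
        (\<forall>p\<in>M. \<exists>W (\<phi> :: 'a \<Rightarrow> 'a). openin (top_of_set V) W \<and> p \<in> \<phi> ` W \<and> openin T (\<phi> ` W) \<and>
           homeomorphic_map (top_of_set W) (subtopology T (\<phi> ` W)) \<phi> \<and>
           immersion_on V W \<phi>))"

text \<open>
  A connected Lie subgroup is a subgroup with a connected Lie group structure making the inclusion
  an immersion; it need not be closed. Multiplication and inversion of \<open>H\<close> are smooth into the
  ambient space, so continuity for \<open>T\<close> is the same as smoothness for the manifold structure.
\<close>

definition connected_Lie_subgroup :: "(real^2^2) set \<Rightarrow> bool" where
  "connected_Lie_subgroup H \<longleftrightarrow>
     subgroup H GL2 \<and>
     (\<exists>T. immersed_submanifold H T \<and> connected_space T \<and>
          topological_group (GL2\<lparr>carrier := H\<rparr>) T)"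

definition mat2 :: "real \<Rightarrow> real \<Rightarrow> real \<Rightarrow> real \<Rightarrow> real^2^2" where
  "mat2 a b c d = vector [vector [a, b], vector [c, d]]"

definition Z_grp :: "(real^2^2) set" where
  "Z_grp = {mat2 (exp t) 0 0 (exp t) | t. True}"

definition U_grp :: "(real^2^2) set" where
  "U_grp = {mat2 (exp t) 0 (t * exp t) (exp t) | t. True}"

definition A_grp :: "real \<Rightarrow> (real^2^2) set" where
  "A_grp \<alpha> = {mat2 (exp ((\<alpha> + 1) * t)) 0 0 (exp ((\<alpha> - 1) * t)) | t. True}"

definition B_grp :: "real \<Rightarrow> (real^2^2) set" where
  "B_grp \<alpha> = {mat2 (exp ((\<alpha> + 1) * t)) 0 s (exp ((\<alpha> - 1) * t)) | s t. True}"

definition nontrivial_connected_subgroup :: "(real^2^2) set \<Rightarrow> bool" where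
  "nontrivial_connected_subgroup H \<longleftrightarrow>
     connected_Lie_subgroup H \<and> \<not> sim_GL2 H {\<one>\<^bsub>GL2\<^esub>} \<and> \<not> sim_GL2 H (carrier GL2)"

end

theory Submission
  imports Defs
begin

text \<open>
  By the singular value decomposition, a matrix \<open>g\<close> is determined up to multiplication by compact
  sets on both sides by its two singular values, equivalently by the point
  \<open>\<mu>(g) = (ln \<bar>det g\<bar>, ln (\<parallel>g\<parallel>\<^sup>2 / \<bar>det g\<bar>))\<close>, where \<open>\<parallel>\<cdot>\<parallel>\<close> is the Euclidean norm of the entries. The first
  coordinate measures the volume distortion; the second, called the width below, is non-negative and is,
  up to a bounded error, the logarithm of the quotient of the singular values. Hence \<open>L \<sim> H\<close> holds
  exactly when \<open>\<mu>(L)\<close> and \<open>\<mu>(H)\<close> are at finite Hausdorff distance, and \<open>(L, H)\<close> is proper exactly when only a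
  bounded part of \<open>\<mu>(L)\<close> lies within any given distance of \<open>\<mu>(H)\<close> (\<open>sim_GL2_iff_near\<close>,
  \<open>proper_GL2_iff_coarsely_proper\<close>). Both questions are thereby about subsets of the upper half-plane.

  The images of the groups in question are, up to finite Hausdorff distance, simple regions: \<open>Z\<close> gives the
  boundary line, \<open>U\<close> the logarithmic graph over it, \<open>A(\<alpha>)\<close> the rays through \<open>(\<plusminus>\<alpha>, 1)\<close>, \<open>B(\<alpha>)\<close> the
  cone between these rays, and \<open>GL\<^sub>2\<close> the whole half-plane. The properness table is then read off from
  elementary estimates; for \<open>U\<close> they rest on the fact that the logarithm is unbounded but grows more slowly
  than every linear function.

  A connected Lie subgroup is connected for the topology of the matrix space, which is coarser than its
  manifold topology. The classification is an argument about subgroups \<open>H\<close> of \<open>GL\<^sub>2\<close> that are connected in this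
  sense, with the intermediate value theorem in the place of Lie algebras.

  If \<open>H\<close> fixes a line, it is conjugate to a group of lower triangular matrices. When it is not abelian,
  connectedness of the set of commutators forces \<open>H\<close> to contain all unipotent lower triangular matrices,
  so \<open>\<mu>(H)\<close> is determined by the logarithms of the diagonal entries; when it is abelian, it is either
  simultaneously diagonalizable or consists of multiples of unipotent matrices. In each case \<open>\<mu>(H)\<close> is
  controlled by a connected subgroup of \<open>\<real>\<^sup>2\<close>, which is trivial, a line, or dense up to distance one
  (\<open>connected_subgroup_plane\<close>); being dense is as good as being everything, since bounded errors do not
  matter.

  If \<open>H\<close> fixes no line and is abelian, it consists of similarities for a suitable inner product, and the
  width is bounded on it. If it is not abelian, let \<open>S\<close> be the group generated by its commutators: a
  connected group of matrices of determinant 1, which again fixes no line and is not abelian. The commutator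
  of two non-commuting elliptic elements is hyperbolic, and so is a high power of a parabolic element times a
  suitable other element; thus \<open>S\<close> contains a hyperbolic element. A sign argument shows that \<open>S\<close> moves the contracted
  direction of that element to every direction, so every vector can be contracted by \<open>S\<close>
  (\<open>hyperbolic_imp_contracting\<close>). By compactness of the circle the width can be reduced below a fixed bound
  within each coset \<open>S g\<close>; as it is unbounded and continuous on the connected set \<open>S g\<close>, it takes
  every larger value there (\<open>coset_attains_all_widths\<close>). So \<open>\<mu>(H)\<close> is, up to a bounded error, the full
  vertical ray over each value of \<open>ln (det g)\<close> for \<open>g \<in> H\<close>; these values are either 0 alone or all reals.
\<close>

section \<open>Real two-by-two matrices\<close>

lemma mat2_nth [simp]:
  "mat2 a b c d $ 1 $ 1 = a" "mat2 a b c d $ 1 $ 2 = b"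
  "mat2 a b c d $ 2 $ 1 = c" "mat2 a b c d $ 2 $ 2 = d"
  by (simp_all add: mat2_def)

lemma mat2_cases: obtains a b c d where "g = mat2 a b c d"
proof
  show "g = mat2 (g$1$1) (g$1$2) (g$2$1) (g$2$2)"
    by (simp add: vec_eq_iff forall_2)
qed

lemma mat2_eq_iff: "mat2 a b c d = mat2 a' b' c' d' \<longleftrightarrow> a = a' \<and> b = b' \<and> c = c' \<and> d = d'"
  by (auto simp: vec_eq_iff forall_2)

lemma mat2_mult [simp]:
  "mat2 a b c d ** mat2 a' b' c' d' =
     mat2 (a * a' + b * c') (a * b' + b * d') (c * a' + d * c') (c * b' + d * d')"
  by (simp add: vec_eq_iff forall_2 matrix_matrix_mult_def sum_2)

lemma mat_1_eq_mat2: "mat 1 = mat2 1 0 0 1"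
  by (simp add: vec_eq_iff forall_2 mat_def)

lemma det_mat2 [simp]: "det (mat2 a b c d) = a * d - b * c"
  by (simp add: det_2)

lemma norm_mat2: "(norm (mat2 a b c d))\<^sup>2 = a\<^sup>2 + b\<^sup>2 + c\<^sup>2 + d\<^sup>2"
  unfolding power2_norm_eq_inner by (simp add: inner_vec_def sum_2 power2_eq_square)

lemma invertible_mat2: "invertible (mat2 a b c d) \<longleftrightarrow> a * d - b * c \<noteq> 0"
  by (simp add: invertible_det_nz)

lemma matrix_inv_right_left:
  fixes g :: "real^2^2"
  assumes "invertible g"
  shows "g ** matrix_inv g = mat 1 \<and> matrix_inv g ** g = mat 1"
  using someI_ex[OF assms[unfolded invertible_def]] unfolding matrix_inv_def .

lemma matrix_inv_unique:
  fixes A B :: "real^2^2"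
  assumes "A ** B = mat 1"
  shows "matrix_inv A = B"
proof -
  have "B ** A = mat 1" using assms by (simp add: matrix_left_right_inverse)
  then have "invertible A" using assms invertible_def by blast
  then have "A ** matrix_inv A = mat 1" by (simp add: matrix_inv_right_left)
  then have "(B ** A) ** matrix_inv A = B" by (simp flip: matrix_mul_assoc)
  then show ?thesis by (simp add: \<open>B ** A = mat 1\<close>)
qed

lemma matrix_inv_mat2:
  assumes "a * d - b * c \<noteq> 0"
  shows "matrix_inv (mat2 a b c d) =
    mat2 (d / (a * d - b * c)) (- b / (a * d - b * c)) (- c / (a * d - b * c)) (a / (a * d - b * c))"
proof (rule matrix_inv_unique)
  define D where "D = a * d - b * c"
  have "D \<noteq> 0" using assms by (simp add: D_def)
  then have "mat2 a b c d ** mat2 (d / D) (- b / D) (- c / D) (a / D) = mat2 (D / D) 0 0 (D / D)"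
    unfolding mat2_mult mat2_eq_iff
    by (auto simp: D_def mult.commute simp flip: diff_divide_distrib)
  then show "mat2 a b c d ** mat2 (d / (a * d - b * c)) (- b / (a * d - b * c)) (- c / (a * d - b * c)) (a / (a * d - b * c)) = mat 1"
    using \<open>D \<noteq> 0\<close> by (simp add: D_def mat_1_eq_mat2)
qed

lemma norm_matrix_mult_le:
  fixes A B :: "real^2^2"
  shows "norm (A ** B) \<le> norm A * norm B"
proof -
  obtain a b c d where A: "A = mat2 a b c d" by (rule mat2_cases)
  obtain a' b' c' d' where B: "B = mat2 a' b' c' d'" by (rule mat2_cases)
  have cs: "(p * r + q * s)\<^sup>2 \<le> (p\<^sup>2 + q\<^sup>2) * (r\<^sup>2 + s\<^sup>2)" for p q r s :: real
  proof -
    have "(p\<^sup>2 + q\<^sup>2) * (r\<^sup>2 + s\<^sup>2) - (p * r + q * s)\<^sup>2 = (p * s - q * r)\<^sup>2"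
      by (simp add: power2_eq_square algebra_simps)
    then show ?thesis by (metis diff_ge_0_iff_ge zero_le_power2)
  qed
  have "(norm (A ** B))\<^sup>2 \<le> (a\<^sup>2 + b\<^sup>2) * (a'\<^sup>2 + c'\<^sup>2) + (a\<^sup>2 + b\<^sup>2) * (b'\<^sup>2 + d'\<^sup>2)
      + (c\<^sup>2 + d\<^sup>2) * (a'\<^sup>2 + c'\<^sup>2) + (c\<^sup>2 + d\<^sup>2) * (b'\<^sup>2 + d'\<^sup>2)"
    unfolding A B mat2_mult norm_mat2 by (intro add_mono cs)
  also have "\<dots> = (norm A * norm B)\<^sup>2"
    unfolding A B power_mult_distrib norm_mat2 by (simp add: algebra_simps)
  finally show ?thesis by (rule power2_le_imp_le) simp
qed

lemma two_abs_le:
  fixes x y :: real assumes "2 * x \<le> y" "- (2 * x) \<le> y" shows "2 * \<bar>x\<bar> \<le> y"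
  using assms by auto

text \<open>
  The difference of the two sides is \<open>(a - d)\<^sup>2 + (b + c)\<^sup>2\<close> or \<open>(a + d)\<^sup>2 + (b - c)\<^sup>2\<close>, according to the sign
  of the determinant. So the second coordinate of \<open>cartan_mu\<close> below is at least \<open>ln 2\<close>.
\<close>

lemma norm_mat2_det: "2 * \<bar>det g\<bar> \<le> (norm g)\<^sup>2" for g :: "real^2^2"
proof -
  obtain a b c d where g: "g = mat2 a b c d" by (rule mat2_cases)
  have "0 \<le> (a - d)\<^sup>2 + (b + c)\<^sup>2" "0 \<le> (a + d)\<^sup>2 + (b - c)\<^sup>2" by simp_all
  then have "2 * (a * d - b * c) \<le> a\<^sup>2 + b\<^sup>2 + c\<^sup>2 + d\<^sup>2" "- (2 * (a * d - b * c)) \<le> a\<^sup>2 + b\<^sup>2 + c\<^sup>2 + d\<^sup>2"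
    by (simp_all add: power2_sum power2_diff)
  then show ?thesis unfolding g norm_mat2 det_mat2 by (intro two_abs_le)
qed

text \<open>
  In dimension two the adjugate has the same entries as the matrix up to sign and order. This makes the
  sets \<open>GL2_ball\<close> below stable under inversion up to a change of radius.
\<close>

lemma norm_matrix_inv:
  fixes g :: "real^2^2"
  assumes "invertible g"
  shows "norm (matrix_inv g) = norm g / \<bar>det g\<bar>"
proof -
  obtain a b c d where g: "g = mat2 a b c d" by (rule mat2_cases)
  have ne: "a * d - b * c \<noteq> 0" using assms by (simp add: g invertible_mat2)
  have "(norm (matrix_inv g))\<^sup>2 = (norm g / \<bar>det g\<bar>)\<^sup>2"
    unfolding g matrix_inv_mat2[OF ne] power_divide norm_mat2 det_mat2
    by (simp add: power_divide add_divide_distrib)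
  then show ?thesis by (rule power2_eq_imp_eq) simp_all
qed

lemma matrix_inv_cancel:
  fixes g :: "real^2^2"
  assumes "invertible g"
  shows "g ** matrix_inv g = mat 1" "matrix_inv g ** g = mat 1"
    "x ** g ** matrix_inv g = x" "x ** matrix_inv g ** g = x"
    "g ** (matrix_inv g ** x) = x" "matrix_inv g ** (g ** x) = x"
proof -
  show 1: "g ** matrix_inv g = mat 1" "matrix_inv g ** g = mat 1"
    using matrix_inv_right_left[OF assms] by auto
  show "x ** g ** matrix_inv g = x" "x ** matrix_inv g ** g = x"
    using 1 by (metis matrix_mul_assoc matrix_mul_rid)+
  show "g ** (matrix_inv g ** x) = x" "matrix_inv g ** (g ** x) = x"
    using 1 by (metis matrix_mul_assoc matrix_mul_lid)+
qed

lemma invertible_matrix_inv: "invertible g \<Longrightarrow> invertible (matrix_inv g)" for g :: "real^2^2"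
  unfolding invertible_def[of "matrix_inv g"] by (intro exI[of _ g]) (simp add: matrix_inv_cancel(1,2))

lemma det_matrix_inv: "invertible g \<Longrightarrow> det (matrix_inv g) = 1 / det g" for g :: "real^2^2"
  using det_mul[of g "matrix_inv g"] by (simp add: matrix_inv_cancel(1) invertible_det_nz eq_divide_eq mult.commute)

lemma matrix_inv_inv: "invertible g \<Longrightarrow> matrix_inv (matrix_inv g) = g" for g :: "real^2^2"
  by (rule matrix_inv_unique) (rule matrix_inv_cancel(2))

lemma continuous_on_matrix_mult [continuous_intros]:
  fixes f g :: "'a::topological_space \<Rightarrow> real^2^2"
  assumes "continuous_on S f" "continuous_on S g"
  shows "continuous_on S (\<lambda>x. f x ** g x)"
  unfolding matrix_matrix_mult_def sum_2
  by (intro continuous_intros assms)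

lemma continuous_on_mat2 [continuous_intros]:
  assumes "continuous_on S a" "continuous_on S b" "continuous_on S c" "continuous_on S d"
  shows "continuous_on S (\<lambda>x. mat2 (a x) (b x) (c x) (d x))"
proof -
  have "mat2 p q r s = (\<chi> i j. if i = 1 then if j = 1 then p else q else if j = 1 then r else s)"
    for p q r s by (simp add: vec_eq_iff forall_2)
  moreover have "continuous_on S (\<lambda>x. if i = 1 then if j = 1 then a x else b x else if j = 1 then c x else d x)"
    for i j :: 2 using assms by (cases "i = 1"; cases "j = 1") simp_all
  ultimately show ?thesis by (simp add: continuous_on_vec_lambda)
qed

lemma continuous_on_det2 [continuous_intros]:
  fixes f :: "'a::topological_space \<Rightarrow> real^2^2"
  assumes "continuous_on S f"
  shows "continuous_on S (\<lambda>x. det (f x))"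
  unfolding det_2 by (intro continuous_intros assms)

lemma continuous_on_matrix_inv [continuous_intros]:
  fixes f :: "'a::topological_space \<Rightarrow> real^2^2"
  assumes f: "continuous_on S f" and inv: "\<And>x. x \<in> S \<Longrightarrow> invertible (f x)"
  shows "continuous_on S (\<lambda>x. matrix_inv (f x))"
proof -
  have "matrix_inv g = mat2 (g$2$2 / det g) (- g$1$2 / det g) (- g$2$1 / det g) (g$1$1 / det g)"
    if "invertible g" for g :: "real^2^2"
    using that by (cases g rule: mat2_cases) (simp add: invertible_mat2 matrix_inv_mat2)
  then have "continuous_on S (\<lambda>x. matrix_inv (f x)) \<longleftrightarrow>
    continuous_on S (\<lambda>x. mat2 (f x$2$2 / det (f x)) (- f x$1$2 / det (f x)) (- f x$2$1 / det (f x)) (f x$1$1 / det (f x)))"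
    using inv by (intro continuous_on_cong) auto
  also have \<dots>
    using inv by (intro continuous_intros f) (auto simp: invertible_det_nz)
  finally show ?thesis .
qed

lemma GL2_simps [simp]:
  "carrier GL2 = {A. invertible A}" "x \<otimes>\<^bsub>GL2\<^esub> y = x ** y" "\<one>\<^bsub>GL2\<^esub> = mat 1"
  by (simp_all add: GL2_def)

lemma group_GL2: "group GL2"
proof (rule groupI)
  show "\<exists>y\<in>carrier GL2. y \<otimes>\<^bsub>GL2\<^esub> x = \<one>\<^bsub>GL2\<^esub>" if "x \<in> carrier GL2" for x
    using that by (auto intro!: exI[of _ "matrix_inv x"] simp: matrix_inv_cancel invertible_matrix_inv)
qed (auto simp: invertible_mult matrix_mul_assoc invertible_def[of "mat 1"])

lemma inv_GL2 [simp]: "invertible x \<Longrightarrow> inv\<^bsub>GL2\<^esub> x = matrix_inv x"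
  by (rule group.inv_equality[OF group_GL2]) (auto simp: matrix_inv_cancel invertible_matrix_inv)

section \<open>The Cartan projection\<close>

definition near :: "(real \<times> real) set \<Rightarrow> (real \<times> real) set \<Rightarrow> bool" where
  "near A B \<longleftrightarrow> (\<exists>R. \<forall>a\<in>A. \<exists>b\<in>B. dist a b \<le> R)"

definition coarsely_proper :: "(real \<times> real) set \<Rightarrow> (real \<times> real) set \<Rightarrow> bool" where
  "coarsely_proper A B \<longleftrightarrow> (\<forall>R. bounded {a \<in> A. \<exists>b\<in>B. dist a b \<le> R})"

text \<open>
  The norm of \<open>real^2^2\<close> is the Euclidean norm of the entries, not the operator norm. The two differ by a
  factor of at most \<open>sqrt 2\<close>, which only changes the second coordinate by a bounded amount, and the Euclidean
  norm is polynomial in the entries.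
\<close>

definition cartan_mu :: "real^2^2 \<Rightarrow> real \<times> real" where
  "cartan_mu g = (ln \<bar>det g\<bar>, ln ((norm g)\<^sup>2 / \<bar>det g\<bar>))"

text \<open>
  An exhaustion of \<open>GL\<^sub>2\<close> by compact sets: the second condition keeps the determinant away from 0.
\<close>

definition GL2_ball :: "real \<Rightarrow> (real^2^2) set" where
  "GL2_ball R = {g. norm g \<le> R \<and> 1 \<le> R * \<bar>det g\<bar>}"

lemma invertible_norm_pos: "invertible g \<Longrightarrow> 0 < norm g" for g :: "real^2^2"
proof -
  assume "invertible g"
  then have "0 < 2 * \<bar>det g\<bar>" by (simp add: invertible_det_nz)
  then have "0 < (norm g)\<^sup>2" using norm_mat2_det[of g] by linarith
  then show ?thesis by simp
qed

lemma snd_cartan_mu: "invertible g \<Longrightarrow> snd (cartan_mu g) = 2 * ln (norm g) - ln \<bar>det g\<bar>"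
  using invertible_norm_pos[of g]
  by (simp add: cartan_mu_def ln_div invertible_det_nz ln_realpow)

lemma fst_cartan_mu: "fst (cartan_mu g) = ln \<bar>det g\<bar>"
  by (simp add: cartan_mu_def)

lemma GL2_ball_invertible: "g \<in> GL2_ball R \<Longrightarrow> invertible g"
  by (auto simp: GL2_ball_def invertible_det_nz)

lemma GL2_ball_mono: "R \<le> R' \<Longrightarrow> GL2_ball R \<subseteq> GL2_ball R'"
  by (auto simp: GL2_ball_def intro: order_trans[OF _ mult_right_mono])

lemma compact_GL2_ball: "compact (GL2_ball R)"
proof -
  have "GL2_ball R = cball 0 R \<inter> {g. 1 \<le> R * \<bar>det g\<bar>}"
    by (auto simp: GL2_ball_def)
  moreover have "closed {g::real^2^2. 1 \<le> R * \<bar>det g\<bar>}"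
    by (intro closed_Collect_le continuous_intros)
  ultimately show ?thesis by (simp add: compact_Int_closed)
qed

lemma compactin_GL2_top: "compactin GL2_top C \<longleftrightarrow> compact C \<and> C \<subseteq> {g. invertible g}"
  by (auto simp: GL2_top_def compactin_subtopology)

lemma compactin_GL2_ball: "compactin GL2_top (GL2_ball R)"
  using compact_GL2_ball GL2_ball_invertible by (auto simp: compactin_GL2_top)

lemma compactin_GL2_top_imp_ball:
  assumes "compactin GL2_top C"
  obtains R where "1 \<le> R" "C \<subseteq> GL2_ball R"
proof -
  have C: "compact C" and inv: "\<And>g. g \<in> C \<Longrightarrow> invertible g"
    using assms by (auto simp: compactin_GL2_top)
  obtain M where M: "\<And>g. g \<in> C \<Longrightarrow> norm g \<le> M"
    using compact_imp_bounded[OF C] by (auto simp: bounded_iff)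
  have "continuous_on C (\<lambda>g. 1 / \<bar>det g\<bar>)"
    using inv by (intro continuous_intros) (auto simp: invertible_det_nz)
  then have "bounded ((\<lambda>g. 1 / \<bar>det g\<bar>) ` C)"
    by (intro compact_imp_bounded compact_continuous_image C)
  then obtain N where N: "\<And>g. g \<in> C \<Longrightarrow> 1 / \<bar>det g\<bar> \<le> N"
    by (fastforce simp: bounded_iff)
  show thesis
  proof
    show "1 \<le> max 1 (max M N)" by simp
    show "C \<subseteq> GL2_ball (max 1 (max M N))"
    proof
      fix g assume g: "g \<in> C"
      have "1 / \<bar>det g\<bar> \<le> max 1 (max M N)" using N[OF g] by simp
      moreover have "0 < \<bar>det g\<bar>" using inv[OF g] by (simp add: invertible_det_nz)
      ultimately have "1 \<le> max 1 (max M N) * \<bar>det g\<bar>" by (simp add: divide_le_eq)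
      then show "g \<in> GL2_ball (max 1 (max M N))"
        using M[OF g] by (simp add: GL2_ball_def)
    qed
  qed
qed

lemma GL2_ball_bounds:
  assumes "g \<in> GL2_ball R" "1 \<le> R"
  shows "\<bar>ln \<bar>det g\<bar>\<bar> \<le> 2 * ln R" "ln (norm g) \<le> ln R" "norm (matrix_inv g) \<le> R\<^sup>2"
proof -
  have inv: "invertible g" using assms GL2_ball_invertible by blast
  have d: "0 < \<bar>det g\<bar>" using inv by (simp add: invertible_det_nz)
  have n: "0 < norm g" "norm g \<le> R" "1 \<le> R * \<bar>det g\<bar>"
    using assms inv invertible_norm_pos by (auto simp: GL2_ball_def)
  show "ln (norm g) \<le> ln R" using n assms(2) by (subst ln_le_cancel_iff) auto
  have dinv: "1 / \<bar>det g\<bar> \<le> R" using n d by (simp add: divide_le_eq)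
  have "norm (matrix_inv g) = norm g * (1 / \<bar>det g\<bar>)" using inv by (simp add: norm_matrix_inv)
  also have "\<dots> \<le> R * R" using n dinv assms(2) by (intro mult_mono) auto
  finally show "norm (matrix_inv g) \<le> R\<^sup>2" by (simp add: power2_eq_square)
  have "\<bar>det g\<bar> \<le> (norm g)\<^sup>2" using norm_mat2_det[of g] by simp
  also have "\<dots> \<le> R\<^sup>2" using n by (intro power_mono) auto
  finally have "ln \<bar>det g\<bar> \<le> ln (R\<^sup>2)" using d assms(2) by (subst ln_le_cancel_iff) auto
  then have 1: "ln \<bar>det g\<bar> \<le> 2 * ln R" using assms(2) by (simp add: ln_realpow)
  have "ln (1 / \<bar>det g\<bar>) \<le> ln R" using dinv d assms(2) by (subst ln_le_cancel_iff) auto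
  then have "- ln \<bar>det g\<bar> \<le> ln R" using d by (simp add: ln_div)
  then show "\<bar>ln \<bar>det g\<bar>\<bar> \<le> 2 * ln R" using 1 ln_ge_zero[OF assms(2)] by linarith
qed

lemma bounded_cartan_mu_GL2_ball: "bounded (cartan_mu ` GL2_ball R)"
proof -
  define R' where "R' = max 1 R"
  have "norm (cartan_mu g) \<le> 6 * ln R'" if "g \<in> GL2_ball R'" for g
  proof -
    have inv: "invertible g" using that GL2_ball_invertible by blast
    note b = GL2_ball_bounds[OF that]
    have "0 < \<bar>det g\<bar>" using inv by (simp add: invertible_det_nz)
    moreover have "\<bar>det g\<bar> \<le> (norm g)\<^sup>2" using norm_mat2_det[of g] by simp
    ultimately have "1 \<le> (norm g)\<^sup>2 / \<bar>det g\<bar>" by simp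
    then have "0 \<le> snd (cartan_mu g)" by (simp add: cartan_mu_def)
    moreover have "snd (cartan_mu g) \<le> 4 * ln R'"
      using b by (simp add: snd_cartan_mu[OF inv] R'_def)
    moreover have "\<bar>fst (cartan_mu g)\<bar> \<le> 2 * ln R'" using b by (simp add: fst_cartan_mu R'_def)
    moreover have "norm (cartan_mu g) \<le> \<bar>fst (cartan_mu g)\<bar> + \<bar>snd (cartan_mu g)\<bar>"
      using norm_Pair_le[of "fst (cartan_mu g)" "snd (cartan_mu g)"] by simp
    ultimately show ?thesis by linarith
  qed
  then have "bounded (cartan_mu ` GL2_ball R')" by (auto simp: bounded_iff)
  then show ?thesis
    by (rule bounded_subset) (use GL2_ball_mono[of R R'] in \<open>auto simp: R'_def\<close>)
qed

lemma bounded_cartan_mu_imp_ball: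
  assumes "bounded (cartan_mu ` S)" "S \<subseteq> {g. invertible g}"
  obtains R where "S \<subseteq> GL2_ball R"
proof -
  obtain M where M: "\<And>g. g \<in> S \<Longrightarrow> norm (cartan_mu g) \<le> M"
    using assms(1) by (auto simp: bounded_iff)
  have "g \<in> GL2_ball (exp M)" if g: "g \<in> S" for g
  proof -
    have inv: "invertible g" using g assms(2) by auto
    have "\<bar>fst (cartan_mu g)\<bar> \<le> M" "\<bar>snd (cartan_mu g)\<bar> \<le> M"
      using M[OF g] norm_fst_le[of "fst (cartan_mu g)" "snd (cartan_mu g)"]
        norm_snd_le[of "snd (cartan_mu g)" "fst (cartan_mu g)"] by simp_all
    then have *: "\<bar>ln \<bar>det g\<bar>\<bar> \<le> M" "\<bar>2 * ln (norm g) - ln \<bar>det g\<bar>\<bar> \<le> M"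
      using inv by (simp_all add: fst_cartan_mu snd_cartan_mu)
    then have "ln (norm g) \<le> M" "0 \<le> M + ln \<bar>det g\<bar>" by linarith+
    then have "exp (ln (norm g)) \<le> exp M" "exp 0 \<le> exp (M + ln \<bar>det g\<bar>)"
      by (simp_all only: exp_le_cancel_iff)
    moreover have "0 < \<bar>det g\<bar>" using inv by (simp add: invertible_det_nz)
    moreover have "exp (ln (norm g)) = norm g" using invertible_norm_pos[OF inv] by (rule exp_ln)
    ultimately show ?thesis
      by (simp add: GL2_ball_def exp_add)
  qed
  then show thesis using that by blast
qed

lemma relatively_compact_in_GL2_iff:
  assumes "S \<subseteq> carrier GL2"
  shows "relatively_compact_in GL2_top S \<longleftrightarrow> bounded (cartan_mu ` S)"
proof
  assume "relatively_compact_in GL2_top S"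
  then have "compactin GL2_top (GL2_top closure_of S)" by (simp add: relatively_compact_in_def)
  then obtain R where "GL2_top closure_of S \<subseteq> GL2_ball R" by (rule compactin_GL2_top_imp_ball)
  moreover have "S \<subseteq> GL2_top closure_of S"
    using assms by (intro closure_of_subset) (simp add: GL2_top_def)
  ultimately show "bounded (cartan_mu ` S)"
    using bounded_subset[OF bounded_cartan_mu_GL2_ball] by (meson image_mono subset_trans)
next
  assume "bounded (cartan_mu ` S)"
  then obtain R where R: "S \<subseteq> GL2_ball R"
    using assms by (auto elim: bounded_cartan_mu_imp_ball)
  have cl: "closedin GL2_top (GL2_ball R)"
    unfolding GL2_top_def
    by (rule closed_subset) (auto simp: GL2_ball_invertible compact_imp_closed compact_GL2_ball)
  have "GL2_top closure_of S \<subseteq> GL2_ball R"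
    using R cl by (rule closure_of_minimal)
  then show "relatively_compact_in GL2_top S"
    unfolding relatively_compact_in_def
    using closed_compactin[OF compactin_GL2_ball _ closedin_closure_of, of S R] assms
    by (auto simp: GL2_top_def)
qed

lemma dist_prod_le: "dist x y \<le> \<bar>fst x - fst y\<bar> + \<bar>snd x - snd y\<bar>" for x y :: "real \<times> real"
  using norm_Pair_le[of "fst (x - y)" "snd (x - y)"] unfolding prod.collapse by (simp add: dist_norm)

lemma norm_matrix_mult3_le: "norm (a ** b ** c) \<le> norm a * norm b * norm c" for a b c :: "real^2^2"
  by (rule order_trans[OF norm_matrix_mult_le mult_right_mono[OF norm_matrix_mult_le norm_ge_zero]])

text \<open>
  The determinant is multiplicative, and \<open>\<parallel>c g d\<inverse>\<parallel>\<close> and \<open>\<parallel>g\<parallel>\<close> bound each other up to the norms of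
  \<open>c, d\<close> and their inverses.
\<close>

lemma cartan_mu_two_sided_bound:
  assumes c: "c \<in> GL2_ball R" and d: "d \<in> GL2_ball R" and R: "1 \<le> R" and g: "invertible g"
  shows "dist (cartan_mu (c ** g ** matrix_inv d)) (cartan_mu g) \<le> 20 * ln R"
proof -
  have ci: "invertible c" and di: "invertible d" using c d GL2_ball_invertible by auto
  define h where "h = c ** g ** matrix_inv d"
  have h: "invertible h" unfolding h_def by (intro invertible_mult ci g invertible_matrix_inv di)
  note bc = GL2_ball_bounds[OF c R] note bd = GL2_ball_bounds[OF d R]
  have R0: "0 < R" using R by simp
  have "det h = det c * det g / det d"
    unfolding h_def by (simp add: det_mul det_matrix_inv di)
  then have f: "ln \<bar>det h\<bar> = ln \<bar>det c\<bar> + ln \<bar>det g\<bar> - ln \<bar>det d\<bar>"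
    using ci di g by (simp add: abs_mult ln_mult ln_div invertible_det_nz)
  have pos: "0 < norm g" "0 < norm h" "0 < norm c" "0 < norm d"
    using invertible_norm_pos g h ci di by blast+
  have "norm h \<le> norm c * norm g * norm (matrix_inv d)"
    unfolding h_def by (rule norm_matrix_mult3_le)
  also have "\<dots> \<le> R * norm g * R\<^sup>2"
    using c bd R pos by (intro mult_mono) (auto simp: GL2_ball_def)
  finally have "ln (norm h) \<le> ln (R * norm g * R\<^sup>2)" using pos R0 by (subst ln_le_cancel_iff) auto
  then have 1: "ln (norm h) \<le> ln (norm g) + 3 * ln R"
    using pos R0 by (simp add: ln_mult ln_realpow)
  have "g = matrix_inv c ** h ** d"
    unfolding h_def matrix_mul_assoc[symmetric] using ci di by (simp only: matrix_inv_cancel matrix_mul_rid)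
  then have "norm g \<le> norm (matrix_inv c) * norm h * norm d"
    using norm_matrix_mult3_le by metis
  also have "\<dots> \<le> R\<^sup>2 * norm h * R"
    using d bc R pos by (intro mult_mono) (auto simp: GL2_ball_def)
  finally have "ln (norm g) \<le> ln (R\<^sup>2 * norm h * R)" using pos R0 by (subst ln_le_cancel_iff) auto
  then have 2: "ln (norm g) \<le> ln (norm h) + 3 * ln R"
    using pos R0 by (simp add: ln_mult ln_realpow)
  have "\<bar>ln \<bar>det c\<bar> - ln \<bar>det d\<bar>\<bar> \<le> 4 * ln R" using bc(1) bd(1) by linarith
  then have "\<bar>fst (cartan_mu h) - fst (cartan_mu g)\<bar> \<le> 4 * ln R"
    by (simp add: f fst_cartan_mu)
  moreover have "\<bar>2 * ln (norm h) - 2 * ln (norm g)\<bar> \<le> 6 * ln R" using 1 2 by linarith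
  ultimately have "\<bar>snd (cartan_mu h) - snd (cartan_mu g)\<bar> \<le> 10 * ln R"
    unfolding fst_cartan_mu snd_cartan_mu[OF h] snd_cartan_mu[OF g] by linarith
  then have "dist (cartan_mu h) (cartan_mu g) \<le> 20 * ln R"
    using dist_prod_le[of "cartan_mu h" "cartan_mu g"] \<open>\<bar>fst _ - _\<bar> \<le> _\<close> ln_ge_zero[OF R] by linarith
  then show ?thesis by (simp add: h_def)
qed

lemma norm_orthogonal_mult:
  fixes k x :: "real^2^2"
  assumes "orthogonal_matrix k"
  shows "norm (k ** x) = norm x" "norm (x ** k) = norm x"
proof -
  obtain a b c d where k: "k = mat2 a b c d" by (rule mat2_cases)
  obtain p q r s where x: "x = mat2 p q r s" by (rule mat2_cases)
  have "transpose k = mat2 a c b d" by (simp add: k vec_eq_iff forall_2 transpose_def)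
  then have "mat2 a c b d ** mat2 a b c d = mat 1" "mat2 a b c d ** mat2 a c b d = mat 1"
    using assms by (simp_all add: orthogonal_matrix_def k)
  then have o: "a * a + c * c = 1" "a * b + c * d = 0" "b * b + d * d = 1"
    "a * a + b * b = 1" "a * c + b * d = 0" "c * c + d * d = 1"
    by (simp_all add: mat_1_eq_mat2 mat2_eq_iff)
  have "(norm (k ** x))\<^sup>2 = (a * a + c * c) * (p * p + q * q) + (b * b + d * d) * (r * r + s * s)
      + 2 * (a * b + c * d) * (p * r + q * s)"
    unfolding k x mat2_mult norm_mat2 by (simp add: power2_eq_square algebra_simps)
  then have "(norm (k ** x))\<^sup>2 = (norm x)\<^sup>2"
    unfolding x norm_mat2 o by (simp add: power2_eq_square)
  then show "norm (k ** x) = norm x" by simp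
  have "(norm (x ** k))\<^sup>2 = (a * a + b * b) * (p * p + r * r) + (c * c + d * d) * (q * q + s * s)
      + 2 * (a * c + b * d) * (p * q + r * s)"
    unfolding k x mat2_mult norm_mat2 by (simp add: power2_eq_square algebra_simps)
  then have "(norm (x ** k))\<^sup>2 = (norm x)\<^sup>2"
    unfolding x norm_mat2 o by (simp add: power2_eq_square)
  then show "norm (x ** k) = norm x" by simp
qed

text \<open>
  The inner product of the two columns of \<open>g r\<close>, for \<open>r\<close> the rotation by \<open>t\<close>, changes sign when \<open>t\<close>
  grows by a right angle, because the columns are then exchanged up to sign. The intermediate value theorem
  gives a rotation that makes them orthogonal.
\<close>

lemma orthogonal_columns_rotation:
  fixes g :: "real^2^2"
  obtains r a b c d where "orthogonal_matrix r" "g ** r = mat2 a b c d" "a * b + c * d = 0"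
proof -
  obtain p q r s where g: "g = mat2 p q r s" by (rule mat2_cases)
  define R where "R t = mat2 (cos t) (- sin t) (sin t) (cos t)" for t
  define f where "f t = (p * cos t + q * sin t) * (q * cos t - p * sin t)
      + (r * cos t + s * sin t) * (s * cos t - r * sin t)" for t
  have anti: "f (pi / 2) = - f 0" by (simp add: f_def algebra_simps)
  have cont: "continuous_on {0..pi/2} f" unfolding f_def by (intro continuous_intros)
  have "\<exists>t. f t = 0"
  proof (cases "f 0 \<le> 0")
    case True
    then show ?thesis using IVT'[of f 0 0 "pi/2"] anti cont by auto
  next
    case False
    then show ?thesis using IVT2'[of f "pi/2" 0 0] anti cont by auto
  qed
  then obtain t where t: "f t = 0" by blast
  have tr: "transpose (R t) = mat2 (cos t) (sin t) (- sin t) (cos t)"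
    by (simp add: R_def vec_eq_iff forall_2 transpose_def)
  have sc: "sin t * sin t + cos t * cos t = 1" "cos t * cos t + sin t * sin t = 1"
    using sin_cos_squared_add[of t] by (simp_all add: power2_eq_square add.commute)
  show thesis
  proof (rule that)
    show "orthogonal_matrix (R t)"
      unfolding orthogonal_matrix_def tr by (simp add: R_def sc mat_1_eq_mat2)
    show "g ** R t = mat2 (p * cos t + q * sin t) (q * cos t - p * sin t)
        (r * cos t + s * sin t) (s * cos t - r * sin t)"
      by (simp add: g R_def)
    show "(p * cos t + q * sin t) * (q * cos t - p * sin t)
        + (r * cos t + s * sin t) * (s * cos t - r * sin t) = 0"
      using t by (simp add: f_def)
  qed
qed

lemma orthogonal_transpose_cancel:
  fixes k x :: "real^2^2"
  assumes "orthogonal_matrix k"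
  shows "k ** transpose k = mat 1" "transpose k ** k = mat 1"
    "k ** (transpose k ** x) = x" "transpose k ** (k ** x) = x"
  using assms by (auto simp: orthogonal_matrix_def matrix_mul_assoc)

text \<open>
  Normalizing orthogonal columns exhibits \<open>g r\<close> as an orthogonal matrix times a diagonal one.
\<close>

lemma singular_value_decomposition:
  fixes g :: "real^2^2"
  assumes "invertible g"
  obtains k s t k' where "orthogonal_matrix k" "orthogonal_matrix k'" "0 < t" "t \<le> s"
    "g = k ** mat2 s 0 0 t ** k'"
proof -
  obtain r a b c d where r: "orthogonal_matrix r" and gr: "g ** r = mat2 a b c d"
    and ort: "a * b + c * d = 0" by (rule orthogonal_columns_rotation)
  have "invertible r" using r by (auto simp: orthogonal_matrix_def invertible_def)
  then have "invertible (mat2 a b c d)" using assms by (simp flip: gr add: invertible_mult)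
  then have D: "a * d - b * c \<noteq> 0" by (simp add: invertible_mat2)
  define s where "s = sqrt (a * a + c * c)"
  define t where "t = sqrt (b * b + d * d)"
  have "a \<noteq> 0 \<or> c \<noteq> 0" "b \<noteq> 0 \<or> d \<noteq> 0" using D by auto
  then have pos: "0 < s" "0 < t"
    by (simp_all add: s_def t_def sum_squares_gt_zero_iff)
  have sq: "s * s = a * a + c * c" "t * t = b * b + d * d"
    by (simp_all add: s_def t_def)
  define k where "k = mat2 (a / s) (b / t) (c / s) (d / t)"
  have tk: "transpose k = mat2 (a / s) (c / s) (b / t) (d / t)"
    by (simp add: k_def vec_eq_iff forall_2 transpose_def)
  have "transpose k ** k = mat2 ((a * a + c * c) / (s * s)) ((a * b + c * d) / (s * t))
      ((a * b + c * d) / (s * t)) ((b * b + d * d) / (t * t))"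
    unfolding tk unfolding k_def by (simp add: mat2_eq_iff add_divide_distrib mult.commute)
  also have "\<dots> = mat 1" using pos by (simp add: ort mat_1_eq_mat2 flip: sq)
  finally have ok: "orthogonal_matrix k" by (simp add: orthogonal_matrix)
  have "k ** mat2 s 0 0 t = g ** r" using pos by (simp add: k_def gr)
  then have g: "g = k ** mat2 s 0 0 t ** transpose r"
    by (metis matrix_mul_assoc matrix_mul_rid orthogonal_transpose_cancel(1)[OF r])
  have or: "orthogonal_matrix (transpose r)" using r by (simp add: orthogonal_matrix_def)
  show thesis
  proof (cases "t \<le> s")
    case True
    then show ?thesis using that[OF ok or _ _ g] pos by simp
  next
    case False
    \<comment> \<open>The permutation matrix exchanges the two diagonal entries.\<close>
    define J where "J = mat2 0 1 1 0"
    have "transpose J = J" by (simp add: J_def vec_eq_iff forall_2 transpose_def)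
    then have oJ: "orthogonal_matrix J" by (simp add: orthogonal_matrix_def J_def mat_1_eq_mat2)
    have "mat2 s 0 0 t = J ** mat2 t 0 0 s ** J" by (simp add: J_def)
    then have "g = (k ** J) ** mat2 t 0 0 s ** (J ** transpose r)"
      by (simp add: g matrix_mul_assoc)
    then show ?thesis
      using that[OF orthogonal_matrix_mul[OF ok oJ] orthogonal_matrix_mul[OF oJ or], of s t] pos False
      by simp
  qed
qed

lemma abs_det_orthogonal: "orthogonal_matrix k \<Longrightarrow> \<bar>det k\<bar> = 1" for k :: "real^2^2"
  using det_orthogonal_matrix[of k] by auto

text \<open>
  If \<open>l = k a k'\<close> and \<open>h = m b m'\<close> are singular value decompositions, then \<open>l = c h d\<inverse>\<close> for
  \<open>c = k (a b\<inverse>) m\<^sup>T\<close> and \<open>d = k'\<^sup>T m'\<close>. Only the diagonal factor \<open>a b\<inverse>\<close> is not orthogonal, and its entries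
  are controlled by the distance of \<open>\<mu>(l)\<close> and \<open>\<mu>(h)\<close>, because the larger singular value is comparable to
  the norm and the product of the two is the determinant.
\<close>

lemma GL2_ball_connects_nearby_mu:
  assumes l: "invertible l" and h: "invertible h" and r: "dist (cartan_mu l) (cartan_mu h) \<le> r"
  shows "\<exists>c\<in>GL2_ball (4 * exp (2 * r)). \<exists>d\<in>GL2_ball (4 * exp (2 * r)). l = c ** h ** matrix_inv d"
proof -
  obtain k s t k' where k: "orthogonal_matrix k" "orthogonal_matrix k'" and st: "0 < t" "t \<le> s"
    and ld: "l = k ** mat2 s 0 0 t ** k'" by (rule singular_value_decomposition[OF l])
  obtain m u v m' where m: "orthogonal_matrix m" "orthogonal_matrix m'" and uv: "0 < v" "v \<le> u"
    and hd: "h = m ** mat2 u 0 0 v ** m'" by (rule singular_value_decomposition[OF h])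
  have tr: "orthogonal_matrix (transpose m)" "orthogonal_matrix (transpose k')"
    using k m by (simp_all add: orthogonal_matrix_def)
  define c where "c = k ** mat2 (s / u) 0 0 (t / v) ** transpose m"
  define d where "d = transpose k' ** m'"
  have s0: "0 < s" and u0: "0 < u" using st uv by auto
  have od: "orthogonal_matrix d" unfolding d_def using tr m by (intro orthogonal_matrix_mul)
  have dinv: "matrix_inv d = transpose m' ** k'"
    by (rule matrix_inv_unique)
      (simp add: d_def orthogonal_transpose_cancel[OF m(2)] orthogonal_transpose_cancel[OF k(2)]
        flip: matrix_mul_assoc)
  have dd: "mat2 (s / u) 0 0 (t / v) ** mat2 u 0 0 v = mat2 s 0 0 t" using u0 uv by simp
  have dd': "mat2 (s / u) 0 0 (t / v) ** (mat2 u 0 0 v ** x) = mat2 s 0 0 t ** x" for x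
    unfolding matrix_mul_assoc dd ..
  have eq: "l = c ** h ** matrix_inv d"
    unfolding ld c_def hd dinv
    by (simp add: orthogonal_transpose_cancel[OF m(2)] orthogonal_transpose_cancel[OF m(1)] dd'
        flip: matrix_mul_assoc)
  have r0: "0 \<le> r" using r zero_le_dist order_trans by blast
  have nl: "(norm l)\<^sup>2 = s\<^sup>2 + t\<^sup>2" and nh: "(norm h)\<^sup>2 = u\<^sup>2 + v\<^sup>2"
    unfolding ld hd norm_orthogonal_mult[OF k(1)] norm_orthogonal_mult[OF k(2)]
      norm_orthogonal_mult[OF m(1)] norm_orthogonal_mult[OF m(2)] norm_mat2 by simp_all
  have dl: "\<bar>det l\<bar> = s * t" and dh: "\<bar>det h\<bar> = u * v"
    unfolding ld hd det_mul abs_mult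
    using abs_det_orthogonal k m st uv s0 u0 by (simp_all add: abs_mult)
  have "\<bar>fst (cartan_mu l) - fst (cartan_mu h)\<bar> \<le> r" "\<bar>snd (cartan_mu l) - snd (cartan_mu h)\<bar> \<le> r"
    using dist_fst_le[of "cartan_mu l" "cartan_mu h"] dist_snd_le[of "cartan_mu l" "cartan_mu h"] r
    by (simp_all add: dist_real_def)
  then have ds: "\<bar>ln (s * t) - ln (u * v)\<bar> \<le> r" "\<bar>2 * ln (norm l) - 2 * ln (norm h)\<bar> \<le> 2 * r"
    unfolding fst_cartan_mu snd_cartan_mu[OF l] snd_cartan_mu[OF h] dl dh by linarith+
  have pos: "0 < norm l" "0 < norm h" using l h invertible_norm_pos by auto
  have "ln (s * t) \<le> r + ln (u * v)" "ln (u * v) \<le> r + ln (s * t)" using ds by linarith+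
  then have "exp (ln (s * t)) \<le> exp (r + ln (u * v))" "exp (ln (u * v)) \<le> exp (r + ln (s * t))" by simp_all
  then have p: "s * t \<le> exp r * (u * v)" "u * v \<le> exp r * (s * t)"
    using st uv s0 u0 by (simp_all add: exp_add)
  have "ln (norm l) \<le> r + ln (norm h)" "ln (norm h) \<le> r + ln (norm l)" using ds by linarith+
  then have "exp (ln (norm l)) \<le> exp (r + ln (norm h))" "exp (ln (norm h)) \<le> exp (r + ln (norm l))" by simp_all
  then have n: "norm l \<le> exp r * norm h" "norm h \<le> exp r * norm l"
    using pos by (simp_all add: exp_add)
  have big: "s \<le> norm l" "norm l \<le> 2 * s" "u \<le> norm h" "norm h \<le> 2 * u"
  proof -
    show "s \<le> norm l" by (rule power2_le_imp_le) (simp_all add: nl)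
    show "u \<le> norm h" by (rule power2_le_imp_le) (simp_all add: nh)
    have "t\<^sup>2 \<le> s\<^sup>2" "v\<^sup>2 \<le> u\<^sup>2" using st uv by (auto intro: power_mono)
    then have "t\<^sup>2 \<le> 3 * s\<^sup>2" "v\<^sup>2 \<le> 3 * u\<^sup>2"
      using zero_le_power2[of s] zero_le_power2[of u] by linarith+
    then have "(norm l)\<^sup>2 \<le> (2 * s)\<^sup>2" "(norm h)\<^sup>2 \<le> (2 * u)\<^sup>2"
      unfolding nl nh power_mult_distrib by simp_all
    then show "norm l \<le> 2 * s" "norm h \<le> 2 * u" using s0 u0 by (auto intro: power2_le_imp_le)
  qed
  have "s \<le> exp r * (2 * u)" using big n mult_left_mono[OF big(4) exp_ge_zero, of r] by linarith
  then have su: "s / u \<le> 2 * exp r" using u0 by (simp add: divide_le_eq algebra_simps)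
  have "u \<le> exp r * (2 * s)" using big n mult_left_mono[OF big(2) exp_ge_zero, of r] by linarith
  then have us: "u / s \<le> 2 * exp r" using s0 by (simp add: divide_le_eq algebra_simps)
  have "t / v = (s * t) / (u * v) * (u / s)" using s0 u0 by simp
  also have "\<dots> \<le> exp r * (2 * exp r)"
    using p us s0 u0 st uv by (intro mult_mono) (auto simp: divide_le_eq)
  finally have tv: "t / v \<le> 2 * exp (2 * r)" by (simp add: exp_double power2_eq_square)
  have "exp r \<le> exp (2 * r)" using r0 by simp
  then have su': "s / u \<le> 2 * exp (2 * r)" using su by linarith
  have pq: "0 < s / u" "0 < t / v" using s0 u0 st uv by simp_all
  have "(norm c)\<^sup>2 = (s / u)\<^sup>2 + (t / v)\<^sup>2"
    unfolding c_def norm_orthogonal_mult[OF k(1)] norm_orthogonal_mult[OF tr(1)] norm_mat2 by simp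
  also have "\<dots> \<le> (s / u + t / v)\<^sup>2"
    using mult_pos_pos[OF pq] unfolding power2_sum by (simp only: mult.assoc)
  finally have "norm c \<le> s / u + t / v"
    by (rule power2_le_imp_le) (use pq in simp)
  also have "\<dots> \<le> 4 * exp (2 * r)" using su' tv by linarith
  finally have nc: "norm c \<le> 4 * exp (2 * r)" .
  have dc: "\<bar>det c\<bar> = (s * t) / (u * v)"
    unfolding c_def det_mul abs_mult
    unfolding abs_det_orthogonal[OF k(1)] abs_det_orthogonal[OF tr(1)] det_mat2
    using mult_pos_pos[OF s0 st(1)] mult_pos_pos[OF u0 uv(1)] by simp
  have "0 < u * v" using u0 uv by simp
  then have "1 \<le> exp r * (s * t) / (u * v)" using p(2) by (simp only: le_divide_eq_1_pos)
  then have "1 \<le> exp r * \<bar>det c\<bar>" unfolding dc by simp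
  also have "\<dots> \<le> 4 * exp (2 * r) * \<bar>det c\<bar>"
  proof (rule mult_right_mono)
    show "exp r \<le> 4 * exp (2 * r)" using \<open>exp r \<le> exp (2 * r)\<close> exp_gt_zero[of "2 * r"] by linarith
  qed simp
  finally have "c \<in> GL2_ball (4 * exp (2 * r))" using nc by (simp add: GL2_ball_def)
  moreover have "d \<in> GL2_ball (4 * exp (2 * r))"
  proof -
    have "norm d = norm (mat 1 :: real^2^2)" using norm_orthogonal_mult(1)[OF od, of "mat 1"] by simp
    moreover have "(norm (mat 1 :: real^2^2))\<^sup>2 \<le> 2\<^sup>2" unfolding mat_1_eq_mat2 norm_mat2 by simp
    then have "norm (mat 1 :: real^2^2) \<le> 2" by (rule power2_le_imp_le) simp
    ultimately have "norm d \<le> 2" by simp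
    moreover have "1 \<le> exp (2 * r)" using r0 by simp
    ultimately have "norm d \<le> 4 * exp (2 * r)" "1 \<le> 4 * exp (2 * r)" by linarith+
    then show ?thesis using abs_det_orthogonal[OF od] by (simp add: GL2_ball_def)
  qed
  ultimately show ?thesis using eq by blast
qed

lemma sandwich_GL2:
  assumes "C \<subseteq> {g. invertible g}"
  shows "sandwich GL2 C H = {c ** h ** matrix_inv d | c h d. c \<in> C \<and> h \<in> H \<and> d \<in> C}"
proof -
  have "c \<otimes>\<^bsub>GL2\<^esub> h \<otimes>\<^bsub>GL2\<^esub> inv\<^bsub>GL2\<^esub> d = c ** h ** matrix_inv d" if "d \<in> C" for c h d
    using assms that by auto
  then show ?thesis unfolding sandwich_def by (intro Collect_cong iff_exI) auto
qed

lemma sandwich_imp_close: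
  assumes "compactin GL2_top C" "H \<subseteq> carrier GL2"
  obtains R where "\<And>l. l \<in> sandwich GL2 C H \<Longrightarrow> \<exists>h\<in>H. dist (cartan_mu l) (cartan_mu h) \<le> R"
proof -
  obtain R where R: "1 \<le> R" "C \<subseteq> GL2_ball R" using compactin_GL2_top_imp_ball[OF assms(1)] by blast
  have "\<exists>h\<in>H. dist (cartan_mu l) (cartan_mu h) \<le> 20 * ln R" if l: "l \<in> sandwich GL2 C H" for l
  proof -
    have "C \<subseteq> {g. invertible g}" using assms(1) by (simp add: compactin_GL2_top)
    then obtain c h d where "c \<in> C" "h \<in> H" "d \<in> C" "l = c ** h ** matrix_inv d"
      using l unfolding sandwich_GL2[OF \<open>C \<subseteq> {g. invertible g}\<close>] by blast
    moreover have "invertible h" using \<open>h \<in> H\<close> assms(2) by auto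
    ultimately show ?thesis using cartan_mu_two_sided_bound R by blast
  qed
  then show thesis using that by blast
qed

lemma close_imp_sandwich:
  assumes "invertible l" "h \<in> H" "H \<subseteq> carrier GL2" "dist (cartan_mu l) (cartan_mu h) \<le> R"
  shows "l \<in> sandwich GL2 (GL2_ball (4 * exp (2 * R))) H"
proof -
  have "invertible h" using assms by auto
  then show ?thesis
    using GL2_ball_connects_nearby_mu[OF assms(1) _ assms(4)] assms(2)
    by (subst sandwich_GL2) (auto simp: GL2_ball_invertible)
qed

theorem sim_GL2_iff_near:
  assumes L: "L \<subseteq> carrier GL2" and H: "H \<subseteq> carrier GL2"
  shows "sim_GL2 L H \<longleftrightarrow> near (cartan_mu ` L) (cartan_mu ` H) \<and> near (cartan_mu ` H) (cartan_mu ` L)"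
proof
  assume "sim_GL2 L H"
  then obtain C where C: "compactin GL2_top C" "L \<subseteq> sandwich GL2 C H" "H \<subseteq> sandwich GL2 C L"
    by (auto simp: sim_in_def)
  show "near (cartan_mu ` L) (cartan_mu ` H) \<and> near (cartan_mu ` H) (cartan_mu ` L)"
  proof
    obtain R where "\<And>l. l \<in> sandwich GL2 C H \<Longrightarrow> \<exists>h\<in>H. dist (cartan_mu l) (cartan_mu h) \<le> R"
      using sandwich_imp_close[OF C(1) H] by blast
    then show "near (cartan_mu ` L) (cartan_mu ` H)"
      unfolding near_def using C(2) by (intro exI[of _ R]) auto
    obtain R where "\<And>l. l \<in> sandwich GL2 C L \<Longrightarrow> \<exists>h\<in>L. dist (cartan_mu l) (cartan_mu h) \<le> R"
      using sandwich_imp_close[OF C(1) L] by blast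
    then show "near (cartan_mu ` H) (cartan_mu ` L)"
      unfolding near_def using C(3) by (intro exI[of _ R]) auto
  qed
next
  assume "near (cartan_mu ` L) (cartan_mu ` H) \<and> near (cartan_mu ` H) (cartan_mu ` L)"
  then obtain R1 R2 where R: "\<forall>l\<in>L. \<exists>h\<in>H. dist (cartan_mu l) (cartan_mu h) \<le> R1"
    "\<forall>h\<in>H. \<exists>l\<in>L. dist (cartan_mu h) (cartan_mu l) \<le> R2"
    by (auto simp: near_def)
  define R where "R = max R1 R2"
  have "L \<subseteq> sandwich GL2 (GL2_ball (4 * exp (2 * R))) H"
  proof
    fix l assume l: "l \<in> L"
    then obtain h where "h \<in> H" "dist (cartan_mu l) (cartan_mu h) \<le> R1" using R by blast
    then show "l \<in> sandwich GL2 (GL2_ball (4 * exp (2 * R))) H"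
      using l L H by (intro close_imp_sandwich[of _ h]) (auto simp: R_def)
  qed
  moreover have "H \<subseteq> sandwich GL2 (GL2_ball (4 * exp (2 * R))) L"
  proof
    fix h assume h: "h \<in> H"
    then obtain l where "l \<in> L" "dist (cartan_mu h) (cartan_mu l) \<le> R2" using R by blast
    then show "h \<in> sandwich GL2 (GL2_ball (4 * exp (2 * R))) L"
      using h L H by (intro close_imp_sandwich[of _ l]) (auto simp: R_def)
  qed
  ultimately
  show "sim_GL2 L H" unfolding sim_in_def using compactin_GL2_ball by blast
qed

theorem proper_GL2_iff_coarsely_proper:
  assumes L: "L \<subseteq> carrier GL2" and H: "H \<subseteq> carrier GL2"
  shows "proper_GL2 L H \<longleftrightarrow> coarsely_proper (cartan_mu ` L) (cartan_mu ` H)"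
  unfolding coarsely_proper_def
proof
  assume P: "proper_GL2 L H"
  show "\<forall>R. bounded {a \<in> cartan_mu ` L. \<exists>b\<in>cartan_mu ` H. dist a b \<le> R}"
  proof
    fix R
    define C where "C = GL2_ball (4 * exp (2 * R))"
    have "relatively_compact_in GL2_top (L \<inter> sandwich GL2 C H)"
      using P compactin_GL2_ball by (simp add: proper_pair_def C_def)
    then have "bounded (cartan_mu ` (L \<inter> sandwich GL2 C H))"
      using L by (subst (asm) relatively_compact_in_GL2_iff) auto
    then show "bounded {a \<in> cartan_mu ` L. \<exists>b\<in>cartan_mu ` H. dist a b \<le> R}"
      by (rule bounded_subset)
        (use close_imp_sandwich[OF _ _ H, of _ _ R] L in \<open>auto simp: C_def intro!: imageI\<close>)
  qed
next
  assume B: "\<forall>R. bounded {a \<in> cartan_mu ` L. \<exists>b\<in>cartan_mu ` H. dist a b \<le> R}"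
  show "proper_GL2 L H"
    unfolding proper_pair_def
  proof (intro allI impI)
    fix C assume C: "compactin GL2_top C"
    obtain R where R: "\<And>l. l \<in> sandwich GL2 C H \<Longrightarrow> \<exists>h\<in>H. dist (cartan_mu l) (cartan_mu h) \<le> R"
      using sandwich_imp_close[OF C H] by blast
    have "bounded (cartan_mu ` (L \<inter> sandwich GL2 C H))"
      using B[rule_format, of R] by (rule bounded_subset) (use R in auto)
    then show "relatively_compact_in GL2_top (L \<inter> sandwich GL2 C H)"
      using L by (subst relatively_compact_in_GL2_iff) auto
  qed
qed

section \<open>Coarse geometry of subsets of the plane\<close>

lemma abs_fst_diff_le: "dist x y \<le> r \<Longrightarrow> \<bar>fst x - fst y\<bar> \<le> r" for x y :: "real \<times> real"
  using dist_fst_le[of x y] by (simp add: dist_real_def)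

lemma abs_snd_diff_le: "dist x y \<le> r \<Longrightarrow> \<bar>snd x - snd y\<bar> \<le> r" for x y :: "real \<times> real"
  using dist_snd_le[of x y] by (simp add: dist_real_def)

lemma nearI: "(\<And>a. a \<in> A \<Longrightarrow> \<exists>b\<in>B. dist a b \<le> R) \<Longrightarrow> near A B"
  unfolding near_def by blast

lemma near_subset: "A \<subseteq> B \<Longrightarrow> near A B"
  by (rule nearI[of _ _ 0]) (metis dist_self order_refl subsetD)

lemma near_trans:
  assumes "near A B" "near B C" shows "near A C"
proof -
  obtain r s where r: "\<And>a. a \<in> A \<Longrightarrow> \<exists>b\<in>B. dist a b \<le> r" and s: "\<And>b. b \<in> B \<Longrightarrow> \<exists>c\<in>C. dist b c \<le> s"
    using assms unfolding near_def by metis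
  show ?thesis
  proof (rule nearI[of _ _ "r + s"])
    fix a assume "a \<in> A"
    then obtain b where "b \<in> B" "dist a b \<le> r" using r by blast
    moreover obtain c where "c \<in> C" "dist b c \<le> s" using s \<open>b \<in> B\<close> by blast
    ultimately show "\<exists>c\<in>C. dist a c \<le> r + s" using dist_triangle[of a c b] by (intro bexI[of _ c]) auto
  qed
qed

lemma near_bounded: "near A B \<Longrightarrow> bounded B \<Longrightarrow> bounded A"
proof -
  assume "near A B" "bounded B"
  then obtain r M where r: "\<And>a. a \<in> A \<Longrightarrow> \<exists>b\<in>B. dist a b \<le> r" and M: "\<And>b. b \<in> B \<Longrightarrow> dist 0 b \<le> M"
    unfolding near_def bounded_any_center[of _ 0] by blast
  have "dist 0 a \<le> M + r" if "a \<in> A" for a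
  proof -
    obtain b where "b \<in> B" "dist a b \<le> r" using r \<open>a \<in> A\<close> by blast
    then show ?thesis using M[of b] dist_triangle[of 0 a b] by (simp add: dist_commute)
  qed
  then show "bounded A" unfolding bounded_any_center[of _ 0] by blast
qed

lemma coarsely_proper_sym:
  assumes "coarsely_proper A B" shows "coarsely_proper B A"
  unfolding coarsely_proper_def
proof
  fix R
  show "bounded {b \<in> B. \<exists>a\<in>A. dist b a \<le> R}"
  proof (rule near_bounded)
    show "bounded {a \<in> A. \<exists>b\<in>B. dist a b \<le> R}" using assms by (simp add: coarsely_proper_def)
    show "near {b \<in> B. \<exists>a\<in>A. dist b a \<le> R} {a \<in> A. \<exists>b\<in>B. dist a b \<le> R}"
      by (rule nearI[of _ _ R]) (auto simp: dist_commute)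
  qed
qed

lemma coarsely_proper_mono:
  assumes P: "coarsely_proper A B" and A: "near A' A" and B: "near B' B"
  shows "coarsely_proper A' B'"
  unfolding coarsely_proper_def
proof
  fix R
  obtain r where r: "\<And>a. a \<in> A' \<Longrightarrow> \<exists>b\<in>A. dist a b \<le> r" using A unfolding near_def by blast
  obtain s where s: "\<And>a. a \<in> B' \<Longrightarrow> \<exists>b\<in>B. dist a b \<le> s" using B unfolding near_def by blast
  show "bounded {a \<in> A'. \<exists>b\<in>B'. dist a b \<le> R}"
  proof (rule near_bounded)
    show "bounded {a \<in> A. \<exists>b\<in>B. dist a b \<le> R + r + s}" using P by (simp add: coarsely_proper_def)
    show "near {a \<in> A'. \<exists>b\<in>B'. dist a b \<le> R} {a \<in> A. \<exists>b\<in>B. dist a b \<le> R + r + s}"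
    proof (rule nearI)
      fix a' assume "a' \<in> {a \<in> A'. \<exists>b\<in>B'. dist a b \<le> R}"
      then obtain b' where a': "a' \<in> A'" and b': "b' \<in> B'" "dist a' b' \<le> R" by blast
      obtain a where a: "a \<in> A" "dist a' a \<le> r" using r a' by blast
      obtain b where b: "b \<in> B" "dist b' b \<le> s" using s b' by blast
      have "dist a b \<le> R + r + s"
        using dist_triangle[of a b a'] dist_triangle[of a' b b'] a b b' by (simp add: dist_commute)
      then show "\<exists>b\<in>{a \<in> A. \<exists>b\<in>B. dist a b \<le> R + r + s}. dist a' b \<le> r" using a b by blast
    qed
  qed
qed

lemma coarsely_proper_near_imp_bounded:
  assumes "coarsely_proper A B" "near A B" shows "bounded A"
proof -
  obtain r where r: "\<And>a. a \<in> A \<Longrightarrow> \<exists>b\<in>B. dist a b \<le> r" using assms(2) unfolding near_def by blast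
  have "bounded {a \<in> A. \<exists>b\<in>B. dist a b \<le> r}" using assms(1) by (simp add: coarsely_proper_def)
  then show ?thesis by (rule bounded_subset) (use r in blast)
qed

definition coarse_eq :: "(real \<times> real) set \<Rightarrow> (real \<times> real) set \<Rightarrow> bool" where
  "coarse_eq A B \<longleftrightarrow> near A B \<and> near B A"

lemma coarse_eq_refl: "coarse_eq A A"
  by (simp add: coarse_eq_def near_subset)

lemma coarse_eq_sym: "coarse_eq A B \<Longrightarrow> coarse_eq B A"
  by (simp add: coarse_eq_def)

lemma coarse_eq_trans: "coarse_eq A B \<Longrightarrow> coarse_eq B C \<Longrightarrow> coarse_eq A C"
  unfolding coarse_eq_def by (meson near_trans)

lemma coarsely_proper_cong:
  assumes "coarse_eq A A'" "coarse_eq B B'"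
  shows "coarsely_proper A B \<longleftrightarrow> coarsely_proper A' B'"
  using assms coarsely_proper_mono unfolding coarse_eq_def by blast

section \<open>Cartan projections of the model groups\<close>

text \<open>
  The regions at finite Hausdorff distance from the images under \<open>\<mu>\<close> of the trivial group, of \<open>Z\<close>, \<open>U\<close>,
  \<open>A(\<alpha>)\<close>, \<open>B(\<alpha>)\<close> and of \<open>GL\<^sub>2\<close>. For \<open>\<alpha> = 0\<close> both \<open>plane_A\<close> and
  \<open>plane_B\<close> are the vertical ray.
\<close>

definition plane_1 :: "(real \<times> real) set" where "plane_1 = {(0, 0)}"
definition plane_Z :: "(real \<times> real) set" where "plane_Z = {(x, 0) | x. True}"
definition plane_U :: "(real \<times> real) set" where "plane_U = {(x, ln (1 + x\<^sup>2)) | x. True}"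
definition plane_A :: "real \<Rightarrow> (real \<times> real) set" where "plane_A \<alpha> = {(\<alpha> * s, \<bar>s\<bar>) | s. True}"
definition plane_B :: "real \<Rightarrow> (real \<times> real) set" where
  "plane_B \<alpha> = {(x, y). 0 \<le> y \<and> \<bar>x\<bar> \<le> \<bar>\<alpha>\<bar> * y}"
definition plane_G :: "(real \<times> real) set" where "plane_G = {(x, y). 0 \<le> y}"
definition plane_models :: "(real \<times> real) set set" where
  "plane_models = {plane_1, plane_G, plane_Z, plane_U} \<union> range plane_A \<union> range plane_B"

lemma cartan_mu_lower_triangular:
  "cartan_mu (mat2 (exp x) 0 s (exp y)) =
     (x + y, ln (exp (x - y) + exp (y - x) + s\<^sup>2 * exp (- x - y)))"
proof -
  have "(exp x)\<^sup>2 / exp (x + y) = exp (x - y)" "(exp y)\<^sup>2 / exp (x + y) = exp (y - x)"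
    by (simp_all add: power2_eq_square flip: exp_add exp_diff)
  moreover have "s\<^sup>2 / exp (x + y) = s\<^sup>2 * exp (- x - y)"
    using exp_minus[of "x + y"] by (simp add: divide_inverse)
  ultimately have "((exp x)\<^sup>2 + 0\<^sup>2 + s\<^sup>2 + (exp y)\<^sup>2) / exp (x + y) = exp (x - y) + exp (y - x) + s\<^sup>2 * exp (- x - y)"
    by (simp add: add_divide_distrib)
  moreover have "det (mat2 (exp x) 0 s (exp y)) = exp (x + y)" by (simp add: exp_add)
  ultimately show ?thesis
    unfolding cartan_mu_def norm_mat2 by simp
qed

lemma ln_between:
  fixes a x c :: real
  assumes "exp a \<le> x" "x \<le> c * exp a" "1 \<le> c" shows "\<bar>ln x - a\<bar> \<le> ln c"
proof -
  have "0 < x" using assms(1) exp_gt_zero[of a] by linarith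
  have "ln (exp a) \<le> ln x" using assms \<open>0 < x\<close> by (subst ln_le_cancel_iff) auto
  moreover have "ln x \<le> ln (c * exp a)" using assms \<open>0 < x\<close> by (subst ln_le_cancel_iff) auto
  moreover have "ln (c * exp a) = ln c + a" using assms(3) by (simp add: ln_mult)
  ultimately show ?thesis using ln_ge_zero[OF assms(3)] by (simp only: ln_exp)
qed

lemma ln_cosh_between: "\<bar>ln (exp x + exp (- x)) - \<bar>x\<bar>\<bar> \<le> ln 2" for x :: real
proof (rule ln_between)
  have "exp x \<le> exp \<bar>x\<bar>" "exp (- x) \<le> exp \<bar>x\<bar>" by simp_all
  then show "exp x + exp (- x) \<le> 2 * exp \<bar>x\<bar>" by linarith
  show "exp \<bar>x\<bar> \<le> exp x + exp (- x)" by (cases "0 \<le> x") simp_all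
qed simp

lemma dist_same_fst: "dist (x, y) (x, y') = \<bar>y - y'\<bar>" for y y' :: real
  by (simp add: dist_Pair_Pair dist_real_def)

lemma cartan_mu_Z: "coarse_eq (cartan_mu ` Z_grp) plane_Z"
proof -
  have mu: "cartan_mu (mat2 (exp t) 0 0 (exp t)) = (2 * t, ln 2)" for t
    by (simp add: cartan_mu_lower_triangular)
  have "near (cartan_mu ` Z_grp) plane_Z"
  proof (rule nearI[of _ _ "ln 2"])
    fix a assume "a \<in> cartan_mu ` Z_grp"
    then obtain t where "a = (2 * t, ln 2)" by (auto simp: Z_grp_def mu)
    then show "\<exists>b\<in>plane_Z. dist a b \<le> ln 2"
      by (intro bexI[of _ "(2 * t, 0)"]) (auto simp: plane_Z_def dist_same_fst)
  qed
  moreover have "near plane_Z (cartan_mu ` Z_grp)"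
  proof (rule nearI[of _ _ "ln 2"])
    fix a assume "a \<in> plane_Z"
    then obtain x where a: "a = (x, 0)" by (auto simp: plane_Z_def)
    have "cartan_mu (mat2 (exp (x/2)) 0 0 (exp (x/2))) \<in> cartan_mu ` Z_grp"
      by (intro imageI) (auto simp: Z_grp_def)
    then show "\<exists>b\<in>cartan_mu ` Z_grp. dist a b \<le> ln 2"
      by (rule bexI[rotated]) (simp add: mu a dist_same_fst)
  qed
  ultimately show ?thesis by (simp add: coarse_eq_def)
qed

lemma ln_quadratic_between: "\<bar>ln (2 + t\<^sup>2) - ln (1 + (2 * t)\<^sup>2)\<bar> \<le> ln 4" for t :: real
proof -
  have p: "0 < 2 + t\<^sup>2" "0 < 1 + (2 * t)\<^sup>2" by (auto intro: add_pos_nonneg)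
  have "2 + t\<^sup>2 \<le> 4 * (1 + (2 * t)\<^sup>2)" "1 + (2 * t)\<^sup>2 \<le> 4 * (2 + t\<^sup>2)"
    using zero_le_power2[of t] unfolding power_mult_distrib by simp_all
  then have "ln (2 + t\<^sup>2) \<le> ln (4 * (1 + (2 * t)\<^sup>2))" "ln (1 + (2 * t)\<^sup>2) \<le> ln (4 * (2 + t\<^sup>2))"
    using p by (subst ln_le_cancel_iff; simp)+
  then have "ln (2 + t\<^sup>2) \<le> ln 4 + ln (1 + (2 * t)\<^sup>2)" "ln (1 + (2 * t)\<^sup>2) \<le> ln 4 + ln (2 + t\<^sup>2)"
    using p by (simp_all only: ln_mult_pos zero_less_numeral)
  then show ?thesis by linarith
qed

lemma cartan_mu_U: "coarse_eq (cartan_mu ` U_grp) plane_U"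
proof -
  have mu: "cartan_mu (mat2 (exp t) 0 (t * exp t) (exp t)) = (2 * t, ln (2 + t\<^sup>2))" for t
  proof -
    have "(t * exp t)\<^sup>2 * exp (- t - t) = t\<^sup>2 * exp (t + t + (- t - t))"
      unfolding exp_add by (simp add: power2_eq_square)
    then show ?thesis by (simp add: cartan_mu_lower_triangular)
  qed
  have d: "dist (2 * t, ln (2 + t\<^sup>2)) (2 * t, ln (1 + (2 * t)\<^sup>2)) \<le> ln 4" for t :: real
    unfolding dist_same_fst by (rule ln_quadratic_between)
  have "near (cartan_mu ` U_grp) plane_U"
  proof (rule nearI[of _ _ "ln 4"])
    fix a assume "a \<in> cartan_mu ` U_grp"
    then obtain t where "a = (2 * t, ln (2 + t\<^sup>2))" by (auto simp: U_grp_def mu)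
    then show "\<exists>b\<in>plane_U. dist a b \<le> ln 4"
      using d[of t] by (intro bexI[of _ "(2 * t, ln (1 + (2 * t)\<^sup>2))"]) (auto simp: plane_U_def)
  qed
  moreover have "near plane_U (cartan_mu ` U_grp)"
  proof (rule nearI[of _ _ "ln 4"])
    fix a assume "a \<in> plane_U"
    then obtain x where a: "a = (x, ln (1 + x\<^sup>2))" by (auto simp: plane_U_def)
    define t where "t = x / 2"
    have x: "x = 2 * t" by (simp add: t_def)
    have "cartan_mu (mat2 (exp t) 0 (t * exp t) (exp t)) \<in> cartan_mu ` U_grp"
      by (intro imageI) (auto simp: U_grp_def)
    then show "\<exists>b\<in>cartan_mu ` U_grp. dist a b \<le> ln 4"
      by (rule bexI[rotated]) (use d[of t] in \<open>simp add: mu a dist_commute x\<close>)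
  qed
  ultimately show ?thesis by (simp add: coarse_eq_def)
qed

lemma cartan_mu_A: "coarse_eq (cartan_mu ` A_grp \<alpha>) (plane_A \<alpha>)"
proof -
  define g where "g t = mat2 (exp ((\<alpha> + 1) * t)) 0 0 (exp ((\<alpha> - 1) * t))" for t
  have A: "A_grp \<alpha> = range g" by (auto simp: A_grp_def g_def)
  have d: "dist (cartan_mu (g t)) (\<alpha> * (2 * t), \<bar>2 * t\<bar>) \<le> ln 2" for t
  proof -
    have "cartan_mu (g t) = (\<alpha> * (2 * t), ln (exp (2 * t) + exp (- (2 * t))))"
      by (simp add: g_def cartan_mu_lower_triangular algebra_simps)
    then show ?thesis using ln_cosh_between[of "2 * t"] by (simp add: dist_same_fst)
  qed
  have "near (cartan_mu ` A_grp \<alpha>) (plane_A \<alpha>)"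
  proof (rule nearI[of _ _ "ln 2"])
    fix a assume "a \<in> cartan_mu ` A_grp \<alpha>"
    then obtain t where "a = cartan_mu (g t)" by (auto simp: A)
    then show "\<exists>b\<in>plane_A \<alpha>. dist a b \<le> ln 2"
      using d[of t] unfolding plane_A_def by blast
  qed
  moreover have "near (plane_A \<alpha>) (cartan_mu ` A_grp \<alpha>)"
  proof (rule nearI[of _ _ "ln 2"])
    fix a assume "a \<in> plane_A \<alpha>"
    then obtain s where a: "a = (\<alpha> * s, \<bar>s\<bar>)" by (auto simp: plane_A_def)
    show "\<exists>b\<in>cartan_mu ` A_grp \<alpha>. dist a b \<le> ln 2"
      using d[of "s / 2"] by (intro bexI[of _ "cartan_mu (g (s / 2))"]) (auto simp: A a dist_commute)
  qed
  ultimately show ?thesis by (simp add: coarse_eq_def)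
qed

text \<open>
  The lower left entry of a triangular matrix with given diagonal can be chosen so that the width takes any
  value above the width \<open>\<bar>x - y\<bar>\<close> of the diagonal, up to a bounded error.
\<close>

lemma cartan_mu_unipotent_shift:
  assumes "\<bar>x - y\<bar> \<le> q"
  obtains s where "\<bar>snd (cartan_mu (mat2 (exp x) 0 s (exp y))) - q\<bar> \<le> ln 3"
proof
  define s where "s = exp ((x + y + q) / 2)"
  have "s\<^sup>2 * exp (- x - y) = exp q"
    unfolding s_def power2_eq_square exp_add[symmetric] by (simp add: field_simps)
  moreover have "\<bar>ln (exp (x - y) + exp (y - x) + exp q) - q\<bar> \<le> ln 3"
  proof (rule ln_between)
    have "exp (x - y) \<le> exp q" "exp (y - x) \<le> exp q" using assms by (simp_all add: abs_le_iff)
    then show "exp (x - y) + exp (y - x) + exp q \<le> 3 * exp q" by linarith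
  qed simp_all
  ultimately show "\<bar>snd (cartan_mu (mat2 (exp x) 0 s (exp y))) - q\<bar> \<le> ln 3"
    by (simp add: cartan_mu_lower_triangular)
qed

lemma snd_cartan_mu_lower_triangular_ge: "\<bar>x - y\<bar> \<le> snd (cartan_mu (mat2 (exp x) 0 s (exp y)))"
proof -
  have "exp \<bar>x - y\<bar> \<le> exp (x - y) + exp (y - x)" by (cases "x \<ge> y") simp_all
  then have "exp \<bar>x - y\<bar> \<le> exp (x - y) + exp (y - x) + s\<^sup>2 * exp (- x - y)" by (simp add: add_increasing2)
  then have "ln (exp \<bar>x - y\<bar>) \<le> ln (exp (x - y) + exp (y - x) + s\<^sup>2 * exp (- x - y))"
    using exp_gt_zero less_le_trans by (subst ln_le_cancel_iff) blast+
  then show ?thesis by (simp add: cartan_mu_lower_triangular)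
qed

lemma fst_cartan_mu_lower_triangular: "fst (cartan_mu (mat2 (exp x) 0 s (exp y))) = x + y"
  by (simp add: cartan_mu_lower_triangular)

lemma cartan_mu_B: "coarse_eq (cartan_mu ` B_grp \<alpha>) (plane_B \<alpha>)"
proof -
  have "cartan_mu ` B_grp \<alpha> \<subseteq> plane_B \<alpha>"
  proof
    fix a assume "a \<in> cartan_mu ` B_grp \<alpha>"
    then obtain t s where a: "a = cartan_mu (mat2 (exp ((\<alpha> + 1) * t)) 0 s (exp ((\<alpha> - 1) * t)))"
      by (auto simp: B_grp_def)
    have "(\<alpha> + 1) * t - (\<alpha> - 1) * t = 2 * t" by (simp add: algebra_simps)
    then have s: "\<bar>2 * t\<bar> \<le> snd a"
      unfolding a using snd_cartan_mu_lower_triangular_ge[of "(\<alpha> + 1) * t" "(\<alpha> - 1) * t" s] by simp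
    have "\<bar>fst a\<bar> = \<bar>\<alpha>\<bar> * \<bar>2 * t\<bar>"
      unfolding a fst_cartan_mu_lower_triangular by (simp add: algebra_simps flip: abs_mult)
    also have "\<dots> \<le> \<bar>\<alpha>\<bar> * snd a" using s by (intro mult_left_mono) auto
    finally show "a \<in> plane_B \<alpha>" using s by (auto simp: plane_B_def split: prod.split)
  qed
  moreover have "near (plane_B \<alpha>) (cartan_mu ` B_grp \<alpha>)"
  proof (rule nearI[of _ _ "ln 3"])
    fix a assume a: "a \<in> plane_B \<alpha>"
    obtain x q where xq: "a = (x, q)" "0 \<le> q" "\<bar>x\<bar> \<le> \<bar>\<alpha>\<bar> * q" using a by (auto simp: plane_B_def)
    define t where "t = x / (2 * \<alpha>)"
    have t: "\<alpha> * (2 * t) = x" "\<bar>2 * t\<bar> \<le> q"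
      using xq by (cases "\<alpha> = 0"; simp add: t_def abs_mult divide_le_eq mult.commute)+
    have "(\<alpha> + 1) * t - (\<alpha> - 1) * t = 2 * t" "(\<alpha> + 1) * t + (\<alpha> - 1) * t = \<alpha> * (2 * t)"
      by (simp_all add: algebra_simps)
    then obtain s where s: "\<bar>snd (cartan_mu (mat2 (exp ((\<alpha> + 1) * t)) 0 s (exp ((\<alpha> - 1) * t)))) - q\<bar> \<le> ln 3"
      and f: "fst (cartan_mu (mat2 (exp ((\<alpha> + 1) * t)) 0 s (exp ((\<alpha> - 1) * t)))) = x"
      using cartan_mu_unipotent_shift[of "(\<alpha> + 1) * t" "(\<alpha> - 1) * t" q] t
      by (metis fst_cartan_mu_lower_triangular)
    then show "\<exists>b\<in>cartan_mu ` B_grp \<alpha>. dist a b \<le> ln 3"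
      using dist_prod_le[of a "cartan_mu (mat2 (exp ((\<alpha> + 1) * t)) 0 s (exp ((\<alpha> - 1) * t)))"]
      by (intro bexI[of _ "cartan_mu (mat2 (exp ((\<alpha> + 1) * t)) 0 s (exp ((\<alpha> - 1) * t)))"])
        (auto simp: B_grp_def xq abs_minus_commute)
  qed
  ultimately show ?thesis by (simp add: coarse_eq_def near_subset)
qed

section \<open>Properness for pairs of regions\<close>

lemma unbounded_plane:
  "\<not> bounded plane_Z" "\<not> bounded plane_U" "\<not> bounded (plane_A \<alpha>)" "\<not> bounded (plane_B \<alpha>)"
proof -
  have *: "\<not> bounded S" if far: "\<And>t::real. 0 \<le> t \<Longrightarrow> \<exists>p\<in>S. t \<le> \<bar>fst p\<bar> \<or> t \<le> \<bar>snd p\<bar>" for S :: "(real \<times> real) set"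
  proof
    assume "bounded S"
    then obtain M where M: "0 < M" "\<And>p. p \<in> S \<Longrightarrow> norm p \<le> M" by (auto simp: bounded_pos)
    obtain p where p: "p \<in> S" "M + 1 \<le> \<bar>fst p\<bar> \<or> M + 1 \<le> \<bar>snd p\<bar>" using far[of "M + 1"] M by auto
    have "\<bar>fst p\<bar> \<le> M" "\<bar>snd p\<bar> \<le> M"
      using abs_fst_diff_le[of p 0 M] abs_snd_diff_le[of p 0 M] M(2)[OF p(1)] by auto
    then show False using p by linarith
  qed
  show "\<not> bounded plane_Z"
  proof (rule *)
    show "\<exists>p\<in>plane_Z. t \<le> \<bar>fst p\<bar> \<or> t \<le> \<bar>snd p\<bar>" for t
      by (intro bexI[of _ "(t, 0)"]) (auto simp: plane_Z_def)
  qed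
  show "\<not> bounded plane_U"
  proof (rule *)
    show "\<exists>p\<in>plane_U. t \<le> \<bar>fst p\<bar> \<or> t \<le> \<bar>snd p\<bar>" for t
      by (intro bexI[of _ "(t, ln (1 + t\<^sup>2))"]) (auto simp: plane_U_def)
  qed
  show "\<not> bounded (plane_A \<alpha>)"
  proof (rule *)
    show "\<exists>p\<in>plane_A \<alpha>. t \<le> \<bar>fst p\<bar> \<or> t \<le> \<bar>snd p\<bar>" for t
      by (intro bexI[of _ "(\<alpha> * t, \<bar>t\<bar>)"]) (auto simp: plane_A_def)
  qed
  show "\<not> bounded (plane_B \<alpha>)"
  proof (rule *)
    fix t :: real assume "0 \<le> t"
    then show "\<exists>p\<in>plane_B \<alpha>. t \<le> \<bar>fst p\<bar> \<or> t \<le> \<bar>snd p\<bar>"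
      by (intro bexI[of _ "(0, t)"]) (auto simp: plane_B_def)
  qed
qed

text \<open>
  With \<open>w = sqrt (1 + \<bar>x\<bar>)\<close>, the left side is \<open>w\<^sup>2 - 1\<close> while the logarithm is at most \<open>4 ln w \<le> 4 w\<close>, so the
  assumption bounds a square by a linear function. It compares the logarithmic graph of \<open>U\<close> with cones.
\<close>

lemma ln_sublinear:
  fixes x a b :: real
  assumes "\<bar>x\<bar> \<le> a + b * ln (1 + x\<^sup>2)" "0 \<le> a" "0 \<le> b"
  shows "\<bar>x\<bar> \<le> (1 + a + 4 * b)\<^sup>2"
proof -
  define w where "w = sqrt (1 + \<bar>x\<bar>)"
  have w2: "w\<^sup>2 = 1 + \<bar>x\<bar>" by (simp add: w_def)
  have w1: "1 \<le> w" by (simp add: w_def)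
  have "1 + x\<^sup>2 \<le> (1 + \<bar>x\<bar>)\<^sup>2" by (simp add: power2_sum)
  also have "\<dots> = w ^ 4" unfolding w2[symmetric] by simp
  finally have "ln (1 + x\<^sup>2) \<le> ln (w ^ 4)" using w1 by (subst ln_le_cancel_iff) (auto intro: add_pos_nonneg)
  also have "\<dots> = 4 * ln w" using w1 by (simp add: ln_realpow)
  also have "\<dots> \<le> 4 * w" using w1 ln_le_minus_one[of w] by simp
  finally have "b * ln (1 + x\<^sup>2) \<le> b * (4 * w)" using assms(3) by (rule mult_left_mono)
  then have "w * w \<le> (1 + a) + b * (4 * w)" using assms(1) w2 by (simp add: power2_eq_square)
  also have "\<dots> \<le> (1 + a) * w + b * (4 * w)" using w1 assms(2) by (simp add: mult_le_cancel_left1)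
  also have "\<dots> = (1 + a + 4 * b) * w" by (simp add: algebra_simps)
  finally have "w \<le> 1 + a + 4 * b" using w1 by simp
  then have "w\<^sup>2 \<le> (1 + a + 4 * b)\<^sup>2" using w1 by (intro power_mono) auto
  then show ?thesis using w2 by simp
qed

lemma coarsely_properI:
  assumes "\<And>R::real. 0 \<le> R \<Longrightarrow> \<exists>M. \<forall>a\<in>A. \<forall>b\<in>B. \<bar>fst a - fst b\<bar> \<le> R \<longrightarrow> \<bar>snd a - snd b\<bar> \<le> R \<longrightarrow> \<bar>fst a\<bar> \<le> M \<and> \<bar>snd a\<bar> \<le> M"
  shows "coarsely_proper A B"
  unfolding coarsely_proper_def
proof
  fix R :: real
  define R' where "R' = max 0 R"
  obtain M where M: "\<And>a b. a \<in> A \<Longrightarrow> b \<in> B \<Longrightarrow> \<bar>fst a - fst b\<bar> \<le> R' \<Longrightarrow> \<bar>snd a - snd b\<bar> \<le> R' \<Longrightarrow> \<bar>fst a\<bar> \<le> M \<and> \<bar>snd a\<bar> \<le> M"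
    using assms[of R'] unfolding R'_def by (metis max.cobounded1)
  have "norm a \<le> 2 * M" if a: "a \<in> A" "b \<in> B" "dist a b \<le> R" for a b
  proof -
    have "dist a b \<le> R'" using a by (simp add: R'_def)
    then have "\<bar>fst a\<bar> \<le> M \<and> \<bar>snd a\<bar> \<le> M" using M[OF a(1,2)] abs_fst_diff_le abs_snd_diff_le by blast
    then show ?thesis using dist_prod_le[of a 0] by simp
  qed
  then show "bounded {a \<in> A. \<exists>b\<in>B. dist a b \<le> R}" unfolding bounded_iff by blast
qed

lemma coarsely_proper_Z_A: "coarsely_proper plane_Z (plane_A \<beta>)"
proof (rule coarsely_properI)
  fix R :: real assume R: "0 \<le> R"
  have "\<bar>x\<bar> \<le> R + \<bar>\<beta>\<bar> * R" if "\<bar>x - \<beta> * s\<bar> \<le> R" "\<bar>s\<bar> \<le> R" for x s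
  proof -
    have "\<bar>\<beta> * s\<bar> \<le> \<bar>\<beta>\<bar> * R" unfolding abs_mult using that by (intro mult_left_mono) auto
    then show ?thesis using that by linarith
  qed
  then show "\<exists>M. \<forall>a\<in>plane_Z. \<forall>b\<in>plane_A \<beta>. \<bar>fst a - fst b\<bar> \<le> R \<longrightarrow> \<bar>snd a - snd b\<bar> \<le> R \<longrightarrow> \<bar>fst a\<bar> \<le> M \<and> \<bar>snd a\<bar> \<le> M"
    using R by (intro exI[of _ "R + \<bar>\<beta>\<bar> * R"]) (auto simp: plane_Z_def plane_A_def)
qed

lemma coarsely_proper_Z_U: "coarsely_proper plane_Z plane_U"
proof (rule coarsely_properI)
  fix R :: real assume R: "0 \<le> R"
  have "\<bar>x\<bar> \<le> R + exp R" if "\<bar>x - y\<bar> \<le> R" "\<bar>ln (1 + y\<^sup>2)\<bar> \<le> R" for x y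
  proof -
    have p: "0 < 1 + y\<^sup>2" by (auto intro: add_pos_nonneg)
    have "exp (ln (1 + y\<^sup>2)) \<le> exp R" using that(2) by simp
    then have e: "1 + y\<^sup>2 \<le> exp R" using p by simp
    have "0 \<le> (\<bar>y\<bar> - 1)\<^sup>2" by simp
    then have "2 * \<bar>y\<bar> \<le> 1 + y\<^sup>2" by (simp add: power2_diff)
    then show ?thesis using that(1) e by linarith
  qed
  then show "\<exists>M. \<forall>a\<in>plane_Z. \<forall>b\<in>plane_U. \<bar>fst a - fst b\<bar> \<le> R \<longrightarrow> \<bar>snd a - snd b\<bar> \<le> R \<longrightarrow> \<bar>fst a\<bar> \<le> M \<and> \<bar>snd a\<bar> \<le> M"
    using R by (intro exI[of _ "R + exp R"]) (auto simp: plane_Z_def plane_U_def add_nonneg_nonneg)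
qed

lemma coarsely_proper_Z_B: "coarsely_proper plane_Z (plane_B \<beta>)"
proof (rule coarsely_properI)
  fix R :: real assume R: "0 \<le> R"
  have "\<bar>x\<bar> \<le> R + \<bar>\<beta>\<bar> * R" if "\<bar>x - x'\<bar> \<le> R" "\<bar>x'\<bar> \<le> \<bar>\<beta>\<bar> * q" "\<bar>q\<bar> \<le> R" for x x' q
  proof -
    have "\<bar>\<beta>\<bar> * q \<le> \<bar>\<beta>\<bar> * R" using that by (intro mult_left_mono) auto
    then show ?thesis using that by linarith
  qed
  then show "\<exists>M. \<forall>a\<in>plane_Z. \<forall>b\<in>plane_B \<beta>. \<bar>fst a - fst b\<bar> \<le> R \<longrightarrow> \<bar>snd a - snd b\<bar> \<le> R \<longrightarrow> \<bar>fst a\<bar> \<le> M \<and> \<bar>snd a\<bar> \<le> M"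
    using R by (intro exI[of _ "R + \<bar>\<beta>\<bar> * R"]) (auto simp: plane_Z_def plane_B_def)
qed

lemma plane_A_abs: "\<bar>\<alpha>\<bar> = \<bar>\<beta>\<bar> \<Longrightarrow> plane_A \<alpha> = plane_A \<beta>"
proof -
  have "plane_A (- \<gamma>) \<subseteq> plane_A \<gamma>" for \<gamma>
  proof
    fix p assume "p \<in> plane_A (- \<gamma>)"
    then obtain s where "p = (\<gamma> * (- s), \<bar>- s\<bar>)" by (auto simp: plane_A_def)
    then show "p \<in> plane_A \<gamma>" unfolding plane_A_def by blast
  qed
  then have "plane_A (- \<gamma>) = plane_A \<gamma>" for \<gamma> by (metis minus_minus subset_antisym)
  then show "\<bar>\<alpha>\<bar> = \<bar>\<beta>\<bar> \<Longrightarrow> plane_A \<alpha> = plane_A \<beta>" by (metis abs_eq_iff)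
qed

lemma coarsely_proper_A_bounded:
  fixes \<alpha> \<beta> s s' R :: real
  assumes gap: "\<bar>\<alpha>\<bar> \<noteq> \<bar>\<beta>\<bar>" and 1: "\<bar>\<alpha> * s - \<beta> * s'\<bar> \<le> R" and 2: "\<bar>\<bar>s\<bar> - \<bar>s'\<bar>\<bar> \<le> R"
  shows "\<bar>s\<bar> \<le> (R + \<bar>\<beta>\<bar> * R) / \<bar>\<bar>\<alpha>\<bar> - \<bar>\<beta>\<bar>\<bar>"
proof -
  have "\<bar>\<bar>\<alpha>\<bar> * \<bar>s\<bar> - \<bar>\<beta>\<bar> * \<bar>s'\<bar>\<bar> \<le> R"
    unfolding abs_mult[symmetric] by (rule order_trans[OF abs_triangle_ineq3 1])
  moreover have "\<bar>\<bar>\<beta>\<bar> * \<bar>s'\<bar> - \<bar>\<beta>\<bar> * \<bar>s\<bar>\<bar> \<le> \<bar>\<beta>\<bar> * R"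
  proof -
    have "\<bar>\<bar>\<beta>\<bar> * \<bar>s'\<bar> - \<bar>\<beta>\<bar> * \<bar>s\<bar>\<bar> = \<bar>\<beta>\<bar> * \<bar>\<bar>s'\<bar> - \<bar>s\<bar>\<bar>"
      unfolding right_diff_distrib[symmetric] abs_mult abs_abs ..
    also have "\<dots> \<le> \<bar>\<beta>\<bar> * R" using 2 by (intro mult_left_mono) auto
    finally show ?thesis .
  qed
  moreover have "\<bar>x - z\<bar> \<le> p + q" if "\<bar>x - y\<bar> \<le> p" "\<bar>y - z\<bar> \<le> q" for x y z p q :: real
    using that by linarith
  ultimately have "\<bar>\<bar>\<alpha>\<bar> * \<bar>s\<bar> - \<bar>\<beta>\<bar> * \<bar>s\<bar>\<bar> \<le> R + \<bar>\<beta>\<bar> * R" by blast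
  then have "\<bar>\<bar>\<alpha>\<bar> - \<bar>\<beta>\<bar>\<bar> * \<bar>s\<bar> \<le> R + \<bar>\<beta>\<bar> * R"
    unfolding left_diff_distrib[symmetric] abs_mult abs_abs .
  then show ?thesis using gap by (simp add: pos_le_divide_eq mult.commute)
qed

text \<open>
  Two points \<open>(\<alpha> s, \<bar>s\<bar>)\<close> and \<open>(\<beta> s', \<bar>s'\<bar>)\<close> at equal height are \<open>\<bar>\<bar>\<alpha>\<bar> - \<bar>\<beta>\<bar>\<bar> \<bar>s\<bar>\<close> apart or more, so the two
  regions diverge linearly; for \<open>\<bar>\<alpha>\<bar> = \<bar>\<beta>\<bar>\<close> they coincide.
\<close>

lemma coarsely_proper_A_A: "coarsely_proper (plane_A \<alpha>) (plane_A \<beta>) \<longleftrightarrow> \<bar>\<alpha>\<bar> \<noteq> \<bar>\<beta>\<bar>"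
proof
  assume "coarsely_proper (plane_A \<alpha>) (plane_A \<beta>)"
  then show "\<bar>\<alpha>\<bar> \<noteq> \<bar>\<beta>\<bar>"
    using plane_A_abs[of \<alpha> \<beta>] coarsely_proper_near_imp_bounded[of "plane_A \<alpha>" "plane_A \<beta>"]
      near_subset[of "plane_A \<alpha>" "plane_A \<alpha>"] unbounded_plane(3) by auto
next
  assume gap: "\<bar>\<alpha>\<bar> \<noteq> \<bar>\<beta>\<bar>"
  show "coarsely_proper (plane_A \<alpha>) (plane_A \<beta>)"
  proof (rule coarsely_properI)
    fix R :: real assume R: "0 \<le> R"
    define N where "N = (R + \<bar>\<beta>\<bar> * R) / \<bar>\<bar>\<alpha>\<bar> - \<bar>\<beta>\<bar>\<bar>"
    have "\<bar>\<alpha> * s\<bar> \<le> N + \<bar>\<alpha>\<bar> * N \<and> \<bar>s\<bar> \<le> N + \<bar>\<alpha>\<bar> * N"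
      if "\<bar>\<alpha> * s - \<beta> * s'\<bar> \<le> R" "\<bar>\<bar>s\<bar> - \<bar>s'\<bar>\<bar> \<le> R" for s s'
    proof -
      have s: "\<bar>s\<bar> \<le> N" unfolding N_def using coarsely_proper_A_bounded[OF gap that] .
      then have "\<bar>\<alpha> * s\<bar> \<le> \<bar>\<alpha>\<bar> * N" unfolding abs_mult by (intro mult_left_mono) auto
      then show ?thesis using s abs_ge_zero[of s] abs_ge_zero[of "\<alpha> * s"] by linarith
    qed
    then show "\<exists>M. \<forall>a\<in>plane_A \<alpha>. \<forall>b\<in>plane_A \<beta>. \<bar>fst a - fst b\<bar> \<le> R \<longrightarrow> \<bar>snd a - snd b\<bar> \<le> R \<longrightarrow> \<bar>fst a\<bar> \<le> M \<and> \<bar>snd a\<bar> \<le> M"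
      by (intro exI[of _ "N + \<bar>\<alpha>\<bar> * N"]) (auto simp: plane_A_def)
  qed
qed

text \<open>
  Points \<open>(x, ln (1 + x\<^sup>2))\<close> near the cone have \<open>\<bar>x\<bar>\<close> bounded by a linear function of
  \<open>ln (1 + x\<^sup>2)\<close>.
\<close>

lemma coarsely_proper_U_B: "coarsely_proper plane_U (plane_B \<beta>)"
proof (rule coarsely_properI)
  fix R :: real assume R: "0 \<le> R"
  define N where "N = (1 + (R + \<bar>\<beta>\<bar> * R) + 4 * \<bar>\<beta>\<bar>)\<^sup>2"
  have "\<bar>x\<bar> \<le> N + ln (1 + N\<^sup>2) \<and> \<bar>ln (1 + x\<^sup>2)\<bar> \<le> N + ln (1 + N\<^sup>2)"
    if "\<bar>x - x'\<bar> \<le> R" "\<bar>x'\<bar> \<le> \<bar>\<beta>\<bar> * q" "\<bar>ln (1 + x\<^sup>2) - q\<bar> \<le> R" for x x' q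
  proof -
    have "\<bar>\<beta>\<bar> * q \<le> \<bar>\<beta>\<bar> * (ln (1 + x\<^sup>2) + R)" using that by (intro mult_left_mono) auto
    then have "\<bar>x\<bar> \<le> (R + \<bar>\<beta>\<bar> * R) + \<bar>\<beta>\<bar> * ln (1 + x\<^sup>2)" using that(1,2) unfolding distrib_left by linarith
    then have x: "\<bar>x\<bar> \<le> N" unfolding N_def using R by (intro ln_sublinear) auto
    have "x\<^sup>2 \<le> N\<^sup>2" using x by (metis abs_ge_zero power2_abs power_mono)
    then have "ln (1 + x\<^sup>2) \<le> ln (1 + N\<^sup>2)" by (subst ln_le_cancel_iff) (auto intro: add_pos_nonneg)
    moreover have "0 \<le> ln (1 + x\<^sup>2)" by simp
    ultimately show ?thesis using x by linarith
  qed
  then show "\<exists>M. \<forall>a\<in>plane_U. \<forall>b\<in>plane_B \<beta>. \<bar>fst a - fst b\<bar> \<le> R \<longrightarrow> \<bar>snd a - snd b\<bar> \<le> R \<longrightarrow> \<bar>fst a\<bar> \<le> M \<and> \<bar>snd a\<bar> \<le> M"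
    by (intro exI[of _ "N + ln (1 + N\<^sup>2)"]) (auto simp: plane_U_def plane_B_def)
qed

lemma plane_A_subset_B: "\<bar>\<alpha>\<bar> \<le> \<bar>\<beta>\<bar> \<Longrightarrow> plane_A \<alpha> \<subseteq> plane_B \<beta>"
  by (auto simp: plane_A_def plane_B_def abs_mult intro!: mult_right_mono)

text \<open>
  The rays of \<open>plane_A \<alpha>\<close> are the boundary of the cone \<open>plane_B \<alpha>\<close>.
\<close>

lemma coarsely_proper_A_U: "coarsely_proper (plane_A \<alpha>) plane_U"
  using coarsely_proper_mono[OF coarsely_proper_U_B[of \<alpha>] near_subset[OF order_refl] near_subset[OF plane_A_subset_B]]
  by (intro coarsely_proper_sym[of plane_U]) simp

lemma coarsely_proper_A_B: "coarsely_proper (plane_A \<alpha>) (plane_B \<beta>) \<longleftrightarrow> \<bar>\<alpha>\<bar> > \<bar>\<beta>\<bar>"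
proof
  assume "coarsely_proper (plane_A \<alpha>) (plane_B \<beta>)"
  then show "\<bar>\<alpha>\<bar> > \<bar>\<beta>\<bar>"
    using near_subset[OF plane_A_subset_B[of \<alpha> \<beta>]] coarsely_proper_near_imp_bounded unbounded_plane(3) not_le
    by blast
next
  assume gap: "\<bar>\<alpha>\<bar> > \<bar>\<beta>\<bar>"
  show "coarsely_proper (plane_A \<alpha>) (plane_B \<beta>)"
  proof (rule coarsely_properI)
    fix R :: real assume R: "0 \<le> R"
    define N where "N = (R + \<bar>\<beta>\<bar> * R) / (\<bar>\<alpha>\<bar> - \<bar>\<beta>\<bar>)"
    have "\<bar>\<alpha> * s\<bar> \<le> N + \<bar>\<alpha>\<bar> * N \<and> \<bar>s\<bar> \<le> N + \<bar>\<alpha>\<bar> * N"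
      if "\<bar>\<alpha> * s - x\<bar> \<le> R" "\<bar>x\<bar> \<le> \<bar>\<beta>\<bar> * q" "\<bar>\<bar>s\<bar> - q\<bar> \<le> R" for s x q
    proof -
      have "\<bar>\<beta>\<bar> * q \<le> \<bar>\<beta>\<bar> * (\<bar>s\<bar> + R)" using that by (intro mult_left_mono) auto
      then have "\<bar>\<alpha> * s\<bar> \<le> R + \<bar>\<beta>\<bar> * \<bar>s\<bar> + \<bar>\<beta>\<bar> * R" using that(1,2) unfolding distrib_left by linarith
      then have "\<bar>s\<bar> * (\<bar>\<alpha>\<bar> - \<bar>\<beta>\<bar>) \<le> R + \<bar>\<beta>\<bar> * R" by (simp add: abs_mult algebra_simps)
      then have s: "\<bar>s\<bar> \<le> N" unfolding N_def using gap by (simp add: le_divide_eq)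
      then have "\<bar>\<alpha> * s\<bar> \<le> \<bar>\<alpha>\<bar> * N" unfolding abs_mult by (intro mult_left_mono) auto
      then show ?thesis using s abs_ge_zero[of s] abs_ge_zero[of "\<alpha> * s"] by linarith
    qed
    then show "\<exists>M. \<forall>a\<in>plane_A \<alpha>. \<forall>b\<in>plane_B \<beta>. \<bar>fst a - fst b\<bar> \<le> R \<longrightarrow> \<bar>snd a - snd b\<bar> \<le> R \<longrightarrow> \<bar>fst a\<bar> \<le> M \<and> \<bar>snd a\<bar> \<le> M"
      by (intro exI[of _ "N + \<bar>\<alpha>\<bar> * N"]) (auto simp: plane_A_def plane_B_def)
  qed
qed

lemma not_coarsely_proper_refl:
  "\<not> coarsely_proper plane_Z plane_Z" "\<not> coarsely_proper plane_U plane_U"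
  using coarsely_proper_near_imp_bounded near_subset[OF order_refl] unbounded_plane by blast+

text \<open>
  All cones contain the vertical ray.
\<close>

lemma not_coarsely_proper_B_B: "\<not> coarsely_proper (plane_B \<alpha>) (plane_B \<beta>)"
proof
  assume "coarsely_proper (plane_B \<alpha>) (plane_B \<beta>)"
  then have "coarsely_proper (plane_A 0) (plane_B \<beta>)"
    by (rule coarsely_proper_mono) (simp_all add: near_subset plane_A_subset_B)
  then show False by (simp add: coarsely_proper_A_B)
qed

text \<open>
  If the half-plane were near one of these regions, so would be its boundary line and the vertical ray; but
  one of the two is unbounded and proper to the region.
\<close>

lemma not_near_plane_G:
  "\<not> near plane_G plane_Z" "\<not> near plane_G plane_U" "\<not> near plane_G (plane_A \<alpha>)" "\<not> near plane_G (plane_B \<alpha>)"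
proof -
  have sub: "plane_Z \<subseteq> plane_G" "plane_A 0 \<subseteq> plane_G"
    by (auto simp: plane_Z_def plane_A_def plane_G_def)
  have *: "\<not> near plane_G B" if "coarsely_proper A B" "A \<subseteq> plane_G" "\<not> bounded A" for A B
    using that(1,3) coarsely_proper_near_imp_bounded near_trans[OF near_subset[OF that(2)]] by blast
  show "\<not> near plane_G plane_Z"
    by (rule *[OF coarsely_proper_sym[OF coarsely_proper_Z_A[of 0]] sub(2) unbounded_plane(3)])
  show "\<not> near plane_G plane_U" "\<not> near plane_G (plane_A \<alpha>)" "\<not> near plane_G (plane_B \<alpha>)"
    by (rule *[OF _ sub(1) unbounded_plane(1)], rule coarsely_proper_Z_U coarsely_proper_Z_A coarsely_proper_Z_B)+
qed

section \<open>The model groups are connected Lie subgroups\<close>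

lemma has_derivative_mat2:
  assumes "(p has_derivative p') F" "(q has_derivative q') F" "(r has_derivative r') F" "(s has_derivative s') F"
  shows "((\<lambda>x. mat2 (p x) (q x) (r x) (s x)) has_derivative (\<lambda>v. mat2 (p' v) (q' v) (r' v) (s' v))) F"
proof -
  have *: "mat2 a b c d = a *\<^sub>R mat2 1 0 0 0 + b *\<^sub>R mat2 0 1 0 0 + c *\<^sub>R mat2 0 0 1 0 + d *\<^sub>R mat2 0 0 0 1" for a b c d
    by (simp add: vec_eq_iff forall_2)
  show ?thesis
    by (subst (1 2) *) (intro has_derivative_add has_derivative_scaleR_left assms)
qed

lemma has_derivative_entry: "((\<lambda>x::real^2^2. x $ i $ j) has_derivative (\<lambda>v. v $ i $ j)) F"
  by (intro bounded_linear_imp_has_derivative bounded_linear_compose[OF bounded_linear_vec_nth bounded_linear_vec_nth])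

text \<open>
  All the global charts needed are members of this family, and the family is closed under directional
  derivatives for fixed \<open>k, l, m\<close>, which makes smoothness a single coinduction. The constant \<open>f\<close> takes up
  the derivative of \<open>d * x$2$1\<close>.
\<close>

definition exp_chart ::
  "real \<Rightarrow> real \<Rightarrow> real \<Rightarrow> real \<Rightarrow> real \<Rightarrow> real \<Rightarrow> real \<Rightarrow> real \<Rightarrow> real \<Rightarrow> real^2^2 \<Rightarrow> real^2^2" where
  "exp_chart k l m a b c d e f x =
     mat2 (a * exp (k * x$1$1)) 0 ((b + c * x$1$1) * exp (l * x$1$1) + d * x$2$1 + f) (e * exp (m * x$1$1))"

definition exp_chart_deriv ::
  "real \<Rightarrow> real \<Rightarrow> real \<Rightarrow> real \<Rightarrow> real \<Rightarrow> real \<Rightarrow> real \<Rightarrow> real \<Rightarrow> real \<Rightarrow> real^2^2 \<Rightarrow> real^2^2 \<Rightarrow> real^2^2" where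
  "exp_chart_deriv k l m a b c d e f x v =
     exp_chart k l m (a * k * v$1$1) ((b * l + c) * v$1$1) (c * l * v$1$1) 0 (e * m * v$1$1) (d * v$2$1) x"

lemma has_derivative_exp_chart:
  "(exp_chart k l m a b c d e f has_derivative exp_chart_deriv k l m a b c d e f x) (at x within S)"
proof -
  have h: "((\<lambda>x. exp (p * x$1$1)) has_derivative (\<lambda>v. exp (p * x$1$1) * (p * v$1$1))) (at x within S)" for p
    by (rule has_derivative_eq_rhs[OF has_derivative_exp[OF has_derivative_mult_right[OF has_derivative_entry]]])
      (simp add: fun_eq_iff mult.commute)
  have "((\<lambda>x. exp_chart k l m a b c d e f x) has_derivative
      (\<lambda>v. mat2 (a * (exp (k * x$1$1) * (k * v$1$1))) 0
        ((b + c * x$1$1) * (exp (l * x$1$1) * (l * v$1$1)) + (0 + c * v$1$1) * exp (l * x$1$1) + d * v$2$1 + 0)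
        (e * (exp (m * x$1$1) * (m * v$1$1))))) (at x within S)"
    unfolding exp_chart_def
    by (intro has_derivative_mat2 has_derivative_add has_derivative_mult_right has_derivative_mult
        has_derivative_const has_derivative_entry h)
  moreover have "mat2 (a * (exp (k * x$1$1) * (k * v$1$1))) 0
        ((b + c * x$1$1) * (exp (l * x$1$1) * (l * v$1$1)) + (0 + c * v$1$1) * exp (l * x$1$1) + d * v$2$1 + 0)
        (e * (exp (m * x$1$1) * (m * v$1$1))) = exp_chart_deriv k l m a b c d e f x v" for v
    by (simp add: exp_chart_deriv_def exp_chart_def mat2_eq_iff algebra_simps)
  ultimately show ?thesis by simp
qed

lemma C_infinity_exp_chart: "C_infinity V W (exp_chart k l m a b c d e f)"
proof (coinduction arbitrary: a b c d e f rule: C_infinity.coinduct)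
  case C_infinity
  have "\<exists>a' b' c' d' e' f'. (\<lambda>x. exp_chart_deriv k l m a b c d e f x v) = exp_chart k l m a' b' c' d' e' f'" for v
    unfolding exp_chart_deriv_def by blast
  then show ?case
    by (intro exI[of _ "exp_chart k l m a b c d e f"] exI[of _ "exp_chart_deriv k l m a b c d e f"])
      (simp add: has_derivative_exp_chart)
qed

lemma topological_group_subgroup_GL2:
  assumes H: "subgroup H GL2"
  shows "topological_group (GL2\<lparr>carrier := H\<rparr>) (top_of_set H)"
proof -
  have sub: "H \<subseteq> {g. invertible g}" using subgroup.subset[OF H] by simp
  have "continuous_on (H \<times> H) (\<lambda>(x, y). x ** y)"
    by (simp add: case_prod_unfold) (intro continuous_intros)
  then have "continuous_map (prod_topology (top_of_set H) (top_of_set H)) (top_of_set H) (\<lambda>(x, y). x ** y)"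
    using subgroup.m_closed[OF H]
    by (auto simp: prod_topology_subtopology_eu continuous_map_in_subtopology)
  moreover have "continuous_map (top_of_set H) (top_of_set H) (\<lambda>x. inv\<^bsub>GL2\<lparr>carrier := H\<rparr>\<^esub> x)"
  proof -
    have e: "inv\<^bsub>GL2\<lparr>carrier := H\<rparr>\<^esub> x = matrix_inv x" if "x \<in> H" for x
      using group.m_inv_consistent[OF group_GL2 H that] sub that by auto
    have "matrix_inv x \<in> H" if "x \<in> H" for x
      using subgroup.m_inv_closed[OF H that] sub that by auto
    moreover have "continuous_on H (\<lambda>x. inv\<^bsub>GL2\<lparr>carrier := H\<rparr>\<^esub> x)"
    proof (rule continuous_on_eq)
      show "continuous_on H matrix_inv"
        using sub continuous_on_matrix_inv[of H "\<lambda>x. x"] by auto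
    qed (simp add: e)
    ultimately show ?thesis by (auto simp: continuous_map_in_subtopology e)
  qed
  moreover have "group (GL2\<lparr>carrier := H\<rparr>)"
    by (rule subgroup.subgroup_is_group[OF H group_GL2])
  ultimately show ?thesis by (simp add: topological_group_def)
qed

lemma second_countable_euclidean: "second_countable (euclidean :: 'a::second_countable_topology topology)"
proof -
  obtain B :: "'a set set" where "countable B" "topological_basis B"
    using ex_countable_basis by blast
  moreover have "\<exists>V\<in>B. x \<in> V \<and> V \<subseteq> U" if "open U" "x \<in> U" for U x
    using topological_basisE[OF \<open>topological_basis B\<close> that] by metis
  moreover have "open V" if "V \<in> B" for V
    using topological_basis_open[OF \<open>topological_basis B\<close> that] .
  ultimately show ?thesis
    unfolding second_countable_def
    by (intro exI[of _ B]) simp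
qed

text \<open>
  The four groups are closed in \<open>GL\<^sub>2\<close> and diffeomorphic to a vector space, so the subspace topology and one
  chart suffice.
\<close>

lemma connected_Lie_subgroup_global_chart:
  fixes V :: "(real^2^2) set"
  assumes H: "subgroup H GL2" and V: "subspace V" and hom: "homeomorphism V H \<phi> \<psi>" and imm: "immersion_on V V \<phi>"
  shows "connected_Lie_subgroup H"
proof -
  have img: "\<phi> ` V = H" using hom by (simp add: homeomorphism_def)
  have "homeomorphic_map (top_of_set V) (top_of_set H) \<phi>"
    using hom unfolding homeomorphic_map_maps homeomorphic_maps_def homeomorphism_def
    by (intro exI[of _ \<psi>]) (auto simp: continuous_map_in_subtopology)
  then have charts: "\<exists>W \<phi>. openin (top_of_set V) W \<and> p \<in> \<phi> ` W \<and> openin (top_of_set H) (\<phi> ` W) \<and>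
      homeomorphic_map (top_of_set W) (subtopology (top_of_set H) (\<phi> ` W)) \<phi> \<and> immersion_on V W \<phi>" if "p \<in> H" for p
    using that imm img by (intro exI[of _ V] exI[of _ \<phi>]) (simp add: subtopology_subtopology)
  have "immersed_submanifold H (top_of_set H)"
    unfolding immersed_submanifold_def
  proof (intro conjI)
    show "second_countable (top_of_set H)"
      by (rule second_countable_subtopology[OF second_countable_euclidean])
    show "\<exists>V. subspace V \<and>
        (\<forall>p\<in>H. \<exists>W (\<phi> :: real^2^2 \<Rightarrow> real^2^2). openin (top_of_set V) W \<and> p \<in> \<phi> ` W \<and> openin (top_of_set H) (\<phi> ` W) \<and>
           homeomorphic_map (top_of_set W) (subtopology (top_of_set H) (\<phi> ` W)) \<phi> \<and>
           immersion_on V W \<phi>)"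
      using V charts by (intro exI[of _ V]) simp
  qed (simp_all add: Hausdorff_space_subtopology)
  moreover have "connected_space (top_of_set H)"
  proof -
    have "connected (\<phi> ` V)"
      using hom V by (intro connected_continuous_image convex_connected subspace_imp_convex) (auto simp: homeomorphism_def)
    then show ?thesis by (simp add: img connected_space_subtopology)
  qed
  ultimately show ?thesis
    using H topological_group_subgroup_GL2[OF H] by (auto simp: connected_Lie_subgroup_def)
qed

text \<open>
  The model spaces have to be subspaces of the ambient matrix space: the parameter \<open>t\<close> is placed in the
  upper left entry, and \<open>s\<close> in the lower left one.
\<close>

definition chart_line :: "(real^2^2) set" where "chart_line = {x. x$1$2 = 0 \<and> x$2$1 = 0 \<and> x$2$2 = 0}"
definition chart_plane :: "(real^2^2) set" where "chart_plane = {x. x$1$2 = 0 \<and> x$2$2 = 0}"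

lemma subspace_chart_models: "subspace chart_line" "subspace chart_plane"
  by (auto simp: subspace_def chart_line_def chart_plane_def)

lemma immersion_exp_chart_line:
  assumes "a * k \<noteq> 0 \<or> e * m \<noteq> 0"
  shows "immersion_on chart_line chart_line (exp_chart k l m a b c d e f)"
  unfolding immersion_on_def
proof (intro conjI ballI C_infinity_exp_chart)
  fix x
  have "inj_on (exp_chart_deriv k l m a b c d e f x) chart_line"
    using assms
    by (auto simp: inj_on_def chart_line_def exp_chart_deriv_def exp_chart_def mat2_eq_iff vec_eq_iff forall_2)
  then show "\<exists>D. (exp_chart k l m a b c d e f has_derivative D) (at x within chart_line) \<and> inj_on D chart_line"
    using has_derivative_exp_chart by blast
qed

lemma immersion_exp_chart_plane:
  assumes "a * k \<noteq> 0 \<or> e * m \<noteq> 0" "d \<noteq> 0"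
  shows "immersion_on chart_plane chart_plane (exp_chart k l m a b c d e f)"
  unfolding immersion_on_def
proof (intro conjI ballI C_infinity_exp_chart)
  fix x
  have "inj_on (exp_chart_deriv k l m a b c d e f x) chart_plane"
    using assms
    by (auto simp: inj_on_def chart_plane_def exp_chart_deriv_def exp_chart_def mat2_eq_iff vec_eq_iff forall_2)
  then show "\<exists>D. (exp_chart k l m a b c d e f has_derivative D) (at x within chart_plane) \<and> inj_on D chart_plane"
    using has_derivative_exp_chart by blast
qed

lemma subgroup_GL2I:
  assumes "\<And>g. g \<in> H \<Longrightarrow> invertible g" "mat 1 \<in> H" "\<And>g h. g \<in> H \<Longrightarrow> h \<in> H \<Longrightarrow> g ** h \<in> H"
    "\<And>g. g \<in> H \<Longrightarrow> matrix_inv g \<in> H"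
  shows "subgroup H GL2"
  using assms by unfold_locales auto

lemma subgroup_Z_grp: "subgroup Z_grp GL2"
proof (rule subgroup_GL2I)
  show "mat 1 \<in> Z_grp" unfolding Z_grp_def mat_1_eq_mat2 by (auto intro: exI[of _ 0])
  show "g ** h \<in> Z_grp" if "g \<in> Z_grp" "h \<in> Z_grp" for g h
    using that by (auto simp: Z_grp_def simp flip: exp_add)
  show "matrix_inv g \<in> Z_grp" if g: "g \<in> Z_grp" for g
  proof -
    obtain t where g: "g = mat2 (exp t) 0 0 (exp t)" using g by (auto simp: Z_grp_def)
    have "matrix_inv g = mat2 (exp (- t)) 0 0 (exp (- t))"
      by (rule matrix_inv_unique) (simp add: g mat_1_eq_mat2 flip: exp_add)
    then show ?thesis by (auto simp: Z_grp_def)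
  qed
qed (auto simp: Z_grp_def invertible_mat2)

lemma subgroup_U_grp: "subgroup U_grp GL2"
proof (rule subgroup_GL2I)
  show "mat 1 \<in> U_grp" unfolding U_grp_def mat_1_eq_mat2 by (auto intro: exI[of _ 0])
  show "g ** h \<in> U_grp" if "g \<in> U_grp" "h \<in> U_grp" for g h
  proof -
    obtain t u where g: "g = mat2 (exp t) 0 (t * exp t) (exp t)" "h = mat2 (exp u) 0 (u * exp u) (exp u)"
      using \<open>g \<in> U_grp\<close> \<open>h \<in> U_grp\<close> unfolding U_grp_def by blast
    have "g ** h = mat2 (exp (t + u)) 0 ((t + u) * exp (t + u)) (exp (t + u))"
      by (simp add: g exp_add algebra_simps)
    then show ?thesis by (auto simp: U_grp_def)
  qed
  show "matrix_inv g \<in> U_grp" if g: "g \<in> U_grp" for g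
  proof -
    obtain t where g: "g = mat2 (exp t) 0 (t * exp t) (exp t)" using g by (auto simp: U_grp_def)
    have "matrix_inv g = mat2 (exp (- t)) 0 (- t * exp (- t)) (exp (- t))"
      by (rule matrix_inv_unique) (simp add: g mat_1_eq_mat2 algebra_simps flip: exp_add)
    then show ?thesis unfolding U_grp_def by blast
  qed
qed (auto simp: U_grp_def invertible_mat2)

lemma subgroup_A_grp: "subgroup (A_grp \<alpha>) GL2"
proof (rule subgroup_GL2I)
  show "mat 1 \<in> A_grp \<alpha>" unfolding A_grp_def mat_1_eq_mat2 by (auto intro: exI[of _ 0])
  show "g ** h \<in> A_grp \<alpha>" if "g \<in> A_grp \<alpha>" "h \<in> A_grp \<alpha>" for g h
    using that by (auto simp: A_grp_def simp flip: exp_add distrib_left)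
  show "matrix_inv g \<in> A_grp \<alpha>" if g: "g \<in> A_grp \<alpha>" for g
  proof -
    obtain t where g: "g = mat2 (exp ((\<alpha> + 1) * t)) 0 0 (exp ((\<alpha> - 1) * t))" using g by (auto simp: A_grp_def)
    have "matrix_inv g = mat2 (exp ((\<alpha> + 1) * - t)) 0 0 (exp ((\<alpha> - 1) * - t))"
      by (rule matrix_inv_unique) (simp add: g mat_1_eq_mat2 flip: exp_add)
    then show ?thesis unfolding A_grp_def by blast
  qed
qed (auto simp: A_grp_def invertible_mat2)

lemma subgroup_B_grp: "subgroup (B_grp \<alpha>) GL2"
proof (rule subgroup_GL2I)
  show "mat 1 \<in> B_grp \<alpha>" unfolding B_grp_def mat_1_eq_mat2 by (auto intro!: exI[of _ 0])
  show "g ** h \<in> B_grp \<alpha>" if "g \<in> B_grp \<alpha>" "h \<in> B_grp \<alpha>" for g h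
  proof -
    obtain t s u r where "g = mat2 (exp ((\<alpha> + 1) * t)) 0 s (exp ((\<alpha> - 1) * t))"
      "h = mat2 (exp ((\<alpha> + 1) * u)) 0 r (exp ((\<alpha> - 1) * u))"
      using \<open>g \<in> B_grp \<alpha>\<close> \<open>h \<in> B_grp \<alpha>\<close> unfolding B_grp_def by blast
    then have "g ** h = mat2 (exp ((\<alpha> + 1) * (t + u))) 0
        (s * exp ((\<alpha> + 1) * u) + exp ((\<alpha> - 1) * t) * r) (exp ((\<alpha> - 1) * (t + u)))"
      by (simp flip: exp_add distrib_left)
    then show ?thesis unfolding B_grp_def by blast
  qed
  show "matrix_inv g \<in> B_grp \<alpha>" if g: "g \<in> B_grp \<alpha>" for g
  proof -
    obtain t s where g: "g = mat2 (exp ((\<alpha> + 1) * t)) 0 s (exp ((\<alpha> - 1) * t))" using g by (auto simp: B_grp_def)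
    have e: "exp ((\<alpha> - 1) * t) * exp ((\<alpha> - 1) * - t) = 1" "exp ((\<alpha> + 1) * t) * exp ((\<alpha> + 1) * - t) = 1"
      by (simp_all flip: exp_add)
    \<comment> \<open>The lower left entry of the inverse is \<open>- s\<close> divided by the determinant.\<close>
    have "matrix_inv g = mat2 (exp ((\<alpha> + 1) * - t)) 0
        (- s * exp ((\<alpha> + 1) * - t) * exp ((\<alpha> - 1) * - t)) (exp ((\<alpha> - 1) * - t))"
      unfolding g mat_1_eq_mat2
    proof (rule matrix_inv_unique)
      have "exp ((\<alpha> - 1) * t) * (- s * exp ((\<alpha> + 1) * - t) * exp ((\<alpha> - 1) * - t)) =
          - s * exp ((\<alpha> + 1) * - t) * (exp ((\<alpha> - 1) * t) * exp ((\<alpha> - 1) * - t))"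
        by (simp only: mult.assoc mult.commute mult.left_commute)
      then show "mat2 (exp ((\<alpha> + 1) * t)) 0 s (exp ((\<alpha> - 1) * t)) ** mat2 (exp ((\<alpha> + 1) * - t)) 0
          (- s * exp ((\<alpha> + 1) * - t) * exp ((\<alpha> - 1) * - t)) (exp ((\<alpha> - 1) * - t)) = mat 1"
        unfolding mat2_mult mat_1_eq_mat2 mat2_eq_iff e by simp
    qed
    then show ?thesis unfolding B_grp_def by blast
  qed
qed (auto simp: B_grp_def invertible_mat2)

lemma connected_Lie_subgroup_Z: "connected_Lie_subgroup Z_grp"
proof (rule connected_Lie_subgroup_global_chart[OF subgroup_Z_grp subspace_chart_models(1)])
  show "immersion_on chart_line chart_line (exp_chart 1 0 1 1 0 0 0 1 0)"
    by (rule immersion_exp_chart_line) simp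
  show "homeomorphism chart_line Z_grp (exp_chart 1 0 1 1 0 0 0 1 0) (\<lambda>g. mat2 (ln (g$1$1)) 0 0 0)"
  proof (rule homeomorphismI)
    show "continuous_on Z_grp (\<lambda>g. mat2 (ln (g$1$1)) 0 0 0)"
      by (intro continuous_intros) (auto simp: Z_grp_def)
  qed (auto simp: exp_chart_def chart_line_def Z_grp_def vec_eq_iff forall_2 intro!: continuous_intros)
qed

lemma connected_Lie_subgroup_U: "connected_Lie_subgroup U_grp"
proof (rule connected_Lie_subgroup_global_chart[OF subgroup_U_grp subspace_chart_models(1)])
  show "immersion_on chart_line chart_line (exp_chart 1 1 1 1 0 1 0 1 0)"
    by (rule immersion_exp_chart_line) simp
  show "homeomorphism chart_line U_grp (exp_chart 1 1 1 1 0 1 0 1 0) (\<lambda>g. mat2 (ln (g$1$1)) 0 0 0)"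
  proof (rule homeomorphismI)
    show "continuous_on U_grp (\<lambda>g. mat2 (ln (g$1$1)) 0 0 0)"
      by (intro continuous_intros) (auto simp: U_grp_def)
  qed (auto simp: exp_chart_def chart_line_def U_grp_def vec_eq_iff forall_2 intro!: continuous_intros)
qed

lemma A_grp_parameter: "(\<alpha> + 1) * t - (\<alpha> - 1) * t = t * 2" for t :: real
  by (simp add: left_diff_distrib distrib_right)

lemma connected_Lie_subgroup_A: "connected_Lie_subgroup (A_grp \<alpha>)"
proof (rule connected_Lie_subgroup_global_chart[OF subgroup_A_grp subspace_chart_models(1)])
  show "immersion_on chart_line chart_line (exp_chart (\<alpha> + 1) 0 (\<alpha> - 1) 1 0 0 0 1 0)"
    by (rule immersion_exp_chart_line) auto
  show "homeomorphism chart_line (A_grp \<alpha>) (exp_chart (\<alpha> + 1) 0 (\<alpha> - 1) 1 0 0 0 1 0)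
      (\<lambda>g. mat2 ((ln (g$1$1) - ln (g$2$2)) / 2) 0 0 0)"
  proof (rule homeomorphismI)
    show "continuous_on (A_grp \<alpha>) (\<lambda>g. mat2 ((ln (g$1$1) - ln (g$2$2)) / 2) 0 0 0)"
      by (intro continuous_intros) (auto simp: A_grp_def)
  qed (auto simp: exp_chart_def chart_line_def A_grp_def vec_eq_iff forall_2 A_grp_parameter intro!: continuous_intros)
qed

lemma connected_Lie_subgroup_B: "connected_Lie_subgroup (B_grp \<alpha>)"
proof (rule connected_Lie_subgroup_global_chart[OF subgroup_B_grp subspace_chart_models(2)])
  show "immersion_on chart_plane chart_plane (exp_chart (\<alpha> + 1) 0 (\<alpha> - 1) 1 0 0 1 1 0)"
    by (rule immersion_exp_chart_plane) auto
  show "homeomorphism chart_plane (B_grp \<alpha>) (exp_chart (\<alpha> + 1) 0 (\<alpha> - 1) 1 0 0 1 1 0)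
      (\<lambda>g. mat2 ((ln (g$1$1) - ln (g$2$2)) / 2) 0 (g$2$1) 0)"
  proof (rule homeomorphismI)
    show "continuous_on (B_grp \<alpha>) (\<lambda>g. mat2 ((ln (g$1$1) - ln (g$2$2)) / 2) 0 (g$2$1) 0)"
      by (intro continuous_intros) (auto simp: B_grp_def)
  qed (auto simp: exp_chart_def chart_plane_def B_grp_def vec_eq_iff forall_2 A_grp_parameter intro!: continuous_intros)
qed

section \<open>Connected subgroups of the plane\<close>

locale additive_subgroup =
  fixes S :: "'a::real_vector set"
  assumes zero_mem: "0 \<in> S" and add_mem: "x \<in> S \<Longrightarrow> y \<in> S \<Longrightarrow> x + y \<in> S" and minus_mem: "x \<in> S \<Longrightarrow> - x \<in> S"
begin

lemma nat_scale_mem: "x \<in> S \<Longrightarrow> real n *\<^sub>R x \<in> S"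
proof (induction n)
  case (Suc n)
  then show ?case using add_mem[of x "real n *\<^sub>R x"] by (simp add: scaleR_left_distrib)
qed (simp add: zero_mem)

lemma int_scale_mem: "x \<in> S \<Longrightarrow> real_of_int k *\<^sub>R x \<in> S"
proof (cases k)
  case (nonneg n)
  then show "x \<in> S \<Longrightarrow> real_of_int k *\<^sub>R x \<in> S" using nat_scale_mem by simp
next
  case (neg n)
  then show "x \<in> S \<Longrightarrow> real_of_int k *\<^sub>R x \<in> S"
    using minus_mem[OF nat_scale_mem[of x "Suc n"]] by (simp only: of_int_minus of_int_of_nat_eq scaleR_minus_left)
qed

lemma linear_image: "linear f \<Longrightarrow> additive_subgroup (f ` S)"
  by unfold_locales (use zero_mem add_mem minus_mem in \<open>auto simp flip: linear_0 linear_add linear_neg intro!: imageI simp: image_iff\<close>)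

end

text \<open>
  A connected subset containing 0 and \<open>s\<close> contains the interval between them, and the multiples of that
  interval and its negative exhaust the line.
\<close>

lemma additive_subgroup_real_UNIV:
  fixes S :: "real set"
  assumes S: "additive_subgroup S" and C: "connected C" "C \<subseteq> S" "0 \<in> C" "s \<in> C" "s \<noteq> 0"
  shows "S = UNIV"
proof -
  interpret additive_subgroup S by fact
  have small: "y \<in> S" if "\<bar>y\<bar> \<le> \<bar>s\<bar>" for y
  proof -
    have int: "z \<in> C" if "0 \<le> z \<and> z \<le> s \<or> s \<le> z \<and> z \<le> 0" for z
      using connectedD_interval[OF C(1,3,4), of z] connectedD_interval[OF C(1,4,3), of z] that by blast
    have "y \<in> C \<or> - y \<in> C" using int[of y] int[of "- y"] that by linarith
    then show ?thesis using C(2) minus_mem[of "- y"] by auto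
  qed
  have "y \<in> S" for y
  proof -
    obtain n :: nat where n: "\<bar>y\<bar> / \<bar>s\<bar> < real n" using reals_Archimedean2 by blast
    have "0 \<le> \<bar>y\<bar> / \<bar>s\<bar>" by simp
    then have n0: "0 < real n" using n by linarith
    have "\<bar>y\<bar> < real n * \<bar>s\<bar>" using n C(5) by (simp add: divide_less_eq)
    then have "\<bar>y / real n\<bar> \<le> \<bar>s\<bar>" using n0 by (simp add: divide_le_eq mult.commute)
    then have "real n *\<^sub>R (y / real n) \<in> S" by (intro nat_scale_mem small)
    then show ?thesis using n0 by simp
  qed
  then show ?thesis by blast
qed

lemma connected_subgroup_real:
  fixes S :: "real set"
  assumes "additive_subgroup S" "connected S"
  shows "S = {0} \<or> S = UNIV"
proof (cases "\<exists>s\<in>S. s \<noteq> 0")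
  case True
  then show ?thesis using additive_subgroup_real_UNIV[OF assms(1,2) order_refl] additive_subgroup.zero_mem[OF assms(1)] by blast
next
  case False
  then show ?thesis using additive_subgroup.zero_mem[OF assms(1)] by blast
qed

text \<open>
  On a non-trivial connected subgroup the norm takes all small values. Choose elements \<open>v\<^sub>n\<close> of norm tending to
  0 whose directions converge to \<open>u\<close>: the integer multiples of \<open>v\<^sub>n\<close> approximate every point of the line
  spanned by \<open>u\<close>.
\<close>

lemma limit_direction_approximable:
  fixes S :: "(real \<times> real) set"
  assumes S: "additive_subgroup S" and conn: "connected S" and ne: "S \<noteq> {0}"
  obtains u where "norm u = 1" "\<And>t e. 0 < e \<Longrightarrow> \<exists>r\<in>S. dist (t *\<^sub>R u) r < e"
proof -
  interpret additive_subgroup S by fact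
  obtain v0 where v0: "v0 \<in> S" "v0 \<noteq> 0" using ne zero_mem by blast
  have "\<exists>v\<in>S. 0 < norm v \<and> norm v \<le> 1 / real (Suc n)" for n
  proof -
    have "connected (norm ` S)" by (intro connected_continuous_image conn continuous_intros)
    moreover have "0 \<in> norm ` S" using zero_mem by force
    moreover have "norm v0 \<in> norm ` S" using v0 by blast
    ultimately have "min (norm v0) (1 / real (Suc n)) \<in> norm ` S"
      by (rule connectedD_interval) simp_all
    then obtain v where "v \<in> S" "norm v = min (norm v0) (1 / real (Suc n))" by (metis imageE)
    then show ?thesis using v0 by (intro bexI[of _ v]) auto
  qed
  then obtain v where v: "\<And>n. v n \<in> S" "\<And>n. 0 < norm (v n)" "\<And>n. norm (v n) \<le> 1 / real (Suc n)"
    by metis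
  have "\<forall>n. sgn (v n) \<in> sphere 0 1" using v(2) by (simp add: norm_sgn)
  then obtain u \<rho> where u: "u \<in> sphere 0 1" "strict_mono \<rho>" "((\<lambda>n. sgn (v n)) \<circ> \<rho>) \<longlonglongrightarrow> u"
    using compact_sphere[of "0::real \<times> real" 1] unfolding compact_def by metis
  show thesis
  proof
    show "norm u = 1" using u(1) by simp
    fix t e :: real assume e: "0 < e"
    define d where "d = e / (2 * (\<bar>t\<bar> + 1))"
    have d: "0 < d" using e by (simp add: d_def)
    obtain N where N: "\<And>n. N \<le> n \<Longrightarrow> dist (sgn (v (\<rho> n))) u < d"
      using u(3) d unfolding lim_sequentially by (metis comp_apply)
    obtain M where M: "1 / real (Suc M) < e / 2" using e nat_approx_posE[of "e / 2"] by auto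
    define n where "n = \<rho> (max N M)"
    have "max N M \<le> n" unfolding n_def by (rule seq_suble[OF u(2)])
    then have "1 / real (Suc n) \<le> 1 / real (Suc M)" by (intro divide_left_mono) auto
    then have small: "norm (v n) < e / 2" using v(3)[of n] M by linarith
    have dir: "dist (sgn (v n)) u < d" using N[of "max N M"] by (simp add: n_def)
    \<comment> \<open>The multiple of \<open>v n\<close> whose length is closest to \<open>t\<close> from below.\<close>
    define k where "k = \<lfloor>t / norm (v n)\<rfloor>"
    have "real_of_int k \<le> t / norm (v n)" "t / norm (v n) < real_of_int k + 1" unfolding k_def by linarith+
    then have "real_of_int k * norm (v n) \<le> t" "t < (real_of_int k + 1) * norm (v n)"
      using v(2)[of n] by (simp_all add: le_divide_eq divide_less_eq)
    then have k: "\<bar>t - real_of_int k * norm (v n)\<bar> \<le> norm (v n)" by (simp add: distrib_right)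
    have vn: "v n = norm (v n) *\<^sub>R sgn (v n)" using v(2)[of n] by (simp add: sgn_div_norm)
    have "t *\<^sub>R u - real_of_int k *\<^sub>R v n = t *\<^sub>R (u - sgn (v n)) + (t - real_of_int k * norm (v n)) *\<^sub>R sgn (v n)"
      by (subst (1) vn) (simp add: algebra_simps)
    then have "norm (t *\<^sub>R u - real_of_int k *\<^sub>R v n) \<le> norm (t *\<^sub>R (u - sgn (v n))) + norm ((t - real_of_int k * norm (v n)) *\<^sub>R sgn (v n))"
      by (metis norm_triangle_ineq)
    also have "\<dots> \<le> \<bar>t\<bar> * d + norm (v n)"
      using k dir v(2)[of n] by (intro add_mono) (auto simp: norm_sgn dist_norm norm_minus_commute intro!: mult_left_mono)
    also have "\<bar>t\<bar> * d \<le> e / 2"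
    proof -
      have "\<bar>t\<bar> * d \<le> (\<bar>t\<bar> + 1) * d" using d by (intro mult_right_mono) auto
      also have "\<dots> = e / 2" by (simp add: d_def field_simps)
      finally show ?thesis .
    qed
    finally have "norm (t *\<^sub>R u - real_of_int k *\<^sub>R v n) < e" using small by linarith
    then show "\<exists>r\<in>S. dist (t *\<^sub>R u) r < e"
      using int_scale_mem[OF v(1)[of n], of k] by (intro bexI[of _ "real_of_int k *\<^sub>R v n"]) (auto simp: dist_norm)
  qed
qed

text \<open>
  Let \<open>u\<close> be a direction whose line is approximated by \<open>S\<close>. The component orthogonal to \<open>u\<close> takes on \<open>S\<close>
  either the value 0 only, and then \<open>S\<close> is the line itself, or all values, and then \<open>S\<close> comes close to every
  point. The third alternative is stated with distance 1 because bounded errors are irrelevant here; the first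
  two are exact.
\<close>

lemma connected_subgroup_plane:
  fixes S :: "(real \<times> real) set"
  assumes S: "additive_subgroup S" and conn: "connected S"
  shows "S = {0} \<or> (\<exists>u. u \<noteq> 0 \<and> S = range (\<lambda>t. t *\<^sub>R u)) \<or> (\<forall>p. \<exists>q\<in>S. dist p q \<le> 1)"
proof (cases "S = {0}")
  case False
  interpret additive_subgroup S by fact
  obtain u where u: "norm u = 1" and app: "\<And>t e. 0 < e \<Longrightarrow> \<exists>r\<in>S. dist (t *\<^sub>R u) r < e"
    using limit_direction_approximable[OF S conn False] by blast
  define w where "w = (snd u, - fst u)"
  have uu: "fst u * fst u + snd u * snd u = 1"
    using u by (simp add: norm_eq_sqrt_inner inner_prod_def)
  have decomp: "p = (p \<bullet> u) *\<^sub>R u + (p \<bullet> w) *\<^sub>R w" for p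
  proof (rule prod_eqI)
    have "(p \<bullet> u) * fst u + (p \<bullet> w) * fst w = fst p * (fst u * fst u + snd u * snd u)"
      by (simp add: w_def inner_prod_def algebra_simps)
    then show "fst p = fst ((p \<bullet> u) *\<^sub>R u + (p \<bullet> w) *\<^sub>R w)" by (simp add: uu)
    have "(p \<bullet> u) * snd u + (p \<bullet> w) * snd w = snd p * (fst u * fst u + snd u * snd u)"
      by (simp add: w_def inner_prod_def algebra_simps)
    then show "snd p = snd ((p \<bullet> u) *\<^sub>R u + (p \<bullet> w) *\<^sub>R w)" by (simp add: uu)
  qed
  have im: "(\<lambda>p. p \<bullet> z) ` S = {0} \<or> (\<lambda>p. p \<bullet> z) ` S = UNIV" for z
  proof (rule connected_subgroup_real)
    show "additive_subgroup ((\<lambda>p. p \<bullet> z) ` S)"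
      by (rule linear_image) (rule bounded_linear.linear[OF bounded_linear_inner_left])
    show "connected ((\<lambda>p. p \<bullet> z) ` S)" by (intro connected_continuous_image conn continuous_intros)
  qed
  show ?thesis
  proof (cases "(\<lambda>p. p \<bullet> w) ` S = {0}")
    case True
    have on_line: "p = (p \<bullet> u) *\<^sub>R u" if "p \<in> S" for p
    proof -
      have "p \<bullet> w \<in> (\<lambda>p. p \<bullet> w) ` S" using that by blast
      then have "p \<bullet> w = 0" using True by simp
      then show ?thesis by (metis decomp add.right_neutral scale_zero_left)
    qed
    have "(\<lambda>p. p \<bullet> u) ` S \<noteq> {0}"
    proof
      assume *: "(\<lambda>p. p \<bullet> u) ` S = {0}"
      have "p = 0" if "p \<in> S" for p
      proof -
        have "p \<bullet> u \<in> (\<lambda>p. p \<bullet> u) ` S" using that by blast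
        then have "p \<bullet> u = 0" using * by simp
        then show ?thesis by (metis on_line[OF that] scale_zero_left)
      qed
      then show False using False zero_mem by blast
    qed
    then have all: "(\<lambda>p. p \<bullet> u) ` S = UNIV" using im by blast
    have "t *\<^sub>R u \<in> S" for t
    proof -
      have "t \<in> (\<lambda>p. p \<bullet> u) ` S" by (simp add: all)
      then obtain p where "p \<in> S" "t = p \<bullet> u" by blast
      then show ?thesis using on_line by metis
    qed
    then have "S = range (\<lambda>t. t *\<^sub>R u)" using on_line by blast
    moreover have "u \<noteq> 0" using u by force
    ultimately show ?thesis by blast
  next
    case False
    then have all: "(\<lambda>p. p \<bullet> w) ` S = UNIV" using im by blast
    have "\<exists>q\<in>S. dist p q \<le> 1" for p
    proof -
      have "p \<bullet> w \<in> (\<lambda>p. p \<bullet> w) ` S" by (simp add: all)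
      then obtain q where q: "q \<in> S" "p \<bullet> w = q \<bullet> w" by blast
      then have "(p - q) \<bullet> w = 0" by (simp add: inner_diff_left)
      then have "p - q = ((p - q) \<bullet> u) *\<^sub>R u" by (metis decomp add.right_neutral scale_zero_left)
      moreover obtain r where r: "r \<in> S" "dist (((p - q) \<bullet> u) *\<^sub>R u) r < 1" using app[of 1] zero_less_one by blast
      ultimately have "dist (p - q) r < 1" by simp
      then have "dist p (q + r) \<le> 1" by (simp add: dist_norm diff_diff_eq)
      then show ?thesis using add_mem[OF q(1) r(1)] by blast
    qed
    then show ?thesis by blast
  qed
qed simp

section \<open>Regions over subgroups of the plane\<close>

definition classified :: "(real^2^2) set \<Rightarrow> bool" where
  "classified H \<longleftrightarrow> (\<exists>P \<in> plane_models.
     coarse_eq (cartan_mu ` H) P)"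

lemma classifiedI:
  assumes "coarse_eq (cartan_mu ` H) P"
    "P \<in> plane_models"
  shows "classified H"
  using assms unfolding classified_def by blast

lemma coarse_eq_conjugate:
  assumes P: "invertible P" and H: "H \<subseteq> carrier GL2"
  shows "coarse_eq (cartan_mu ` (\<lambda>g. P ** g ** matrix_inv P) ` H) (cartan_mu ` H)"
proof -
  have "compactin GL2_top {P}" using P unfolding compactin_GL2_top by simp
  then obtain R where R: "1 \<le> R" "P \<in> GL2_ball R" by (rule compactin_GL2_top_imp_ball) blast
  have d: "dist (cartan_mu (P ** g ** matrix_inv P)) (cartan_mu g) \<le> 20 * ln R" if "g \<in> H" for g
    using cartan_mu_two_sided_bound[OF R(2,2,1)] that H by auto
  have "near (cartan_mu ` (\<lambda>g. P ** g ** matrix_inv P) ` H) (cartan_mu ` H)"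
    by (rule nearI[of _ _ "20 * ln R"]) (use d in blast)
  moreover have "near (cartan_mu ` H) (cartan_mu ` (\<lambda>g. P ** g ** matrix_inv P) ` H)"
  proof (rule nearI[of _ _ "20 * ln R"])
    fix a assume "a \<in> cartan_mu ` H"
    then obtain g where "g \<in> H" "a = cartan_mu g" by blast
    then show "\<exists>b\<in>cartan_mu ` (\<lambda>g. P ** g ** matrix_inv P) ` H. dist a b \<le> 20 * ln R"
      using d[of g] by (intro bexI[of _ "cartan_mu (P ** g ** matrix_inv P)"]) (auto simp: dist_commute)
  qed
  ultimately show ?thesis by (simp add: coarse_eq_def)
qed

text \<open>
  Up to bounded error, these are the images under \<open>\<mu>\<close> of three kinds of triangular groups. In the first two,
  \<open>\<Lambda>\<close> is the group of pairs of logarithms of the diagonal entries, for groups that contain all unipotents and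
  for diagonal groups respectively. In the third, \<open>\<Lambda>\<close> consists of the pairs \<open>(x, \<tau>)\<close> for the elements
  \<open>exp x (1 0; \<tau> 1)\<close> of a group of multiples of unipotents.
\<close>

definition cone_over :: "(real \<times> real) set \<Rightarrow> (real \<times> real) set" where
  "cone_over \<Lambda> = {(x + y, q) | x y q. (x, y) \<in> \<Lambda> \<and> \<bar>x - y\<bar> \<le> q}"

definition graph_over :: "(real \<times> real) set \<Rightarrow> (real \<times> real) set" where
  "graph_over \<Lambda> = {(x + y, \<bar>x - y\<bar>) | x y. (x, y) \<in> \<Lambda>}"

definition parabolic_over :: "(real \<times> real) set \<Rightarrow> (real \<times> real) set" where
  "parabolic_over \<Lambda> = {(2 * x, ln (1 + \<tau>\<^sup>2)) | x \<tau>. (x, \<tau>) \<in> \<Lambda>}"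

lemma plane_models_mem:
  "plane_A \<alpha> \<in> plane_models" "plane_B \<alpha> \<in> plane_models" "plane_1 \<in> plane_models"
  "plane_G \<in> plane_models" "plane_Z \<in> plane_models" "plane_U \<in> plane_models"
  by (auto simp: plane_models_def)

lemma plane_A_0: "plane_A 0 = {(0, q) | q. 0 \<le> q}"
  unfolding plane_A_def by (auto intro: exI[of _ "\<bar>_\<bar>"] abs_of_nonneg[symmetric])

text \<open>
  For a line \<open>\<Lambda>\<close> of direction \<open>(p, r)\<close>, the cone has parameter \<open>\<alpha> = (p + r) / (p - r)\<close>, and it degenerates
  to the half-plane if \<open>p = r\<close>.
\<close>

lemma coarse_cone_over:
  assumes "additive_subgroup \<Lambda>" "connected \<Lambda>"
  shows "\<exists>P \<in> plane_models. coarse_eq (cone_over \<Lambda>) P"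
  using connected_subgroup_plane[OF assms]
proof (elim disjE exE conjE)
  assume "\<Lambda> = {0}"
  then have "cone_over \<Lambda> = plane_A 0" by (auto simp: cone_over_def plane_A_0 zero_prod_def)
  then show ?thesis using coarse_eq_refl plane_models_mem(1)[of 0] by metis
next
  fix u assume u: "u \<noteq> 0" "\<Lambda> = range (\<lambda>t. t *\<^sub>R u)"
  obtain p r where pr: "u = (p, r)" by (cases u)
  have L: "cone_over \<Lambda> = {(t * p + t * r, q) | t q. \<bar>t * p - t * r\<bar> \<le> q}"
    unfolding cone_over_def u(2) pr by force
  show ?thesis
  proof (cases "p = r")
    case True
    then have "p \<noteq> 0" using u pr by (auto simp: zero_prod_def)
    have "(x, q) \<in> cone_over \<Lambda>" if "0 \<le> q" for x q
      unfolding L using that True \<open>p \<noteq> 0\<close> by (auto intro!: exI[of _ "x / (2 * p)"])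
    then have "cone_over \<Lambda> = plane_G"
      by (auto simp: plane_G_def cone_over_def intro: order_trans[OF abs_ge_zero])
    then show ?thesis using coarse_eq_refl plane_models_mem(4) by metis
  next
    case False
    define \<alpha> where "\<alpha> = (p + r) / (p - r)"
    have "\<alpha> * (p - r) = p + r" using False by (simp add: \<alpha>_def)
    then have al: "t * p + t * r = \<alpha> * (t * (p - r))" for t by (metis distrib_left mult.left_commute)
    have "cone_over \<Lambda> = plane_B \<alpha>"
    proof (intro subset_antisym subsetI)
      fix z assume "z \<in> cone_over \<Lambda>"
      then obtain t q where z: "z = (\<alpha> * (t * (p - r)), q)" "\<bar>t * (p - r)\<bar> \<le> q"
        unfolding L al by (auto simp: right_diff_distrib)
      then have "\<bar>\<alpha>\<bar> * \<bar>t * (p - r)\<bar> \<le> \<bar>\<alpha>\<bar> * q" by (intro mult_left_mono) auto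
      moreover have "0 \<le> q" using z(2) abs_ge_zero order_trans by blast
      ultimately show "z \<in> plane_B \<alpha>" using z by (auto simp: plane_B_def abs_mult)
    next
      fix z assume "z \<in> plane_B \<alpha>"
      then obtain x q where z: "z = (x, q)" "0 \<le> q" "\<bar>x\<bar> \<le> \<bar>\<alpha>\<bar> * q" by (auto simp: plane_B_def)
      define t where "t = (if \<alpha> = 0 then 0 else x / (\<alpha> * (p - r)))"
      have "\<alpha> * (t * (p - r)) = x" using z False by (auto simp: t_def)
      moreover have "\<bar>t * (p - r)\<bar> \<le> q"
        using z False by (auto simp: t_def abs_mult divide_le_eq mult.commute)
      ultimately show "z \<in> cone_over \<Lambda>" unfolding L al z by (auto simp: right_diff_distrib)
    qed
    then show ?thesis using coarse_eq_refl plane_models_mem(2) by metis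
  qed
next
  assume dense: "\<forall>p. \<exists>q\<in>\<Lambda>. dist p q \<le> 1"
  have "cone_over \<Lambda> \<subseteq> plane_G" by (auto simp: cone_over_def plane_G_def intro: order_trans[OF abs_ge_zero])
  moreover have "near plane_G (cone_over \<Lambda>)"
  proof (rule nearI[of _ _ 4])
    fix a assume "a \<in> plane_G"
    then obtain X q where a: "a = (X, q)" "0 \<le> q" by (auto simp: plane_G_def)
    obtain x y where xy: "(x, y) \<in> \<Lambda>" "dist (X / 2, X / 2) (x, y) \<le> 1" using dense by (metis surj_pair)
    then have "\<bar>X / 2 - x\<bar> \<le> 1" "\<bar>X / 2 - y\<bar> \<le> 1"
      using abs_fst_diff_le abs_snd_diff_le by fastforce+
    then have "dist a (x + y, max q \<bar>x - y\<bar>) \<le> 4"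
      using dist_prod_le[of a "(x + y, max q \<bar>x - y\<bar>)"] a by (simp add: max_def split: if_splits)
    moreover have "(x + y, max q \<bar>x - y\<bar>) \<in> cone_over \<Lambda>" using xy(1) by (force simp: cone_over_def)
    ultimately show "\<exists>b\<in>cone_over \<Lambda>. dist a b \<le> 4" by blast
  qed
  ultimately have "coarse_eq (cone_over \<Lambda>) plane_G" by (simp add: coarse_eq_def near_subset)
  then show ?thesis using plane_models_mem(4) by blast
qed

text \<open>
  As for the cone, with the boundary rays in place of the cone, and with the line \<open>plane_Z\<close> for \<open>p = r\<close>.
  For dense \<open>\<Lambda>\<close>, the point \<open>(X, q)\<close> is hit approximately by \<open>x = (X + q) / 2\<close> and \<open>y = (X - q) / 2\<close>.
\<close>

lemma coarse_graph_over:
  assumes "additive_subgroup \<Lambda>" "connected \<Lambda>"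
  shows "\<exists>P \<in> plane_models. coarse_eq (graph_over \<Lambda>) P"
  using connected_subgroup_plane[OF assms]
proof (elim disjE exE conjE)
  assume "\<Lambda> = {0}"
  then have "graph_over \<Lambda> = plane_1" by (auto simp: graph_over_def plane_1_def zero_prod_def)
  then show ?thesis using coarse_eq_refl plane_models_mem(3) by metis
next
  fix u assume u: "u \<noteq> 0" "\<Lambda> = range (\<lambda>t. t *\<^sub>R u)"
  obtain p r where pr: "u = (p, r)" by (cases u)
  have L: "graph_over \<Lambda> = {(t * p + t * r, \<bar>t * p - t * r\<bar>) | t. True}"
    by (auto simp: graph_over_def u(2) pr)
  show ?thesis
  proof (cases "p = r")
    case True
    then have "p \<noteq> 0" using u pr by (auto simp: zero_prod_def)
    then have "(x, 0) \<in> graph_over \<Lambda>" for x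
      unfolding L using True by (auto intro!: exI[of _ "x / (2 * p)"])
    then have "graph_over \<Lambda> = plane_Z" unfolding plane_Z_def using L True by auto
    then show ?thesis using coarse_eq_refl plane_models_mem(5) by metis
  next
    case False
    define \<alpha> where "\<alpha> = (p + r) / (p - r)"
    have "\<alpha> * (p - r) = p + r" using False by (simp add: \<alpha>_def)
    then have al: "t * p + t * r = \<alpha> * (t * (p - r))" for t by (metis distrib_left mult.left_commute)
    have "graph_over \<Lambda> = plane_A \<alpha>"
    proof (intro subset_antisym subsetI)
      fix z assume "z \<in> graph_over \<Lambda>"
      then show "z \<in> plane_A \<alpha>" unfolding L al plane_A_def right_diff_distrib[symmetric] by blast
    next
      fix z assume "z \<in> plane_A \<alpha>"
      then obtain s where z: "z = (\<alpha> * s, \<bar>s\<bar>)" by (auto simp: plane_A_def)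
      define t where "t = s / (p - r)"
      have "s = t * (p - r)" using False by (simp add: t_def)
      then show "z \<in> graph_over \<Lambda>" unfolding L al right_diff_distrib[symmetric] using z by blast
    qed
    then show ?thesis using coarse_eq_refl plane_models_mem(1) by metis
  qed
next
  assume dense: "\<forall>p. \<exists>q\<in>\<Lambda>. dist p q \<le> 1"
  have "graph_over \<Lambda> \<subseteq> plane_G" by (auto simp: graph_over_def plane_G_def)
  moreover have "near plane_G (graph_over \<Lambda>)"
  proof (rule nearI[of _ _ 4])
    fix a assume "a \<in> plane_G"
    then obtain X q where a: "a = (X, q)" "0 \<le> q" by (auto simp: plane_G_def)
    obtain x y where xy: "(x, y) \<in> \<Lambda>" "dist ((X + q) / 2, (X - q) / 2) (x, y) \<le> 1" using dense by (metis surj_pair)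
    then have "\<bar>(X + q) / 2 - x\<bar> \<le> 1" "\<bar>(X - q) / 2 - y\<bar> \<le> 1"
      using abs_fst_diff_le abs_snd_diff_le by fastforce+
    then have "X + q - 2 * x \<le> 2" "2 * x - (X + q) \<le> 2" "X - q - 2 * y \<le> 2" "2 * y - (X - q) \<le> 2"
      by (simp_all add: abs_le_iff field_simps)
    then have "\<bar>X - (x + y)\<bar> \<le> 2" "\<bar>q - (x - y)\<bar> \<le> 2" unfolding abs_le_iff by linarith+
    then have "dist a (x + y, \<bar>x - y\<bar>) \<le> 4"
      using dist_prod_le[of a "(x + y, \<bar>x - y\<bar>)"] a by simp
    moreover have "(x + y, \<bar>x - y\<bar>) \<in> graph_over \<Lambda>" using xy(1) by (force simp: graph_over_def)
    ultimately show "\<exists>b\<in>graph_over \<Lambda>. dist a b \<le> 4" by blast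
  qed
  ultimately have "coarse_eq (graph_over \<Lambda>) plane_G" by (simp add: coarse_eq_def near_subset)
  then show ?thesis using plane_models_mem(4) by blast
qed

lemma ln_one_plus_square_scale:
  fixes x y c :: real
  assumes "1 + x\<^sup>2 \<le> c * (1 + y\<^sup>2)" "1 + y\<^sup>2 \<le> c * (1 + x\<^sup>2)" "0 < c"
  shows "\<bar>ln (1 + x\<^sup>2) - ln (1 + y\<^sup>2)\<bar> \<le> ln c"
proof -
  have p: "0 < 1 + x\<^sup>2" "0 < 1 + y\<^sup>2" by (auto intro: add_pos_nonneg)
  have "ln (1 + x\<^sup>2) \<le> ln (c * (1 + y\<^sup>2))" "ln (1 + y\<^sup>2) \<le> ln (c * (1 + x\<^sup>2))"
    using p assms by (subst ln_le_cancel_iff; simp)+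
  then have "ln (1 + x\<^sup>2) \<le> ln c + ln (1 + y\<^sup>2)" "ln (1 + y\<^sup>2) \<le> ln c + ln (1 + x\<^sup>2)"
    using p assms(3) by (simp_all only: ln_mult_pos)
  then show ?thesis by linarith
qed

text \<open>
  A line of direction \<open>(p, c)\<close> gives \<open>plane_U\<close> if neither coordinate vanishes, since the factor \<open>c / p\<close>
  changes the logarithm by a bounded amount only; it gives \<open>plane_Z\<close> if \<open>c = 0\<close>, and the vertical ray if
  \<open>p = 0\<close>.
\<close>

lemma coarse_parabolic_over:
  assumes "additive_subgroup \<Lambda>" "connected \<Lambda>"
  shows "\<exists>P \<in> plane_models. coarse_eq (parabolic_over \<Lambda>) P"
  using connected_subgroup_plane[OF assms]
proof (elim disjE exE conjE)
  assume "\<Lambda> = {0}"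
  then have "parabolic_over \<Lambda> = plane_1" by (auto simp: parabolic_over_def plane_1_def zero_prod_def)
  then show ?thesis using coarse_eq_refl plane_models_mem(3) by metis
next
  fix u assume u: "u \<noteq> 0" "\<Lambda> = range (\<lambda>t. t *\<^sub>R u)"
  obtain p c where pc: "u = (p, c)" by (cases u)
  have L: "parabolic_over \<Lambda> = {(2 * (t * p), ln (1 + (t * c)\<^sup>2)) | t. True}"
    by (auto simp: parabolic_over_def u(2) pc)
  show ?thesis
  proof (cases "p = 0")
    case True
    then have "c \<noteq> 0" using u pc by (auto simp: zero_prod_def)
    have "(0, q) \<in> parabolic_over \<Lambda>" if "0 \<le> q" for q
    proof -
      define t where "t = sqrt (exp q - 1) / c"
      have "(t * c)\<^sup>2 = exp q - 1" using \<open>c \<noteq> 0\<close> that by (simp add: t_def)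
      then have "(0, q) = (2 * (t * p), ln (1 + (t * c)\<^sup>2))" using True by simp
      then show ?thesis unfolding L by blast
    qed
    then have "parabolic_over \<Lambda> = plane_A 0" unfolding plane_A_0 using L True by auto
    then show ?thesis using coarse_eq_refl plane_models_mem(1)[of 0] by metis
  next
    case p: False
    show ?thesis
    proof (cases "c = 0")
      case True
      have "(x, 0) \<in> parabolic_over \<Lambda>" for x
        unfolding L using True p by (auto intro!: exI[of _ "x / (2 * p)"])
      then have "parabolic_over \<Lambda> = plane_Z" unfolding plane_Z_def using L True by auto
      then show ?thesis using coarse_eq_refl plane_models_mem(5) by metis
    next
      case False
      define \<kappa> where "\<kappa> = (c / (2 * p))\<^sup>2"
      define m where "m = max 1 (max \<kappa> (1 / \<kappa>))"
      have \<kappa>: "0 < \<kappa>" using p False by (simp add: \<kappa>_def)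
      have m: "1 \<le> m" "\<kappa> \<le> m" "1 / \<kappa> \<le> m" by (simp_all add: m_def)
      have bd: "\<bar>ln (1 + (t * c)\<^sup>2) - ln (1 + (2 * (t * p))\<^sup>2)\<bar> \<le> ln m" for t
      proof (rule ln_one_plus_square_scale)
        have e: "(t * c)\<^sup>2 = \<kappa> * (2 * (t * p))\<^sup>2" "(2 * (t * p))\<^sup>2 = 1 / \<kappa> * (t * c)\<^sup>2"
          using p False by (simp_all add: \<kappa>_def power_mult_distrib power_divide)
        have "(t * c)\<^sup>2 \<le> m * (2 * (t * p))\<^sup>2"
          unfolding e(1) using m by (intro mult_right_mono) auto
        then show "1 + (t * c)\<^sup>2 \<le> m * (1 + (2 * (t * p))\<^sup>2)" using m(1) by (simp add: distrib_left)
        have "(2 * (t * p))\<^sup>2 \<le> m * (t * c)\<^sup>2"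
          by (subst e(2)) (use m in \<open>intro mult_right_mono; simp\<close>)
        then show "1 + (2 * (t * p))\<^sup>2 \<le> m * (1 + (t * c)\<^sup>2)" using m(1) by (simp add: distrib_left)
      qed (use m in simp)
      have d: "dist (2 * (t * p), ln (1 + (t * c)\<^sup>2)) (2 * (t * p), ln (1 + (2 * (t * p))\<^sup>2)) \<le> ln m" for t
        unfolding dist_same_fst by (rule bd)
      have "near (parabolic_over \<Lambda>) plane_U"
        by (rule nearI[of _ _ "ln m"]) (use d in \<open>unfold L plane_U_def, blast\<close>)
      moreover have "near plane_U (parabolic_over \<Lambda>)"
      proof (rule nearI[of _ _ "ln m"])
        fix a assume "a \<in> plane_U"
        then obtain x where a: "a = (x, ln (1 + x\<^sup>2))" by (auto simp: plane_U_def)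
        define t where "t = x / (2 * p)"
        have x: "x = 2 * (t * p)" using p by (simp add: t_def)
        show "\<exists>b\<in>parabolic_over \<Lambda>. dist a b \<le> ln m"
          unfolding a x using d[of t] by (subst dist_commute) (unfold L, blast)
      qed
      ultimately have "coarse_eq (parabolic_over \<Lambda>) plane_U" by (simp add: coarse_eq_def)
      then show ?thesis using plane_models_mem(6) by blast
    qed
  qed
next
  assume dense: "\<forall>p. \<exists>q\<in>\<Lambda>. dist p q \<le> 1"
  have "parabolic_over \<Lambda> \<subseteq> plane_G" by (auto simp: parabolic_over_def plane_G_def)
  moreover have "near plane_G (parabolic_over \<Lambda>)"
  proof (rule nearI[of _ _ "2 + ln 3"])
    fix a assume "a \<in> plane_G"
    then obtain X q where a: "a = (X, q)" "0 \<le> q" by (auto simp: plane_G_def)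
    define \<tau> where "\<tau> = sqrt (exp q - 1)"
    have q: "q = ln (1 + \<tau>\<^sup>2)" using a(2) by (simp add: \<tau>_def)
    obtain x \<sigma> where xs: "(x, \<sigma>) \<in> \<Lambda>" "dist (X / 2, \<tau>) (x, \<sigma>) \<le> 1" using dense by (metis surj_pair)
    then have le: "\<bar>X / 2 - x\<bar> \<le> 1" "\<bar>\<tau> - \<sigma>\<bar> \<le> 1"
      using abs_fst_diff_le abs_snd_diff_le by fastforce+
    have sq: "1 + v\<^sup>2 \<le> 3 * (1 + w\<^sup>2)" if "\<bar>v - w\<bar> \<le> 1" for v w :: real
    proof -
      have "(v - w)\<^sup>2 \<le> 1" using that by (metis abs_le_square_iff abs_one one_power2)
      moreover have "0 \<le> (v - 2 * w)\<^sup>2" by simp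
      ultimately have "v\<^sup>2 + w\<^sup>2 - 2 * (v * w) \<le> 1" "0 \<le> v\<^sup>2 + 4 * w\<^sup>2 - 4 * (v * w)"
        by (simp_all add: power2_diff power_mult_distrib)
      then have "v\<^sup>2 \<le> 2 + 2 * w\<^sup>2" by linarith
      moreover have "0 \<le> w\<^sup>2" by simp
      ultimately have "1 + v\<^sup>2 \<le> 3 + 3 * w\<^sup>2" by linarith
      then show ?thesis by (simp add: distrib_left)
    qed
    have "\<bar>ln (1 + \<tau>\<^sup>2) - ln (1 + \<sigma>\<^sup>2)\<bar> \<le> ln 3"
      using sq[of \<tau> \<sigma>] sq[of \<sigma> \<tau>] le(2) by (intro ln_one_plus_square_scale) (auto simp: abs_minus_commute)
    then have "dist a (2 * x, ln (1 + \<sigma>\<^sup>2)) \<le> 2 + ln 3"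
      using dist_prod_le[of a "(2 * x, ln (1 + \<sigma>\<^sup>2))"] a(1) q le(1) by simp
    moreover have "(2 * x, ln (1 + \<sigma>\<^sup>2)) \<in> parabolic_over \<Lambda>" using xs(1) by (force simp: parabolic_over_def)
    ultimately show "\<exists>b\<in>parabolic_over \<Lambda>. dist a b \<le> 2 + ln 3" by blast
  qed
  ultimately have "coarse_eq (parabolic_over \<Lambda>) plane_G" by (simp add: coarse_eq_def near_subset)
  then show ?thesis using plane_models_mem(4) by blast
qed

lemma classified_coarse_eq:
  assumes "coarse_eq (cartan_mu ` H) X"
    "\<exists>P \<in> plane_models. coarse_eq X P"
  shows "classified H"
  using assms coarse_eq_trans unfolding classified_def by meson

section \<open>Connected groups with an invariant line\<close>

text \<open>
  Connectedness refers to the topology of the matrix space. A connected Lie subgroup satisfies it because its own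
  manifold topology is finer.
\<close>

locale connected_matrix_group =
  fixes H :: "(real^2^2) set"
  assumes invertible: "g \<in> H \<Longrightarrow> invertible g"
    and one_mem: "mat 1 \<in> H"
    and mult_mem: "g \<in> H \<Longrightarrow> h \<in> H \<Longrightarrow> g ** h \<in> H"
    and inv_mem: "g \<in> H \<Longrightarrow> matrix_inv g \<in> H"
    and conn: "connected H"
begin

lemma sign_constant:
  assumes f: "continuous_on H f" and nz: "\<And>g. g \<in> H \<Longrightarrow> f g \<noteq> 0" and one: "0 < f (mat 1)" and g: "g \<in> H"
  shows "0 < (f g :: real)"
proof (rule ccontr)
  assume "\<not> 0 < f g"
  moreover have "connected (f ` H)" by (intro connected_continuous_image f conn)
  ultimately have "0 \<in> f ` H"
    using connectedD_interval[of "f ` H" "f g" "f (mat 1)" 0] g one one_mem by (simp add: imageI)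
  then show False using nz by auto
qed

lemma det_pos: "g \<in> H \<Longrightarrow> 0 < det g"
  by (rule sign_constant) (use invertible in \<open>auto simp: invertible_det_nz intro!: continuous_intros\<close>)

lemma conjugate:
  assumes P: "invertible P"
  shows "connected_matrix_group ((\<lambda>g. P ** g ** matrix_inv P) ` H)"
proof
  show "connected ((\<lambda>g. P ** g ** matrix_inv P) ` H)"
    by (intro connected_continuous_image conn continuous_intros)
  have "mat 1 = P ** mat 1 ** matrix_inv P" using P by (simp add: matrix_inv_cancel)
  then show "mat 1 \<in> (\<lambda>g. P ** g ** matrix_inv P) ` H" using one_mem by blast
  fix g assume "g \<in> (\<lambda>g. P ** g ** matrix_inv P) ` H"
  then obtain g0 where g: "g0 \<in> H" "g = P ** g0 ** matrix_inv P" by blast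
  show "invertible g" unfolding g by (intro invertible_mult invertible g P invertible_matrix_inv)
  have "matrix_inv g = P ** matrix_inv g0 ** matrix_inv P"
  proof (rule matrix_inv_unique)
    show "g ** (P ** matrix_inv g0 ** matrix_inv P) = mat 1"
      unfolding g matrix_mul_assoc[symmetric] using P invertible[OF g(1)] by (simp add: matrix_inv_cancel)
  qed
  then show "matrix_inv g \<in> (\<lambda>g. P ** g ** matrix_inv P) ` H" using inv_mem[OF g(1)] by blast
  fix h assume "h \<in> (\<lambda>g. P ** g ** matrix_inv P) ` H"
  then obtain h0 where h: "h0 \<in> H" "h = P ** h0 ** matrix_inv P" by blast
  have "g ** h = P ** (g0 ** h0) ** matrix_inv P"
    unfolding g h matrix_mul_assoc[symmetric] using P by (simp add: matrix_inv_cancel)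
  then show "g ** h \<in> (\<lambda>g. P ** g ** matrix_inv P) ` H" using mult_mem[OF g(1) h(1)] by blast
qed

lemma classified_conjugate:
  assumes "invertible P" "classified ((\<lambda>g. P ** g ** matrix_inv P) ` H)"
  shows "classified H"
proof -
  have "coarse_eq (cartan_mu ` H) (cartan_mu ` (\<lambda>g. P ** g ** matrix_inv P) ` H)"
    by (rule coarse_eq_sym[OF coarse_eq_conjugate[OF assms(1)]]) (auto simp: invertible)
  then show ?thesis using assms(2) unfolding classified_def by (blast intro: coarse_eq_trans)
qed

end

locale connected_triangular_group = connected_matrix_group +
  assumes triangular: "g \<in> H \<Longrightarrow> g$1$2 = 0"
begin

lemma diagonal_pos:
  assumes g: "g \<in> H" shows "0 < g$1$1" "0 < g$2$2"
proof -
  have nz: "g$1$1 \<noteq> 0 \<and> g$2$2 \<noteq> 0" if "g \<in> H" for g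
    using det_pos[OF that] triangular[OF that] by (auto simp: det_2)
  show "0 < g$1$1"
    by (rule sign_constant[OF _ _ _ g]) (use nz in \<open>auto intro!: continuous_intros simp: mat_def\<close>)
  show "0 < g$2$2"
    by (rule sign_constant[OF _ _ _ g]) (use nz in \<open>auto intro!: continuous_intros simp: mat_def\<close>)
qed

lemma mem_eq_mat2:
  assumes "g \<in> H"
  shows "g = mat2 (exp (ln (g$1$1))) 0 (g$2$1) (exp (ln (g$2$2)))"
  using diagonal_pos[OF assms] triangular[OF assms] by (simp add: vec_eq_iff forall_2)

definition log_diag :: "(real \<times> real) set" where
  "log_diag = (\<lambda>g. (ln (g$1$1), ln (g$2$2))) ` H"

lemma log_diag_iff: "(x, y) \<in> log_diag \<longleftrightarrow> (\<exists>s. mat2 (exp x) 0 s (exp y) \<in> H)"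
proof
  assume "(x, y) \<in> log_diag"
  then obtain g where "g \<in> H" "x = ln (g$1$1)" "y = ln (g$2$2)" by (auto simp: log_diag_def)
  then show "\<exists>s. mat2 (exp x) 0 s (exp y) \<in> H" using mem_eq_mat2 by metis
next
  assume "\<exists>s. mat2 (exp x) 0 s (exp y) \<in> H"
  then obtain s where s: "mat2 (exp x) 0 s (exp y) \<in> H" by blast
  show "(x, y) \<in> log_diag" unfolding log_diag_def by (rule image_eqI[OF _ s]) simp
qed

lemma additive_subgroup_log_diag: "additive_subgroup log_diag"
proof
  show "0 \<in> log_diag"
    using one_mem by (auto simp: zero_prod_def log_diag_iff mat_1_eq_mat2)
  show "u + v \<in> log_diag" if mem: "u \<in> log_diag" "v \<in> log_diag" for u v
  proof -
    obtain x y x' y' where uv: "u = (x, y)" "v = (x', y')" by (metis surj_pair)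
    then obtain s s' where "mat2 (exp x) 0 s (exp y) \<in> H" "mat2 (exp x') 0 s' (exp y') \<in> H"
      using mem log_diag_iff by metis
    with uv show ?thesis using mult_mem[of "mat2 (exp x) 0 s (exp y)" "mat2 (exp x') 0 s' (exp y')"]
      by (auto simp: log_diag_iff simp flip: exp_add)
  qed
  show "- u \<in> log_diag" if mem: "u \<in> log_diag" for u
  proof -
    obtain x y s where "u = (x, y)" "mat2 (exp x) 0 s (exp y) \<in> H"
      using mem log_diag_iff by (metis surj_pair)
    moreover have "matrix_inv (mat2 (exp x) 0 s (exp y)) = mat2 (exp (- x)) 0 (- s / (exp x * exp y)) (exp (- y))"
      by (simp add: matrix_inv_mat2 mat2_eq_iff exp_minus field_simps)
    ultimately show ?thesis using inv_mem[of "mat2 (exp x) 0 s (exp y)"]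
      by (auto simp: log_diag_iff)
  qed
qed

lemma connected_log_diag: "connected log_diag"
  unfolding log_diag_def
  by (intro connected_continuous_image conn continuous_intros) (use diagonal_pos in force)+

definition unipotents :: "real set" where
  "unipotents = {s. mat2 1 0 s 1 \<in> H}"

lemma additive_subgroup_unipotents: "additive_subgroup unipotents"
proof
  show "0 \<in> unipotents" using one_mem by (simp add: unipotents_def mat_1_eq_mat2)
  show "s + t \<in> unipotents" if "s \<in> unipotents" "t \<in> unipotents" for s t
    using mult_mem[of "mat2 1 0 s 1" "mat2 1 0 t 1"] that by (simp add: unipotents_def)
  show "- s \<in> unipotents" if "s \<in> unipotents" for s
    using inv_mem[of "mat2 1 0 s 1"] that by (simp add: unipotents_def matrix_inv_mat2)
qed

lemma commutator_eq_unipotent: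
  assumes "g \<in> H" "h \<in> H"
  shows "g ** h ** matrix_inv g ** matrix_inv h = mat2 1 0 ((g ** h ** matrix_inv g ** matrix_inv h)$2$1) 1"
proof -
  obtain x y s x' y' s' where e: "g = mat2 (exp x) 0 s (exp y)" "h = mat2 (exp x') 0 s' (exp y')"
    using mem_eq_mat2 assms by metis
  show ?thesis unfolding e by (simp add: matrix_inv_mat2)
qed

text \<open>
  The lower left entry of a commutator is a continuous function on the connected set \<open>H \<times> H\<close>. It takes the
  value 0, and a non-zero value if \<open>H\<close> is not abelian; so the unipotents in \<open>H\<close> contain an interval.
\<close>

lemma nonabelian_imp_all_unipotents:
  assumes "g \<in> H" "h \<in> H" "g ** h \<noteq> h ** g"
  shows "unipotents = UNIV"
proof (rule additive_subgroup_real_UNIV[OF additive_subgroup_unipotents])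
  define c :: "(real^2^2) \<times> (real^2^2) \<Rightarrow> real" where "c = (\<lambda>(g, h). (g ** h ** matrix_inv g ** matrix_inv h)$2$1)"
  show "connected (c ` (H \<times> H))"
    unfolding c_def case_prod_unfold
    by (intro connected_continuous_image connected_Times conn continuous_intros) (auto intro: invertible)
  show "c ` (H \<times> H) \<subseteq> unipotents"
  proof safe
    fix g h assume "g \<in> H" "h \<in> H"
    then show "c (g, h) \<in> unipotents"
      using commutator_eq_unipotent[of g h] mult_mem inv_mem by (auto simp: unipotents_def c_def)
  qed
  have "c (mat 1, mat 1) = 0" by (simp add: c_def mat_1_eq_mat2 matrix_inv_mat2)
  then show "0 \<in> c ` (H \<times> H)" using one_mem by force
  show "c (g, h) \<in> c ` (H \<times> H)" using assms by blast
  show "c (g, h) \<noteq> 0"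
  proof
    assume "c (g, h) = 0"
    then have "g ** h ** matrix_inv g ** matrix_inv h = mat 1"
      using commutator_eq_unipotent[OF assms(1,2)] by (simp add: c_def mat_1_eq_mat2)
    then have "g ** h ** matrix_inv g ** matrix_inv h ** h ** g = h ** g" by simp
    then show False
      using assms invertible by (simp add: matrix_inv_cancel)
  qed
qed

text \<open>
  The diagonal entries of \<open>H\<close> are arbitrary in \<open>log_diag\<close> and the lower left entry is then free, so the width
  takes all values above \<open>\<bar>x - y\<bar>\<close> up to a bounded error.
\<close>

lemma classified_nonabelian:
  assumes "unipotents = UNIV"
  shows "classified H"
proof -
  have all: "mat2 (exp x) 0 s (exp y) \<in> H" if mem: "(x, y) \<in> log_diag" for x y s
  proof -
    obtain s0 where "mat2 (exp x) 0 s0 (exp y) \<in> H" using mem log_diag_iff by blast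
    moreover have "mat2 1 0 ((s - s0) / exp x) 1 \<in> H" using assms unfolding unipotents_def by blast
    ultimately have "mat2 1 0 ((s - s0) / exp x) 1 ** mat2 (exp x) 0 s0 (exp y) \<in> H" by (intro mult_mem)
    then show ?thesis by simp
  qed
  have "cartan_mu ` H \<subseteq> cone_over log_diag"
  proof
    fix a assume "a \<in> cartan_mu ` H"
    then obtain g where g: "g \<in> H" "a = cartan_mu g" by blast
    then obtain x y s where e: "g = mat2 (exp x) 0 s (exp y)" using mem_eq_mat2 by metis
    then have "(x, y) \<in> log_diag" using g log_diag_iff by blast
    moreover have "\<bar>x - y\<bar> \<le> snd a" unfolding g e by (rule snd_cartan_mu_lower_triangular_ge)
    ultimately have "(x + y, snd a) \<in> cone_over log_diag" unfolding cone_over_def by blast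
    moreover have "fst a = x + y" unfolding g e by (rule fst_cartan_mu_lower_triangular)
    ultimately show "a \<in> cone_over log_diag" by (metis prod.collapse)
  qed
  moreover have "near (cone_over log_diag) (cartan_mu ` H)"
  proof (rule nearI[of _ _ "ln 3"])
    fix a assume "a \<in> cone_over log_diag"
    then obtain x y q where a: "a = (x + y, q)" "(x, y) \<in> log_diag" "\<bar>x - y\<bar> \<le> q"
      unfolding cone_over_def by blast
    obtain s where s: "\<bar>snd (cartan_mu (mat2 (exp x) 0 s (exp y))) - q\<bar> \<le> ln 3"
      using cartan_mu_unipotent_shift[OF a(3)] by blast
    have "dist a (cartan_mu (mat2 (exp x) 0 s (exp y))) \<le> ln 3"
      using dist_prod_le[of a "cartan_mu (mat2 (exp x) 0 s (exp y))"] s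
      by (simp add: a(1) fst_cartan_mu_lower_triangular abs_minus_commute)
    then show "\<exists>b\<in>cartan_mu ` H. dist a b \<le> ln 3" using all[OF a(2)] by blast
  qed
  ultimately have "coarse_eq (cartan_mu ` H) (cone_over log_diag)"
    by (simp add: coarse_eq_def near_subset)
  then show ?thesis
    using coarse_cone_over[OF additive_subgroup_log_diag connected_log_diag] by (rule classified_coarse_eq)
qed

text \<open>
  Commuting with an element \<open>h\<close> with distinct diagonal entries forces the lower left entry of \<open>g\<close> to be a
  fixed multiple \<open>\<kappa>\<close> of the difference of its diagonal entries. So the width differs from that of the diagonal
  part by an amount bounded in terms of \<open>\<kappa>\<close>.
\<close>

lemma classified_diagonalizable:
  assumes abelian: "\<And>g h. g \<in> H \<Longrightarrow> h \<in> H \<Longrightarrow> g ** h = h ** g"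
    and h: "h \<in> H" "h$1$1 \<noteq> h$2$2"
  shows "classified H"
proof -
  define \<kappa> where "\<kappa> = h$2$1 / (h$1$1 - h$2$2)"
  have off: "g$2$1 = \<kappa> * (g$1$1 - g$2$2)" if "g \<in> H" for g
  proof -
    have "(g ** h)$2$1 = (h ** g)$2$1" using abelian[OF that h(1)] by simp
    then have "g$2$1 * (h$1$1 - h$2$2) = h$2$1 * (g$1$1 - g$2$2)"
      by (simp add: matrix_matrix_mult_def sum_2 algebra_simps)
    then show ?thesis using h(2) by (simp add: \<kappa>_def field_simps)
  qed
  define R where "R = ln (2 * (1 + \<kappa>\<^sup>2))"
  have mu: "dist (cartan_mu g) (x + y, \<bar>x - y\<bar>) \<le> R"
    if g: "g \<in> H" and e: "g = mat2 (exp x) 0 s (exp y)" for g x y s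
  proof -
    have s: "s = \<kappa> * (exp x - exp y)" using off[OF g] by (simp add: e)
    define E where "E = exp (x - y) + exp (y - x)"
    have "(exp x - exp y)\<^sup>2 * exp (- x - y) = E - 2"
      by (simp add: E_def exp_diff exp_minus power2_eq_square field_simps)
    then have "s\<^sup>2 * exp (- x - y) = \<kappa>\<^sup>2 * (E - 2)" by (simp add: s power_mult_distrib)
    then have m: "cartan_mu g = (x + y, ln (E + \<kappa>\<^sup>2 * (E - 2)))"
      by (simp add: e cartan_mu_lower_triangular E_def)
    have E: "exp \<bar>x - y\<bar> \<le> E" "E \<le> 2 * exp \<bar>x - y\<bar>"
    proof -
      show "exp \<bar>x - y\<bar> \<le> E" unfolding E_def by (cases "x \<ge> y") simp_all
      have "exp (x - y) \<le> exp \<bar>x - y\<bar>" "exp (y - x) \<le> exp \<bar>x - y\<bar>" by simp_all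
      then show "E \<le> 2 * exp \<bar>x - y\<bar>" unfolding E_def by linarith
    qed
    have "2 \<le> E"
      using \<open>(exp x - exp y)\<^sup>2 * exp (- x - y) = E - 2\<close> zero_le_power2[of "exp x - exp y"]
      by (metis diff_ge_0_iff_ge exp_ge_zero mult_nonneg_nonneg)
    then have lo: "E \<le> E + \<kappa>\<^sup>2 * (E - 2)" by simp
    have "E + \<kappa>\<^sup>2 * (E - 2) \<le> (1 + \<kappa>\<^sup>2) * E" by (simp add: algebra_simps)
    also have "\<dots> \<le> (1 + \<kappa>\<^sup>2) * (2 * exp \<bar>x - y\<bar>)" using E by (intro mult_left_mono) auto
    also have "\<dots> = 2 * (1 + \<kappa>\<^sup>2) * exp \<bar>x - y\<bar>" by (simp only: mult.assoc mult.left_commute)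
    finally have hi: "E + \<kappa>\<^sup>2 * (E - 2) \<le> 2 * (1 + \<kappa>\<^sup>2) * exp \<bar>x - y\<bar>" .
    have "\<bar>ln (E + \<kappa>\<^sup>2 * (E - 2)) - \<bar>x - y\<bar>\<bar> \<le> R"
      unfolding R_def
    proof (rule ln_between[OF _ hi])
      show "exp \<bar>x - y\<bar> \<le> E + \<kappa>\<^sup>2 * (E - 2)" using E lo by linarith
      show "1 \<le> 2 * (1 + \<kappa>\<^sup>2)" using zero_le_power2[of \<kappa>] unfolding distrib_left by linarith
    qed
    then show ?thesis unfolding m dist_same_fst .
  qed
  have "near (cartan_mu ` H) (graph_over log_diag)"
  proof (rule nearI[of _ _ R])
    fix a assume "a \<in> cartan_mu ` H"
    then obtain g where g: "g \<in> H" "a = cartan_mu g" by blast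
    then obtain x y s where e: "g = mat2 (exp x) 0 s (exp y)" using mem_eq_mat2 by metis
    then have "(x, y) \<in> log_diag" using g log_diag_iff by blast
    then have "(x + y, \<bar>x - y\<bar>) \<in> graph_over log_diag" unfolding graph_over_def by blast
    then show "\<exists>b\<in>graph_over log_diag. dist a b \<le> R" using mu[OF g(1) e] unfolding g(2) by blast
  qed
  moreover have "near (graph_over log_diag) (cartan_mu ` H)"
  proof (rule nearI[of _ _ R])
    fix a assume "a \<in> graph_over log_diag"
    then obtain x y where a: "a = (x + y, \<bar>x - y\<bar>)" "(x, y) \<in> log_diag" unfolding graph_over_def by blast
    then obtain s where s: "mat2 (exp x) 0 s (exp y) \<in> H" using log_diag_iff by blast
    then have "dist a (cartan_mu (mat2 (exp x) 0 s (exp y))) \<le> R"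
      unfolding a using mu[OF s refl] by (simp add: dist_commute)
    then show "\<exists>b\<in>cartan_mu ` H. dist a b \<le> R" using s by blast
  qed
  ultimately have "coarse_eq (cartan_mu ` H) (graph_over log_diag)"
    by (simp add: coarse_eq_def)
  then show ?thesis
    using coarse_graph_over[OF additive_subgroup_log_diag connected_log_diag] by (rule classified_coarse_eq)
qed

text \<open>
  On these groups, \<open>g \<mapsto> (ln (g$1$1), g$2$1 / g$1$1)\<close> is an injective homomorphism to \<open>\<real>\<^sup>2\<close>.
\<close>

lemma classified_scalar_diagonal:
  assumes scalar: "\<And>g. g \<in> H \<Longrightarrow> g$1$1 = g$2$2"
  shows "classified H"
proof -
  define L where "L = (\<lambda>g. (ln (g$1$1), g$2$1 / g$1$1)) ` H"
  have iff: "(x, \<tau>) \<in> L \<longleftrightarrow> mat2 (exp x) 0 (\<tau> * exp x) (exp x) \<in> H" for x \<tau>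
  proof
    assume "(x, \<tau>) \<in> L"
    then obtain g where g: "g \<in> H" "x = ln (g$1$1)" "\<tau> = g$2$1 / g$1$1" by (auto simp: L_def)
    then have "exp x = g$1$1" "\<tau> * exp x = g$2$1" "0 < g$1$1" using diagonal_pos(1)[OF g(1)] by auto
    then have "mat2 (exp x) 0 (\<tau> * exp x) (exp x) = g"
      using scalar[OF g(1)] triangular[OF g(1)] by (simp add: vec_eq_iff forall_2)
    then show "mat2 (exp x) 0 (\<tau> * exp x) (exp x) \<in> H" using g(1) by simp
  next
    assume *: "mat2 (exp x) 0 (\<tau> * exp x) (exp x) \<in> H"
    show "(x, \<tau>) \<in> L" unfolding L_def by (rule image_eqI[OF _ *]) simp
  qed
  have add: "additive_subgroup L"
  proof
    show "0 \<in> L" using one_mem by (auto simp: zero_prod_def iff mat_1_eq_mat2)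
    show "u + v \<in> L" if "u \<in> L" "v \<in> L" for u v
    proof -
      obtain x \<tau> x' \<tau>' where uv: "u = (x, \<tau>)" "v = (x', \<tau>')" by (metis surj_pair)
      have "mat2 (exp x) 0 (\<tau> * exp x) (exp x) ** mat2 (exp x') 0 (\<tau>' * exp x') (exp x') \<in> H"
        using that by (intro mult_mem) (auto simp: uv iff)
      moreover have "mat2 (exp x) 0 (\<tau> * exp x) (exp x) ** mat2 (exp x') 0 (\<tau>' * exp x') (exp x') =
          mat2 (exp (x + x')) 0 ((\<tau> + \<tau>') * exp (x + x')) (exp (x + x'))"
        by (simp add: exp_add algebra_simps)
      ultimately show ?thesis by (simp add: uv iff)
    qed
    show "- u \<in> L" if "u \<in> L" for u
    proof -
      obtain x \<tau> where u: "u = (x, \<tau>)" by (metis surj_pair)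
      have "matrix_inv (mat2 (exp x) 0 (\<tau> * exp x) (exp x)) = mat2 (exp (- x)) 0 (- \<tau> * exp (- x)) (exp (- x))"
        by (rule matrix_inv_unique) (simp add: mat_1_eq_mat2 algebra_simps flip: exp_add)
      then show ?thesis using inv_mem[of "mat2 (exp x) 0 (\<tau> * exp x) (exp x)"] that by (simp add: u iff)
    qed
  qed
  have con: "connected L"
    unfolding L_def
    by (intro connected_continuous_image conn continuous_intros) (use diagonal_pos in force)+
  have mu: "dist (cartan_mu (mat2 (exp x) 0 (\<tau> * exp x) (exp x))) (2 * x, ln (1 + \<tau>\<^sup>2)) \<le> ln 2" for x \<tau>
  proof -
    have "(\<tau> * exp x)\<^sup>2 * exp (- x - x) = \<tau>\<^sup>2 * exp (x + x + (- x - x))"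
      unfolding exp_add by (simp add: power2_eq_square)
    then have m: "cartan_mu (mat2 (exp x) 0 (\<tau> * exp x) (exp x)) = (2 * x, ln (2 + \<tau>\<^sup>2))"
      by (simp add: cartan_mu_lower_triangular)
    have p: "0 < 1 + \<tau>\<^sup>2" by (auto intro: add_pos_nonneg)
    have "\<bar>ln (2 + \<tau>\<^sup>2) - ln (1 + \<tau>\<^sup>2)\<bar> \<le> ln 2"
      by (rule ln_between) (use p in simp_all)
    then show ?thesis unfolding m dist_same_fst .
  qed
  have "near (cartan_mu ` H) (parabolic_over L)"
  proof (rule nearI[of _ _ "ln 2"])
    fix a assume "a \<in> cartan_mu ` H"
    then obtain g where g: "g \<in> H" "a = cartan_mu g" by blast
    define x where "x = ln (g$1$1)"
    define \<tau> where "\<tau> = g$2$1 / g$1$1"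
    have "exp x = g$1$1" "\<tau> * exp x = g$2$1" using diagonal_pos(1)[OF g(1)] by (auto simp: x_def \<tau>_def)
    then have e: "g = mat2 (exp x) 0 (\<tau> * exp x) (exp x)"
      using scalar[OF g(1)] triangular[OF g(1)] by (simp add: vec_eq_iff forall_2)
    then have "(x, \<tau>) \<in> L" using g(1) iff by metis
    then have "(2 * x, ln (1 + \<tau>\<^sup>2)) \<in> parabolic_over L" unfolding parabolic_over_def by blast
    then show "\<exists>b\<in>parabolic_over L. dist a b \<le> ln 2" using mu[of x \<tau>] unfolding g(2) e[symmetric] by blast
  qed
  moreover have "near (parabolic_over L) (cartan_mu ` H)"
  proof (rule nearI[of _ _ "ln 2"])
    fix a assume "a \<in> parabolic_over L"
    then obtain x \<tau> where a: "a = (2 * x, ln (1 + \<tau>\<^sup>2))" "(x, \<tau>) \<in> L" unfolding parabolic_over_def by blast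
    then show "\<exists>b\<in>cartan_mu ` H. dist a b \<le> ln 2" using mu[of x \<tau>] iff by (metis dist_commute imageI)
  qed
  ultimately have "coarse_eq (cartan_mu ` H) (parabolic_over L)"
    by (simp add: coarse_eq_def)
  then show ?thesis
    using coarse_parabolic_over[OF add con] by (rule classified_coarse_eq)
qed

theorem classified_triangular: "classified H"
proof (cases "\<exists>g\<in>H. \<exists>h\<in>H. g ** h \<noteq> h ** g")
  case True
  then show ?thesis using nonabelian_imp_all_unipotents classified_nonabelian by blast
next
  case False
  then show ?thesis using classified_diagonalizable classified_scalar_diagonal by blast
qed

end

lemma ex_matrix_second_column:
  fixes v :: "real^2"
  assumes v: "v \<noteq> 0"
  shows "\<exists>Q :: real^2^2. invertible Q \<and> Q *v axis 2 1 = v"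
proof -
  have "v$1 \<noteq> 0 \<or> v$2 \<noteq> 0" using v by (auto simp: vec_eq_iff forall_2)
  then have "0 < v$2 * v$2 + v$1 * v$1" unfolding sum_squares_gt_zero_iff by blast
  then have "v$2 * v$2 - v$1 * (- v$1) \<noteq> 0" by (metis less_irrefl mult_minus_right diff_minus_eq_add)
  then have "invertible (mat2 (v$2) (v$1) (- v$1) (v$2))" unfolding invertible_mat2 .
  moreover have "mat2 (v$2) (v$1) (- v$1) (v$2) *v axis 2 1 = v"
    by (simp add: vec_eq_iff forall_2 axis_def matrix_vector_mult_def sum_2)
  ultimately show ?thesis by blast
qed

text \<open>
  A matrix \<open>Q\<close> whose second column spans the invariant line conjugates the group into lower triangular
  matrices, and conjugation moves \<open>\<mu>\<close> by a bounded amount.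
\<close>

theorem (in connected_matrix_group) classified_reducible:
  assumes v: "v \<noteq> 0" and eigen: "\<And>g. g \<in> H \<Longrightarrow> \<exists>c. g *v v = c *\<^sub>R v"
  shows "classified H"
proof -
  obtain Q :: "real^2^2" where Q: "invertible Q" "Q *v axis 2 1 = v"
    using ex_matrix_second_column[OF v] by blast
  define P where "P = matrix_inv Q"
  have P: "invertible P" "matrix_inv P = Q" unfolding P_def using Q(1) by (simp_all add: invertible_matrix_inv matrix_inv_inv)
  define e :: "real^2" where "e = axis 2 1"
  have Qe: "Q *v e = v" using Q(2) by (simp add: e_def)
  interpret C: connected_matrix_group "(\<lambda>g. P ** g ** matrix_inv P) ` H" by (rule conjugate[OF P(1)])
  interpret C: connected_triangular_group "(\<lambda>g. P ** g ** matrix_inv P) ` H"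
  proof
    fix h assume "h \<in> (\<lambda>g. P ** g ** matrix_inv P) ` H"
    then obtain g where g: "g \<in> H" "h = P ** g ** Q" using P by auto
    obtain c where c: "g *v v = c *\<^sub>R v" using eigen[OF g(1)] by blast
    have "h *v e = P *v (g *v (Q *v e))" by (simp add: g matrix_vector_mul_assoc matrix_mul_assoc)
    also have "\<dots> = c *\<^sub>R (P *v (Q *v e))" by (simp add: Qe c matrix_vector_mult_scaleR)
    also have "P *v (Q *v e) = e" using Q(1) by (simp add: matrix_vector_mul_assoc P_def matrix_inv_cancel)
    finally have "(h *v e)$1 = 0" by (simp add: e_def axis_def)
    then show "h$1$2 = 0" by (simp add: e_def matrix_vector_mult_def sum_2 axis_def)
  qed
  show ?thesis by (rule classified_conjugate[OF P(1) C.classified_triangular])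
qed

section \<open>Irreducible abelian groups\<close>

definition cross2 :: "real^2 \<Rightarrow> real^2 \<Rightarrow> real" where
  "cross2 v w = v$1 * w$2 - v$2 * w$1"

lemma cross2_zero_imp_parallel:
  assumes "v \<noteq> 0" "cross2 v w = 0"
  shows "\<exists>c. w = c *\<^sub>R v"
proof (cases "v$1 = 0")
  case True
  then have "v$2 \<noteq> 0" using assms(1) by (auto simp: vec_eq_iff forall_2)
  then have "w = (w$2 / v$2) *\<^sub>R v"
    using True assms(2) by (simp add: cross2_def vec_eq_iff forall_2)
  then show ?thesis by blast
next
  case False
  then have "w = (w$1 / v$1) *\<^sub>R v"
    using assms(2) by (simp add: cross2_def vec_eq_iff forall_2 field_simps)
  then show ?thesis by blast
qed

lemma mat2_mult_vec: "mat2 a b c d *v v = (\<chi> i. if i = 1 then a * v$1 + b * v$2 else c * v$1 + d * v$2)"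
  by (simp add: vec_eq_iff forall_2 matrix_vector_mult_def sum_2)

lemma mat2_mult_vec_nth [simp]:
  "(mat2 a b c d *v v)$1 = a * v$1 + b * v$2" "(mat2 a b c d *v v)$2 = c * v$1 + d * v$2"
  by (simp_all add: mat2_mult_vec)

lemma norm_vec2: "(norm v)\<^sup>2 = (v$1)\<^sup>2 + (v$2)\<^sup>2" for v :: "real^2"
  unfolding power2_norm_eq_inner by (simp add: inner_vec_def sum_2 power2_eq_square)

definition scalar_matrix :: "real^2^2 \<Rightarrow> bool" where
  "scalar_matrix X \<longleftrightarrow> X$1$2 = 0 \<and> X$2$1 = 0 \<and> X$1$1 = X$2$2"

lemma scalar_matrix_mat2: "scalar_matrix (mat2 a b c d) \<longleftrightarrow> b = 0 \<and> c = 0 \<and> a = d"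
  by (simp add: scalar_matrix_def)

lemma scalar_matrix_commutes: "scalar_matrix X \<Longrightarrow> X ** Y = Y ** X"
  by (cases X rule: mat2_cases; cases Y rule: mat2_cases) (auto simp: scalar_matrix_mat2 mat2_eq_iff)

text \<open>
  If two independent vectors were eigenvectors for \<open>l\<close>, the matrix would be \<open>l\<close> times the identity.
\<close>

lemma eigenspace_line:
  assumes X: "\<not> scalar_matrix X" and v: "v \<noteq> 0" "X *v v = l *\<^sub>R v" and w: "X *v w = l *\<^sub>R w"
  shows "\<exists>c. w = c *\<^sub>R v"
proof (rule cross2_zero_imp_parallel[OF v(1)], rule ccontr)
  assume ne: "cross2 v w \<noteq> 0"
  obtain a b c d where Xe: "X = mat2 a b c d" by (rule mat2_cases)
  have e: "a * v$1 + b * v$2 = l * v$1" "c * v$1 + d * v$2 = l * v$2"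
    "a * w$1 + b * w$2 = l * w$1" "c * w$1 + d * w$2 = l * w$2"
    using v(2) w by (simp_all add: Xe vec_eq_iff forall_2)
  have "(a - l) * cross2 v w = (a * v$1 + b * v$2 - l * v$1) * w$2 - (a * w$1 + b * w$2 - l * w$1) * v$2"
    "b * cross2 v w = (a * w$1 + b * w$2 - l * w$1) * v$1 - (a * v$1 + b * v$2 - l * v$1) * w$1"
    "c * cross2 v w = (c * v$1 + d * v$2 - l * v$2) * w$2 - (c * w$1 + d * w$2 - l * w$2) * v$2"
    "(d - l) * cross2 v w = (c * w$1 + d * w$2 - l * w$2) * v$1 - (c * v$1 + d * v$2 - l * v$2) * w$1"
    by (simp_all add: cross2_def algebra_simps)
  then have "(a - l) * cross2 v w = 0" "b * cross2 v w = 0" "c * cross2 v w = 0" "(d - l) * cross2 v w = 0"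
    unfolding e by simp_all
  then have "a = l" "b = 0" "c = 0" "d = l" using ne by simp_all
  then show False using X by (simp add: Xe scalar_matrix_mat2)
qed

lemma real_eigenvector:
  assumes "(p + s)\<^sup>2 - 4 * (p * s - q * r) = e\<^sup>2"
  shows "\<exists>v. v \<noteq> 0 \<and> mat2 p q r s *v v = ((p + s + e) / 2) *\<^sub>R v"
proof -
  define l where "l = (p + s + e) / 2"
  have ch: "(p - l) * (s - l) = q * r"
    using assms by (simp add: l_def power2_eq_square field_simps)
  show ?thesis
  proof (cases "q = 0 \<and> p = l")
    case False
    define v :: "real^2" where "v = (\<chi> i. if i = 1 then q else l - p)"
    have "v \<noteq> 0" using False by (auto simp: v_def vec_eq_iff forall_2)
    moreover have "mat2 p q r s *v v = l *\<^sub>R v"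
      using ch by (simp add: v_def vec_eq_iff forall_2 algebra_simps)
    ultimately show ?thesis unfolding l_def by blast
  next
    case q: True
    show ?thesis
    proof (cases "r = 0 \<and> s = l")
      case False
      define v :: "real^2" where "v = (\<chi> i. if i = 1 then l - s else r)"
      have "v \<noteq> 0" using False by (auto simp: v_def vec_eq_iff forall_2)
      moreover have "mat2 p q r s *v v = l *\<^sub>R v"
        using ch by (simp add: v_def vec_eq_iff forall_2 algebra_simps)
      ultimately show ?thesis unfolding l_def by blast
    next
      case True
      define v :: "real^2" where "v = (\<chi> i. 1)"
      have "v \<noteq> 0" by (auto simp: v_def vec_eq_iff)
      moreover have "mat2 p q r s *v v = l *\<^sub>R v"
        using q True by (simp add: v_def vec_eq_iff forall_2)
      ultimately show ?thesis unfolding l_def by blast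
    qed
  qed
qed

lemma centralizer_mat2:
  assumes q: "q \<noteq> 0" and comm: "g ** mat2 p q r s = mat2 p q r s ** g"
  obtains m k where "g = mat2 (m + k * p) (k * q) (k * r) (m + k * s)"
proof -
  obtain a b c d where g: "g = mat2 a b c d" by (rule mat2_cases)
  have e: "a * p + b * r = p * a + q * c" "a * q + b * s = p * b + q * d"
    using comm by (simp_all add: g mat2_eq_iff)
  define k where "k = b / q"
  have b: "b = k * q" using q by (simp add: k_def)
  have "q * c = q * (k * r)" using e(1) by (auto simp: b algebra_simps)
  then have c: "c = k * r" unfolding mult_cancel_left using q by blast
  have "q * d = q * (a - k * p + k * s)" using e(2) by (simp add: b algebra_simps)
  then have "d = a - k * p + k * s" using q by simp
  then have "g = mat2 ((a - k * p) + k * p) (k * q) (k * r) ((a - k * p) + k * s)"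
    by (simp add: g b c)
  then show thesis by (rule that)
qed

locale irreducible_matrix_group = connected_matrix_group +
  assumes irreducible: "v \<noteq> 0 \<Longrightarrow> \<exists>g\<in>H. \<forall>c. g *v v \<noteq> c *\<^sub>R v"
begin

text \<open>
  A real eigenspace of \<open>X\<close> is a line that is invariant under everything that commutes with \<open>X\<close>.
\<close>

lemma commuting_elliptic:
  assumes comm: "\<And>g. g \<in> H \<Longrightarrow> g ** X = X ** g" and X: "\<not> scalar_matrix X"
  shows "(X$1$1 + X$2$2)\<^sup>2 < 4 * det X"
proof (rule ccontr)
  assume real: "\<not> (X$1$1 + X$2$2)\<^sup>2 < 4 * det X"
  obtain p q r s where Xe: "X = mat2 p q r s" by (rule mat2_cases)
  have "0 \<le> (p + s)\<^sup>2 - 4 * (p * s - q * r)" using real by (simp add: Xe)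
  then obtain e where "(p + s)\<^sup>2 - 4 * (p * s - q * r) = e\<^sup>2" by (metis real_sqrt_pow2)
  then obtain v l where v: "v \<noteq> 0" "X *v v = l *\<^sub>R v" using real_eigenvector Xe by blast
  obtain g where g: "g \<in> H" "\<And>c. g *v v \<noteq> c *\<^sub>R v" using irreducible[OF v(1)] by blast
  have "X *v (g *v v) = g *v (X *v v)" by (simp add: matrix_vector_mul_assoc comm[OF g(1)])
  also have "\<dots> = l *\<^sub>R (g *v v)" by (simp add: v(2) matrix_vector_mult_scaleR)
  finally show False using eigenspace_line[OF X v] g(2) by blast
qed

lemma ex_nonzero_off_diagonal: "\<exists>g\<in>H. g$1$2 \<noteq> 0" "\<exists>g\<in>H. g$2$1 \<noteq> 0"
proof -
  have e: "g *v axis 2 1 = g$2$2 *\<^sub>R axis 2 1" if "g$1$2 = 0" for g :: "real^2^2"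
    using that by (simp add: vec_eq_iff forall_2 axis_def matrix_vector_mult_def sum_2)
  then show "\<exists>g\<in>H. g$1$2 \<noteq> 0" using irreducible[of "axis 2 1"] by fastforce
  have "g *v axis 1 1 = g$1$1 *\<^sub>R axis 1 1" if "g$2$1 = 0" for g :: "real^2^2"
    using that by (simp add: vec_eq_iff forall_2 axis_def matrix_vector_mult_def sum_2)
  then show "\<exists>g\<in>H. g$2$1 \<noteq> 0" using irreducible[of "axis 1 1"] by fastforce
qed

lemma nonscalar_exists: "\<exists>X\<in>H. \<not> scalar_matrix X"
  using ex_nonzero_off_diagonal(1) unfolding scalar_matrix_def by blast

end

context connected_matrix_group
begin

lemma ln_det_image: "(\<lambda>g. ln (det g)) ` H = {0} \<or> (\<lambda>g. ln (det g)) ` H = UNIV"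
proof (rule connected_subgroup_real)
  show "connected ((\<lambda>g. ln (det g)) ` H)"
    by (intro connected_continuous_image conn continuous_intros) (use det_pos in force)
  show "additive_subgroup ((\<lambda>g. ln (det g)) ` H)"
  proof
    show "0 \<in> (\<lambda>g. ln (det g)) ` H" using one_mem by (intro image_eqI[of _ _ "mat 1"]) simp_all
    show "u + v \<in> (\<lambda>g. ln (det g)) ` H" if uv: "u \<in> (\<lambda>g. ln (det g)) ` H" "v \<in> (\<lambda>g. ln (det g)) ` H" for u v
    proof -
      obtain g h where "g \<in> H" "h \<in> H" "u = ln (det g)" "v = ln (det h)" using uv by blast
      then show ?thesis
        using det_pos mult_mem by (intro image_eqI[of _ _ "g ** h"]) (auto simp: det_mul ln_mult_pos)
    qed
    show "- u \<in> (\<lambda>g. ln (det g)) ` H" if u: "u \<in> (\<lambda>g. ln (det g)) ` H" for u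
    proof -
      obtain g where "g \<in> H" "u = ln (det g)" using u by blast
      then show ?thesis
        using det_pos inv_mem invertible
        by (intro image_eqI[of _ _ "matrix_inv g"]) (auto simp: det_matrix_inv ln_div)
    qed
  qed
qed

lemma fst_cartan_mu_mem: "g \<in> H \<Longrightarrow> fst (cartan_mu g) = ln (det g)"
  using det_pos[of g] by (simp add: fst_cartan_mu)

lemma snd_cartan_mu_nonneg: "g \<in> H \<Longrightarrow> 0 \<le> snd (cartan_mu g)"
proof -
  assume "g \<in> H"
  then have "0 < det g" by (rule det_pos)
  then have "1 \<le> (norm g)\<^sup>2 / \<bar>det g\<bar>" using norm_mat2_det[of g] by simp
  then show ?thesis by (simp add: cartan_mu_def)
qed

text \<open>
  The width is bounded, so \<open>\<mu>(H)\<close> is near the set of values of \<open>ln (det g)\<close> on the boundary line. By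
  connectedness this is a point or the whole line.
\<close>

lemma classified_bounded_width:
  assumes C: "\<And>g. g \<in> H \<Longrightarrow> (norm g)\<^sup>2 \<le> C * det g"
  shows "classified H"
proof -
  define P where "P = (\<lambda>x. (x, 0::real)) ` (\<lambda>g. ln (det g)) ` H"
  have d: "dist (cartan_mu g) (ln (det g), 0) \<le> ln C" if g: "g \<in> H" for g
  proof -
    have dp: "0 < det g" using g by (rule det_pos)
    have np: "0 < norm g" using g invertible invertible_norm_pos by blast
    have "(norm g)\<^sup>2 / \<bar>det g\<bar> \<le> C" using C[OF g] dp by (simp add: divide_le_eq)
    moreover have "0 < (norm g)\<^sup>2 / \<bar>det g\<bar>" using dp np by simp
    ultimately have "snd (cartan_mu g) \<le> ln C"
      unfolding cartan_mu_def snd_conv by (subst ln_le_cancel_iff) auto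
    then show ?thesis
      using dist_prod_le[of "cartan_mu g" "(ln (det g), 0)"] snd_cartan_mu_nonneg[OF g]
      by (simp add: fst_cartan_mu_mem[OF g])
  qed
  have "near (cartan_mu ` H) P" by (rule nearI[of _ _ "ln C"]) (use d in \<open>unfold P_def, blast\<close>)
  moreover have "near P (cartan_mu ` H)"
  proof (rule nearI[of _ _ "ln C"])
    fix a assume "a \<in> P"
    then obtain g where "g \<in> H" "a = (ln (det g), 0)" by (auto simp: P_def)
    then show "\<exists>b\<in>cartan_mu ` H. dist a b \<le> ln C" using d[of g] by (metis dist_commute imageI)
  qed
  ultimately have "coarse_eq (cartan_mu ` H) P" by (simp add: coarse_eq_def)
  moreover have "P = plane_1 \<or> P = plane_Z"
    using ln_det_image unfolding P_def plane_1_def plane_Z_def by auto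
  ultimately show ?thesis using plane_models_mem(3,5) classifiedI by metis
qed

end

context irreducible_matrix_group
begin

text \<open>
  Every element is a combination of the identity and one matrix \<open>X\<close> without real eigenvalues. On the plane of
  these combinations the determinant is a positive definite quadratic form, as is the squared norm, so their
  quotient is bounded.
\<close>

lemma classified_abelian:
  assumes abelian: "\<And>g h. g \<in> H \<Longrightarrow> h \<in> H \<Longrightarrow> g ** h = h ** g"
  shows "classified H"
proof -
  obtain X where X: "X \<in> H" "\<not> scalar_matrix X" using nonscalar_exists by blast
  obtain p q r s where Xe: "X = mat2 p q r s" by (rule mat2_cases)
  have "(p + s)\<^sup>2 < 4 * (p * s - q * r)"
    using commuting_elliptic[OF abelian[OF _ X(1)] X(2)] by (simp add: Xe)
  define \<Delta> where "\<Delta> = (p * s - q * r) - ((p + s) / 2)\<^sup>2"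
  have \<Delta>: "0 < \<Delta>"
    using \<open>(p + s)\<^sup>2 < 4 * (p * s - q * r)\<close> by (simp add: \<Delta>_def power_divide)
  have q: "q \<noteq> 0"
  proof
    assume "q = 0"
    then have "\<Delta> = - ((p - s) / 2)\<^sup>2" by (simp add: \<Delta>_def power2_eq_square field_simps)
    then show False using \<Delta> by simp
  qed
  define M where "M = (p - s)\<^sup>2 / 2 + q\<^sup>2 + r\<^sup>2"
  define C where "C = max 2 (M / \<Delta>)"
  have "(norm g)\<^sup>2 \<le> C * det g" if g: "g \<in> H" for g
  proof -
    have "g ** mat2 p q r s = mat2 p q r s ** g" using abelian[OF g X(1)] by (simp add: Xe)
    then obtain m k where e: "g = mat2 (m + k * p) (k * q) (k * r) (m + k * s)"
      using centralizer_mat2[OF q] by metis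
    \<comment> \<open>Half the trace; it diagonalizes both quadratic forms at once.\<close>
    define \<mu> where "\<mu> = m + k * (p + s) / 2"
    have n: "(norm g)\<^sup>2 = 2 * \<mu>\<^sup>2 + k\<^sup>2 * M"
      unfolding e norm_mat2 by (simp add: \<mu>_def M_def power2_eq_square field_simps)
    have d: "det g = \<mu>\<^sup>2 + k\<^sup>2 * \<Delta>"
      unfolding e det_mat2 by (simp add: \<mu>_def \<Delta>_def power2_eq_square field_simps)
    have "2 * \<mu>\<^sup>2 \<le> C * \<mu>\<^sup>2" by (intro mult_right_mono) (auto simp: C_def)
    moreover have "M / \<Delta> \<le> C" by (simp add: C_def)
    then have "M \<le> C * \<Delta>" using \<Delta> by (simp add: pos_divide_le_eq)
    then have "k\<^sup>2 * M \<le> k\<^sup>2 * (C * \<Delta>)" by (intro mult_left_mono) auto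
    ultimately show ?thesis unfolding n d by (simp add: distrib_left mult.left_commute)
  qed
  then show ?thesis by (rule classified_bounded_width)
qed

end

section \<open>The group generated by commutators\<close>

context connected_matrix_group
begin

text \<open>
  Products of exactly \<open>n\<close> commutators are continuous images of connected sets, hence connected, and they all
  contain the identity. So their union is connected.
\<close>

primrec commutator_products :: "nat \<Rightarrow> (real^2^2) set" where
  "commutator_products 0 = {mat 1}"
| "commutator_products (Suc n) =
    (\<lambda>(s, g, h). s ** (g ** h ** matrix_inv g ** matrix_inv h)) ` (commutator_products n \<times> H \<times> H)"

definition derived :: "(real^2^2) set" where
  "derived = (\<Union>n. commutator_products n)"

lemma commutator_products_sub: "commutator_products n \<subseteq> H"
  by (induction n) (use one_mem mult_mem inv_mem in auto)

lemma derived_sub: "derived \<subseteq> H"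
  using commutator_products_sub by (auto simp: derived_def)

lemma commutator_products_SucI:
  "s \<in> commutator_products n \<Longrightarrow> g \<in> H \<Longrightarrow> h \<in> H \<Longrightarrow>
     s ** (g ** h ** matrix_inv g ** matrix_inv h) \<in> commutator_products (Suc n)"
  by force

lemma one_mem_commutator_products: "mat 1 \<in> commutator_products n"
proof (induction n)
  case (Suc n)
  have "matrix_inv (mat 1 :: real^2^2) = mat 1" by (rule matrix_inv_unique) simp
  then show ?case using commutator_products_SucI[OF Suc one_mem one_mem] by simp
qed simp

lemma connected_commutator_products: "connected (commutator_products n)"
proof (induction n)
  case (Suc n)
  have "connected (commutator_products n \<times> H \<times> H)" by (intro connected_Times Suc conn)
  then show ?case
    unfolding commutator_products.simps case_prod_unfold
    by (rule connected_continuous_image[rotated]) (auto intro!: continuous_intros invertible)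
qed simp

lemma commutator_products_mult:
  "s \<in> commutator_products m \<Longrightarrow> t \<in> commutator_products n \<Longrightarrow> s ** t \<in> commutator_products (m + n)"
proof (induction n arbitrary: t)
  case (Suc n)
  then obtain u g h where t: "u \<in> commutator_products n" "g \<in> H" "h \<in> H"
    "t = u ** (g ** h ** matrix_inv g ** matrix_inv h)" by auto
  then have "s ** t = (s ** u) ** (g ** h ** matrix_inv g ** matrix_inv h)" by (simp add: matrix_mul_assoc)
  then show ?case using commutator_products_SucI[OF Suc.IH[OF Suc.prems(1) t(1)] t(2,3)] by simp
qed simp

lemma commutator_mem: "g \<in> H \<Longrightarrow> h \<in> H \<Longrightarrow> g ** h ** matrix_inv g ** matrix_inv h \<in> commutator_products 1"
  using commutator_products_SucI[of "mat 1" 0 g h] by simp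

text \<open>
  The inverse of the commutator of \<open>g\<close> and \<open>h\<close> is the commutator of \<open>h\<close> and \<open>g\<close>.
\<close>

lemma commutator_products_inv:
  "s \<in> commutator_products n \<Longrightarrow> matrix_inv s \<in> commutator_products n"
proof (induction n arbitrary: s)
  case 0
  then show ?case by (auto intro!: matrix_inv_unique)
next
  case (Suc n)
  then obtain u g h where t: "u \<in> commutator_products n" "g \<in> H" "h \<in> H"
    "s = u ** (g ** h ** matrix_inv g ** matrix_inv h)" by auto
  have inv: "invertible u" "invertible g" "invertible h"
    using t commutator_products_sub invertible by blast+
  have "matrix_inv s = (h ** g ** matrix_inv h ** matrix_inv g) ** matrix_inv u"
    unfolding t(4) using inv
    by (intro matrix_inv_unique) (simp add: matrix_inv_cancel matrix_mul_assoc)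
  then show ?case
    using commutator_products_mult[OF commutator_mem[OF t(3,2)] Suc.IH[OF t(1)]] by simp
qed

lemma commutator_products_conj:
  "s \<in> commutator_products n \<Longrightarrow> k \<in> H \<Longrightarrow> k ** s ** matrix_inv k \<in> commutator_products n"
proof (induction n arbitrary: s)
  case 0
  then show ?case using invertible by (auto simp: matrix_inv_cancel)
next
  case (Suc n)
  then obtain u g h where t: "u \<in> commutator_products n" "g \<in> H" "h \<in> H"
    "s = u ** (g ** h ** matrix_inv g ** matrix_inv h)" by auto
  have k: "invertible k" using Suc.prems invertible by blast
  have inv: "invertible g" "invertible h" using t invertible by blast+
  define c where "c x = k ** x ** matrix_inv k" for x
  have cm: "c x ** c y = c (x ** y)" for x y
    unfolding c_def using k by (simp add: matrix_inv_cancel matrix_mul_assoc)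
  have ci: "matrix_inv (c x) = c (matrix_inv x)" if "invertible x" for x
    using that k by (intro matrix_inv_unique) (simp add: cm matrix_inv_cancel, simp add: c_def matrix_inv_cancel)
  have "c s = c u ** (c g ** c h ** matrix_inv (c g) ** matrix_inv (c h))"
    unfolding t(4) ci[OF inv(1)] ci[OF inv(2)] cm ..
  moreover have "c g \<in> H" "c h \<in> H" unfolding c_def using t Suc.prems(2) by (auto intro!: mult_mem inv_mem)
  moreover have "c u \<in> commutator_products n" unfolding c_def by (rule Suc.IH[OF t(1) Suc.prems(2)])
  ultimately show ?case using commutator_products_SucI unfolding c_def by metis
qed

lemma connected_matrix_group_derived: "connected_matrix_group derived"
proof
  show "connected derived"
    unfolding derived_def
  proof (rule connected_Union)
    have "mat 1 \<in> \<Inter> (range commutator_products)" using one_mem_commutator_products by blast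
    then show "\<Inter> (range commutator_products) \<noteq> {}" by blast
  qed (use connected_commutator_products in blast)
  show "mat 1 \<in> derived" using one_mem_commutator_products by (auto simp: derived_def)
  show "invertible g" if "g \<in> derived" for g using that derived_sub invertible by blast
  show "g ** h \<in> derived" if "g \<in> derived" "h \<in> derived" for g h
    using that commutator_products_mult unfolding derived_def by blast
  show "matrix_inv g \<in> derived" if "g \<in> derived" for g
    using that commutator_products_inv unfolding derived_def by blast
qed

lemma derived_conj: "s \<in> derived \<Longrightarrow> k \<in> H \<Longrightarrow> k ** s ** matrix_inv k \<in> derived"
  using commutator_products_conj unfolding derived_def by blast

lemma commutator_mem_derived: "g \<in> H \<Longrightarrow> h \<in> H \<Longrightarrow> g ** h ** matrix_inv g ** matrix_inv h \<in> derived"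
  using commutator_mem unfolding derived_def by blast

lemma det_derived: "s \<in> derived \<Longrightarrow> det s = 1"
proof -
  have "det s = 1" if "s \<in> commutator_products n" for n s
    using that
  proof (induction n arbitrary: s)
    case (Suc n)
    then obtain u g h where t: "u \<in> commutator_products n" "g \<in> H" "h \<in> H"
      "s = u ** (g ** h ** matrix_inv g ** matrix_inv h)" by auto
    then show ?case
      using Suc.IH[OF t(1)] invertible det_pos[OF t(2)] det_pos[OF t(3)] by (simp add: det_mul det_matrix_inv)
  qed simp
  then show "s \<in> derived \<Longrightarrow> det s = 1" unfolding derived_def by blast
qed

end

section \<open>Hyperbolic elements and contraction\<close>

locale connected_SL2_group = connected_matrix_group +
  assumes det_1: "g \<in> H \<Longrightarrow> det g = 1"
begin

text \<open>
  Scalar matrices of determinant 1 are \<open>\<plusminus>1\<close>, and connectedness excludes the sign.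
\<close>

lemma scalar_mem_imp_one:
  assumes "\<And>g. g \<in> H \<Longrightarrow> scalar_matrix g" and g: "g \<in> H"
  shows "g = mat 1"
proof -
  have sq: "(h$1$1)\<^sup>2 = 1" if "h \<in> H" for h
    using assms(1)[OF that] det_1[OF that] by (simp add: scalar_matrix_def det_2 power2_eq_square)
  have "0 < g$1$1"
    by (rule sign_constant[OF _ _ _ g]) (use sq in \<open>force intro!: continuous_intros simp: mat_def\<close>)+
  then have "g$1$1 = 1" using sq[OF g] by (simp add: power2_eq_1_iff)
  then show ?thesis using assms(1)[OF g] by (simp add: scalar_matrix_def vec_eq_iff forall_2 mat_def)
qed

end

text \<open>
  Since \<open>g h g\<inverse> h\<inverse> - 1 = (g h - h g) (h g)\<inverse>\<close> and both matrices have determinant 1, the trace of the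
  commutator exceeds 2 by \<open>- det (g h - h g)\<close>. The matrix \<open>g h - h g\<close> has trace 0 and is orthogonal to \<open>g\<close>
  for the trace form. On matrices of trace 0 the form \<open>- det\<close> has signature \<open>(2, 1)\<close>, and the trace-free
  part of an elliptic \<open>g\<close> is a negative vector, so its orthogonal complement is positive definite. The proof
  carries this out in coordinates, by completing a square.
\<close>

lemma trace_commutator_elliptic:
  fixes g h :: "real^2^2"
  assumes g: "det g = 1" and h: "det h = 1" and ell: "(g$1$1 + g$2$2)\<^sup>2 < 4" and nc: "g ** h \<noteq> h ** g"
  defines "k \<equiv> g ** h ** matrix_inv g ** matrix_inv h"
  shows "2 < k$1$1 + k$2$2"
proof -
  obtain a b c d where ge: "g = mat2 a b c d" by (rule mat2_cases)
  obtain a' b' c' d' where he: "h = mat2 a' b' c' d'" by (rule mat2_cases)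
  have dg: "a * d - b * c = 1" and dh: "a' * d' - b' * c' = 1" using g h by (simp_all add: ge he)
  define x y z where "x = b * c' - b' * c" and "y = (a - d) * b' - b * (a' - d')" and "z = c * (a' - d') - c' * (a - d)"
  have comm: "g ** h - h ** g = mat2 x y z (- x)"
    by (simp add: ge he x_def y_def z_def vec_eq_iff forall_2 algebra_simps)
  have xyz: "x \<noteq> 0 \<or> y \<noteq> 0 \<or> z \<noteq> 0"
  proof (rule ccontr)
    assume "\<not> ?thesis"
    then have "g ** h - h ** g = 0" unfolding comm by (simp add: vec_eq_iff forall_2)
    then show False using nc by simp
  qed
  have inv: "matrix_inv g = mat2 d (- b) (- c) a" "matrix_inv h = mat2 d' (- b') (- c') a'"
    using matrix_inv_mat2[of a d b c] matrix_inv_mat2[of a' d' b' c'] dg dh by (simp_all add: ge he)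
  have "k$1$1 + k$2$2 - 2 * ((a * d - b * c) * (a' * d' - b' * c')) = x\<^sup>2 + y * z"
    unfolding k_def inv unfolding ge he by (simp add: x_def y_def z_def power2_eq_square algebra_simps)
  then have tr: "k$1$1 + k$2$2 = 2 + (x\<^sup>2 + y * z)" by (simp add: dg dh)
  have orth: "x * (a - d) + y * c + z * b = 0"
    by (simp add: x_def y_def z_def algebra_simps)
  have disc: "(a - d)\<^sup>2 + 4 * (b * c) < 0"
  proof -
    have "(a - d)\<^sup>2 + 4 * (b * c) = (a + d)\<^sup>2 - 4 * (a * d - b * c)"
      by (simp add: power2_eq_square algebra_simps)
    then show ?thesis using ell by (simp add: ge dg)
  qed
  then have b: "b \<noteq> 0" using zero_le_power2[of "a - d"] by auto
  have "b * z = - (x * (a - d) + y * c)" using orth by (simp add: algebra_simps)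
  moreover have "4 * b\<^sup>2 * (x\<^sup>2 + y * z) = 4 * b\<^sup>2 * x\<^sup>2 + 4 * b * y * (b * z)"
    by (simp add: power2_eq_square algebra_simps)
  ultimately have "4 * b\<^sup>2 * (x\<^sup>2 + y * z) = 4 * b\<^sup>2 * x\<^sup>2 - 4 * b * y * (x * (a - d) + y * c)"
    by (simp only: mult_minus_right add_uminus_conv_diff)
  also have "\<dots> = (2 * b * x - (a - d) * y)\<^sup>2 - ((a - d)\<^sup>2 + 4 * (b * c)) * y\<^sup>2"
    by (simp add: power2_eq_square algebra_simps)
  finally have form: "4 * b\<^sup>2 * (x\<^sup>2 + y * z) = (2 * b * x - (a - d) * y)\<^sup>2 - ((a - d)\<^sup>2 + 4 * (b * c)) * y\<^sup>2" .
  have "0 < (2 * b * x - (a - d) * y)\<^sup>2 - ((a - d)\<^sup>2 + 4 * (b * c)) * y\<^sup>2"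
  proof (cases "y = 0")
    case True
    then have "x \<noteq> 0" using xyz \<open>b * z = _\<close> b by auto
    then show ?thesis using True b by simp
  next
    case False
    then have "((a - d)\<^sup>2 + 4 * (b * c)) * y\<^sup>2 < 0" using disc by (simp add: mult_neg_pos)
    then show ?thesis using zero_le_power2[of "2 * b * x - (a - d) * y"] by linarith
  qed
  then have "0 < 4 * b\<^sup>2 * (x\<^sup>2 + y * z)" unfolding form .
  then have "0 < x\<^sup>2 + y * z" using b by (simp add: zero_less_mult_iff)
  then show ?thesis using tr by simp
qed

locale irreducible_SL2_group = connected_SL2_group + irreducible_matrix_group

context irreducible_SL2_group
begin

lemma conjugate_irreducible_SL2:
  assumes P: "invertible P"
  shows "irreducible_SL2_group ((\<lambda>g. P ** g ** matrix_inv P) ` H)"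
proof -
  interpret C: connected_matrix_group "(\<lambda>g. P ** g ** matrix_inv P) ` H" by (rule conjugate[OF P])
  show ?thesis
  proof
    show "det g = 1" if "g \<in> (\<lambda>g. P ** g ** matrix_inv P) ` H" for g
      using that P det_1 by (auto simp: det_mul det_matrix_inv invertible_det_nz)
    fix v :: "real^2" assume v: "v \<noteq> 0"
    define w where "w = matrix_inv P *v v"
    have Pw: "P *v w = v" using P by (simp add: w_def matrix_vector_mul_assoc matrix_inv_cancel)
    then have "w \<noteq> 0" using v by auto
    then obtain g where g: "g \<in> H" "\<And>c. g *v w \<noteq> c *\<^sub>R w" using irreducible by blast
    have "(P ** g ** matrix_inv P) *v v \<noteq> c *\<^sub>R v" for c
    proof
      assume "(P ** g ** matrix_inv P) *v v = c *\<^sub>R v"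
      then have "matrix_inv P *v ((P ** g ** matrix_inv P) *v v) = c *\<^sub>R w"
        by (simp add: w_def matrix_vector_mult_scaleR)
      moreover have "matrix_inv P *v ((P ** g ** matrix_inv P) *v v) = g *v w"
        using P by (simp add: w_def matrix_vector_mul_assoc matrix_inv_cancel matrix_mul_assoc)
      ultimately show False using g(2) by simp
    qed
    then show "\<exists>g\<in>(\<lambda>g. P ** g ** matrix_inv P) ` H. \<forall>c. g *v v \<noteq> c *\<^sub>R v" using g(1) by blast
  qed
qed

text \<open>
  The trace of \<open>u\<^sup>n h\<close>, for the unipotent square \<open>u\<close> of the given matrix, is an affine function of \<open>n\<close> whose
  slope is a multiple of the upper right entry of \<open>h\<close>. By irreducibility some \<open>h\<close> has a non-zero entry there.
\<close>

lemma unipotent_imp_hyperbolic: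
  assumes g: "mat2 e 0 c e \<in> H" and e: "e * e = 1" and c: "c \<noteq> 0"
  shows "\<exists>h\<in>H. 4 < (h$1$1 + h$2$2)\<^sup>2"
proof -
  define \<kappa> where "\<kappa> = 2 * e * c"
  have \<kappa>: "\<kappa> \<noteq> 0" using e c by (auto simp: \<kappa>_def)
  have "mat2 1 0 \<kappa> 1 \<in> H" using mult_mem[OF g g] by (simp add: e \<kappa>_def algebra_simps)
  then have pow: "mat2 1 0 (real n * \<kappa>) 1 \<in> H" for n
  proof (induction n)
    case 0
    then show ?case using one_mem by (simp add: mat_1_eq_mat2)
  next
    case (Suc n)
    then show ?case using mult_mem[OF Suc.IH[OF Suc.prems] Suc.prems] by (simp add: distrib_right add.commute)
  qed
  obtain h where h: "h \<in> H" and h12: "h$1$2 \<noteq> 0" using ex_nonzero_off_diagonal(1) by blast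
  define D where "D = \<bar>\<kappa> * h$1$2\<bar>"
  have D: "0 < D" using \<kappa> h12 by (simp add: D_def)
  obtain n :: nat where "(2 + \<bar>h$1$1 + h$2$2\<bar>) / D < real n" using reals_Archimedean2 by blast
  then have n: "2 + \<bar>h$1$1 + h$2$2\<bar> < real n * D" using D by (simp add: divide_less_eq)
  define k where "k = mat2 1 0 (real n * \<kappa>) 1 ** h"
  have "k \<in> H" unfolding k_def using pow h by (intro mult_mem)
  have "k$1$1 + k$2$2 = real n * (\<kappa> * h$1$2) + (h$1$1 + h$2$2)"
    by (simp add: k_def matrix_matrix_mult_def sum_2)
  moreover have "\<bar>real n * (\<kappa> * h$1$2)\<bar> = real n * D" by (simp add: D_def abs_mult)
  ultimately have "2 < \<bar>k$1$1 + k$2$2\<bar>" using n by linarith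
  then have "2\<^sup>2 < \<bar>k$1$1 + k$2$2\<bar>\<^sup>2" by (intro power_strict_mono) auto
  then show ?thesis using \<open>k \<in> H\<close> by auto
qed

lemma trace_conjugate:
  fixes P g :: "real^2^2"
  assumes "invertible P"
  shows "(P ** g ** matrix_inv P)$1$1 + (P ** g ** matrix_inv P)$2$2 = g$1$1 + g$2$2"
proof -
  have "trace (P ** (g ** matrix_inv P)) = trace (g ** matrix_inv P ** P)" by (rule trace_mul_sym)
  then show ?thesis using assms by (simp add: trace_def sum_2 matrix_mul_assoc matrix_inv_cancel)
qed

lemma parabolic_imp_hyperbolic:
  assumes g: "g \<in> H" and tr: "(g$1$1 + g$2$2)\<^sup>2 = 4" and ns: "\<not> scalar_matrix g"
  shows "\<exists>h\<in>H. 4 < (h$1$1 + h$2$2)\<^sup>2"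
proof -
  obtain a b c d where ge: "g = mat2 a b c d" by (rule mat2_cases)
  define e where "e = (a + d) / 2"
  have e2: "e * e = 1" using tr by (simp add: ge e_def power2_eq_square)
  have dg: "a * d - b * c = 1" using det_1[OF g] by (simp add: ge)
  have disc: "(a + d)\<^sup>2 - 4 * (a * d - b * c) = 0\<^sup>2" using tr by (simp add: dg ge)
  obtain v where v: "v \<noteq> 0" "g *v v = e *\<^sub>R v"
    using real_eigenvector[OF disc] unfolding ge e_def by auto
  obtain Q :: "real^2^2" where Q: "invertible Q" "Q *v axis 2 1 = v" using ex_matrix_second_column[OF v(1)] by blast
  define P where "P = matrix_inv Q"
  have P: "invertible P" "matrix_inv P = Q" unfolding P_def using Q by (simp_all add: invertible_matrix_inv matrix_inv_inv)
  interpret C: irreducible_SL2_group "(\<lambda>g. P ** g ** matrix_inv P) ` H" by (rule conjugate_irreducible_SL2[OF P(1)])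
  define k where "k = P ** g ** matrix_inv P"
  have kH: "k \<in> (\<lambda>g. P ** g ** matrix_inv P) ` H" unfolding k_def using g by blast
  have "k *v axis 2 1 = P *v (g *v (Q *v axis 2 1))"
    by (simp add: k_def P matrix_vector_mul_assoc matrix_mul_assoc)
  also have "\<dots> = e *\<^sub>R (P *v (Q *v axis 2 1))" by (simp add: Q v(2) matrix_vector_mult_scaleR)
  also have "P *v (Q *v axis 2 1) = axis 2 1" using Q(1) by (simp add: matrix_vector_mul_assoc P_def matrix_inv_cancel)
  finally have "k$1$2 = 0" "k$2$2 = e"
    by (simp_all add: vec_eq_iff forall_2 axis_def matrix_vector_mult_def sum_2)
  moreover have "k$1$1 + k$2$2 = e + e"
    unfolding k_def trace_conjugate[OF P(1)] by (simp add: ge e_def)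
  ultimately have k: "k = mat2 e 0 (k$2$1) e" by (simp add: vec_eq_iff forall_2)
  have "k$2$1 \<noteq> 0"
  proof
    assume "k$2$1 = 0"
    then have sk: "scalar_matrix k" using k by (metis scalar_matrix_mat2)
    have "g = Q ** k ** P"
      unfolding k_def P(2) using Q by (simp add: P_def matrix_inv_cancel matrix_mul_assoc)
    also have "\<dots> = k ** (Q ** P)"
      using scalar_matrix_commutes[OF sk, of Q] by (simp add: matrix_mul_assoc)
    also have "\<dots> = k" using Q by (simp add: P_def matrix_inv_cancel)
    finally show False using ns sk by simp
  qed
  then obtain h where "h \<in> (\<lambda>g. P ** g ** matrix_inv P) ` H" "4 < (h$1$1 + h$2$2)\<^sup>2"
    using C.unipotent_imp_hyperbolic[of e "k$2$1"] kH k e2 by metis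
  then show ?thesis using trace_conjugate[OF P(1)] by auto
qed

text \<open>
  The first element is elliptic, parabolic or hyperbolic according to whether its trace has modulus less than,
  equal to or greater than 2. In the three cases a hyperbolic element is provided by the commutator, by \<open>parabolic_imp_hyperbolic\<close>, and by the element itself.
\<close>

lemma nonabelian_imp_hyperbolic:
  assumes g: "g \<in> H" and h: "h \<in> H" and nc: "g ** h \<noteq> h ** g"
  shows "\<exists>k\<in>H. 4 < (k$1$1 + k$2$2)\<^sup>2"
proof -
  have ns: "\<not> scalar_matrix g" using nc scalar_matrix_commutes by blast
  consider "(g$1$1 + g$2$2)\<^sup>2 < 4" | "(g$1$1 + g$2$2)\<^sup>2 = 4" | "4 < (g$1$1 + g$2$2)\<^sup>2" by linarith
  then show ?thesis
  proof cases
    case 1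
    define k where "k = g ** h ** matrix_inv g ** matrix_inv h"
    have "2 < k$1$1 + k$2$2"
      unfolding k_def by (rule trace_commutator_elliptic[OF det_1[OF g] det_1[OF h] 1 nc])
    then have "2\<^sup>2 < (k$1$1 + k$2$2)\<^sup>2" by (intro power_strict_mono) auto
    moreover have "k \<in> H" unfolding k_def using g h by (intro mult_mem inv_mem)
    ultimately show ?thesis by auto
  next
    case 2
    then show ?thesis using parabolic_imp_hyperbolic g ns by blast
  next
    case 3
    then show ?thesis using g by blast
  qed
qed

text \<open>
  The conclusion says that \<open>s\<close> maps the second basis vector, which is contracted by the given diagonal
  element \<open>k\<close>, to a multiple of \<open>v\<close>. If this never happens, a linear combination of the entries in the
  second column of \<open>s\<close> is positive on all of \<open>H\<close> by connectedness. Applying this to \<open>k\<^sup>-\<^sup>n s\<close> and letting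
  \<open>n\<close> tend to infinity gives \<open>s$2$2 \<ge> 0\<close> for all \<open>s\<close>; applying that to \<open>t k\<^sup>n s\<close> gives
  \<open>t$2$1 * s$1$2 \<ge> 0\<close> for all \<open>s, t\<close>. With \<open>t = s\<close> and \<open>t = s\<inverse>\<close> every element is triangular, one way or
  the other, and the product of an upper and a lower triangular element that are not diagonal is not.
\<close>

lemma diagonal_transitive:
  assumes k: "mat2 m 0 0 l \<in> H" and ml: "m * l = 1" and l: "\<bar>l\<bar> < 1" and v: "v \<noteq> 0"
  shows "\<exists>s\<in>H. s$1$2 * v$2 = s$2$2 * v$1"
proof (rule ccontr)
  assume neg: "\<not> ?thesis"
  have v1: "v$1 \<noteq> 0"
  proof
    assume "v$1 = 0"
    then have "(mat 1 :: real^2^2)$1$2 * v$2 = (mat 1 :: real^2^2)$2$2 * v$1" by (simp add: mat_def)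
    then show False using neg one_mem by blast
  qed
  define w where "w = v$2 / v$1"
  have pos: "0 < s$2$2 - s$1$2 * w" if s: "s \<in> H" for s
  proof (rule sign_constant[OF _ _ _ s])
    show "continuous_on H (\<lambda>s. s$2$2 - s$1$2 * w)" by (intro continuous_intros)
    show "g$2$2 - g$1$2 * w \<noteq> 0" if "g \<in> H" for g
      using neg that v1 by (auto simp: w_def field_simps)
  qed (simp add: mat_def)
  have lpos: "0 < l" using pos[OF k] by simp
  have l2: "l * l < 1" using l lpos by (metis abs_of_pos mult_less_cancel_left2 mult_strict_mono less_trans mult.left_neutral less_eq_real_def zero_less_one)
  have lim: "0 \<le> A" if "\<And>n. 0 \<le> A + B * (l * l) ^ n" for A B :: real
  proof -
    have "(\<lambda>n. (l * l) ^ n) \<longlonglongrightarrow> 0" using l2 by (intro LIMSEQ_realpow_zero) auto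
    then have "(\<lambda>n. A + B * (l * l) ^ n) \<longlonglongrightarrow> A + B * 0"
      by (intro tendsto_add tendsto_mult tendsto_const)
    then have "0 \<le> A + B * 0" by (rule LIMSEQ_le_const) (use that in blast)
    then show ?thesis by simp
  qed
  have kpow: "mat2 (m ^ n) 0 0 (l ^ n) \<in> H" for n
  proof (induction n)
    case 0
    then show ?case using one_mem by (simp add: mat_1_eq_mat2)
  next
    case (Suc n)
    then show ?case using mult_mem[OF k Suc] by simp
  qed
  have kinv: "mat2 (l ^ n) 0 0 (m ^ n) \<in> H" for n
  proof -
    have "matrix_inv (mat2 (m ^ n) 0 0 (l ^ n)) = mat2 (l ^ n) 0 0 (m ^ n)"
      by (rule matrix_inv_unique) (use ml in \<open>simp add: mat_1_eq_mat2 mult.commute flip: power_mult_distrib\<close>)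
    then show ?thesis using inv_mem[OF kpow] by metis
  qed
  have mlp: "l ^ n * m ^ n = 1" for n using ml by (simp add: mult.commute flip: power_mult_distrib)
  have d22: "0 \<le> s$2$2" if s: "s \<in> H" for s
  proof (rule lim[of _ "- (s$1$2 * w)"])
    fix n
    have "0 < (mat2 (l ^ n) 0 0 (m ^ n) ** s)$2$2 - (mat2 (l ^ n) 0 0 (m ^ n) ** s)$1$2 * w"
      using pos mult_mem[OF kinv s] by blast
    then have "0 < m ^ n * s$2$2 - l ^ n * s$1$2 * w" by (simp add: matrix_matrix_mult_def sum_2)
    then have "0 < l ^ n * (m ^ n * s$2$2 - l ^ n * s$1$2 * w)" using lpos by simp
    also have "\<dots> = (l ^ n * m ^ n) * s$2$2 - (l * l) ^ n * (s$1$2 * w)"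
      by (simp add: algebra_simps power_mult_distrib)
    finally show "0 \<le> s$2$2 + - (s$1$2 * w) * (l * l) ^ n" by (simp add: mlp mult.commute)
  qed
  have off: "0 \<le> t$2$1 * s$1$2" if s: "s \<in> H" and t: "t \<in> H" for s t
  proof (rule lim[of _ "t$2$2 * s$2$2"])
    fix n
    have "0 \<le> (t ** (mat2 (m ^ n) 0 0 (l ^ n) ** s))$2$2"
      by (intro d22 mult_mem t kpow s)
    then have "0 \<le> t$2$1 * (m ^ n * s$1$2) + t$2$2 * (l ^ n * s$2$2)"
      by (simp add: matrix_matrix_mult_def sum_2)
    then have "0 \<le> l ^ n * (t$2$1 * (m ^ n * s$1$2) + t$2$2 * (l ^ n * s$2$2))" using lpos by simp
    also have "\<dots> = (l ^ n * m ^ n) * (t$2$1 * s$1$2) + t$2$2 * s$2$2 * (l * l) ^ n"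
      by (simp add: algebra_simps power_mult_distrib)
    finally show "0 \<le> t$2$1 * s$1$2 + t$2$2 * s$2$2 * (l * l) ^ n" by (simp add: mlp)
  qed
  have zero: "s$2$1 = 0 \<or> s$1$2 = 0" if s: "s \<in> H" for s
  proof -
    have "matrix_inv s = mat2 (s$2$2) (- s$1$2) (- s$2$1) (s$1$1)"
      using det_1[OF s] by (cases s rule: mat2_cases) (simp add: matrix_inv_mat2)
    then have "0 \<le> - (s$2$1 * s$1$2)" using off[OF s inv_mem[OF s]] by simp
    then show ?thesis using off[OF s s] by simp
  qed
  obtain s t where s: "s \<in> H" and s12: "s$1$2 \<noteq> 0" and t: "t \<in> H" and t21: "t$2$1 \<noteq> 0"
    using ex_nonzero_off_diagonal by blast
  have s21: "s$2$1 = 0" and t12: "t$1$2 = 0" using zero[OF s] zero[OF t] s12 t21 by auto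
  have ds: "s$1$1 * s$2$2 = 1" "t$1$1 * t$2$2 = 1"
    using det_1[OF s] det_1[OF t] s21 t12 by (simp_all add: det_2)
  have "(s ** t)$2$1 = s$2$2 * t$2$1" "(s ** t)$1$2 = s$1$2 * t$2$2"
    by (simp_all add: matrix_matrix_mult_def sum_2 s21 t12)
  then have "s$2$2 * t$2$1 = 0 \<or> s$1$2 * t$2$2 = 0" using zero[OF mult_mem[OF s t]] by simp
  then show False using s12 t21 ds by auto
qed

text \<open>
  A hyperbolic \<open>k\<close> contracts some vector \<open>y\<close>. By transitivity on directions \<open>v\<close> is a multiple of \<open>s y\<close> for some
  \<open>s\<close>, and then \<open>k\<^sup>n s\<inverse>\<close> maps \<open>v\<close> to a multiple of \<open>k\<^sup>n y\<close>, which tends to 0.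
\<close>

lemma hyperbolic_imp_contracting:
  assumes k: "k \<in> H" "4 < (k$1$1 + k$2$2)\<^sup>2" and v: "v \<noteq> 0" and \<epsilon>: "0 < \<epsilon>"
  shows "\<exists>s\<in>H. norm (s *v v) < \<epsilon>"
proof -
  obtain a b c d where ke: "k = mat2 a b c d" by (rule mat2_cases)
  have dk: "a * d - b * c = 1" using det_1[OF k(1)] by (simp add: ke)
  define e where "e = sqrt ((a + d)\<^sup>2 - 4)"
  have e: "0 < e" "e\<^sup>2 = (a + d)\<^sup>2 - 4" using k(2) by (simp_all add: ke e_def)
  have ev: "\<exists>x. x \<noteq> 0 \<and> k *v x = ((a + d + e) / 2) *\<^sub>R x" "\<exists>x. x \<noteq> 0 \<and> k *v x = ((a + d - e) / 2) *\<^sub>R x"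
    using real_eigenvector[of a d b c e] real_eigenvector[of a d b c "- e"] e by (simp_all add: ke dk)
  have prod: "(a + d + e) / 2 * ((a + d - e) / 2) = 1"
    using e(2) by (simp add: power2_eq_square field_simps)
  \<comment> \<open>The eigenvalues are real with product 1; both of modulus 1 would make the squared trace at most 4.\<close>
  have "\<exists>m l. m * l = 1 \<and> \<bar>l\<bar> < 1 \<and> (\<exists>x. x \<noteq> 0 \<and> k *v x = m *\<^sub>R x) \<and> (\<exists>x. x \<noteq> 0 \<and> k *v x = l *\<^sub>R x)"
  proof (cases "\<bar>(a + d - e) / 2\<bar> < 1")
    case True
    then show ?thesis using ev prod by blast
  next
    case False
    have "\<bar>(a + d + e) / 2\<bar> < 1"
    proof (rule ccontr)
      assume "\<not> \<bar>(a + d + e) / 2\<bar> < 1"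
      then have ge: "1 \<le> \<bar>(a + d + e) / 2\<bar>" "1 \<le> \<bar>(a + d - e) / 2\<bar>" using False by linarith+
      have p1: "\<bar>(a + d + e) / 2\<bar> * \<bar>(a + d - e) / 2\<bar> = 1" unfolding abs_mult[symmetric] prod by simp
      have "\<bar>(a + d + e) / 2\<bar> * 1 \<le> \<bar>(a + d + e) / 2\<bar> * \<bar>(a + d - e) / 2\<bar>"
        "1 * \<bar>(a + d - e) / 2\<bar> \<le> \<bar>(a + d + e) / 2\<bar> * \<bar>(a + d - e) / 2\<bar>"
        using ge by (intro mult_left_mono mult_right_mono; simp)+
      then have "\<bar>(a + d + e) / 2\<bar> = 1" "\<bar>(a + d - e) / 2\<bar> = 1"
        using ge unfolding p1 by linarith+
      then have "((a + d + e) / 2)\<^sup>2 = 1" "((a + d - e) / 2)\<^sup>2 = 1"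
        unfolding abs_square_eq_1 by auto
      then have "(a + d + e)\<^sup>2 = 4" "(a + d - e)\<^sup>2 = 4" by (simp_all add: power_divide)
      then have "2 * (a + d)\<^sup>2 + 2 * e\<^sup>2 = 8" by (simp add: power2_eq_square algebra_simps)
      then show False using e(2) k(2) by (simp add: ke)
    qed
    then show ?thesis using ev prod by (metis mult.commute)
  qed
  then obtain m l x y where ml: "m * l = 1" "\<bar>l\<bar> < 1" and x: "x \<noteq> 0" "k *v x = m *\<^sub>R x"
    and y: "y \<noteq> 0" "k *v y = l *\<^sub>R y" by blast
  have m_ne_l: "m \<noteq> l"
  proof
    assume "m = l"
    then have "\<bar>l\<bar> * \<bar>l\<bar> = 1" using ml(1) by (simp flip: abs_mult)
    moreover have "\<bar>l\<bar> * \<bar>l\<bar> \<le> \<bar>l\<bar> * 1" using ml(2) by (intro mult_left_mono) auto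
    ultimately show False using ml(2) by simp
  qed
  define Q where "Q = mat2 (x$1) (y$1) (x$2) (y$2)"
  have indep: "cross2 x y \<noteq> 0"
  proof
    assume "cross2 x y = 0"
    then obtain t where t: "y = t *\<^sub>R x" using cross2_zero_imp_parallel[OF x(1)] by blast
    then have "l *\<^sub>R y = m *\<^sub>R y"
      using x(2) y(2) by (metis matrix_vector_mult_scaleR scaleR_scaleR mult.commute)
    then show False using m_ne_l y(1) by simp
  qed
  then have Q: "invertible Q" by (simp add: Q_def invertible_mat2 cross2_def mult.commute)
  have "k ** Q = Q ** mat2 m 0 0 l"
    using x(2) y(2) by (simp add: Q_def ke mat2_eq_iff vec_eq_iff forall_2 mult.commute)
  define P where "P = matrix_inv Q"
  have P: "invertible P" "matrix_inv P = Q" unfolding P_def using Q by (simp_all add: invertible_matrix_inv matrix_inv_inv)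
  interpret C: irreducible_SL2_group "(\<lambda>g. P ** g ** matrix_inv P) ` H" by (rule conjugate_irreducible_SL2[OF P(1)])
  have "P ** k ** matrix_inv P = P ** (k ** Q)" by (simp add: P matrix_mul_assoc)
  also have "\<dots> = mat2 m 0 0 l"
    unfolding \<open>k ** Q = _\<close> P_def using Q by (simp add: matrix_inv_cancel)
  finally have "mat2 m 0 0 l \<in> (\<lambda>g. P ** g ** matrix_inv P) ` H" using k(1) by (metis imageI)
  moreover have "P *v v \<noteq> 0"
  proof
    assume "P *v v = 0"
    then have "Q *v (P *v v) = 0" by simp
    then show False using v Q by (simp add: matrix_vector_mul_assoc P_def matrix_inv_cancel)
  qed
  ultimately obtain s' where s': "s' \<in> (\<lambda>g. P ** g ** matrix_inv P) ` H"
    "s'$1$2 * (P *v v)$2 = s'$2$2 * (P *v v)$1"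
    using C.diagonal_transitive[OF _ ml] by blast
  obtain s where s: "s \<in> H" "s' = P ** s ** Q" using s'(1) P by auto
  define z where "z = s' *v axis 2 1"
  have z: "z$1 = s'$1$2" "z$2 = s'$2$2"
    by (simp_all add: z_def axis_def matrix_vector_mult_def sum_2)
  have "z \<noteq> 0"
  proof
    assume "z = 0"
    then have "det s' = 0" using z by (simp add: det_2)
    then show False using C.det_1[OF s'(1)] by simp
  qed
  moreover have "cross2 z (P *v v) = 0" using s'(2) by (simp add: cross2_def z)
  ultimately obtain t where t: "P *v v = t *\<^sub>R z" using cross2_zero_imp_parallel by blast
  have Qy: "Q *v axis 2 1 = y"
    by (simp add: Q_def vec_eq_iff forall_2 axis_def)
  have "v = Q *v (P *v v)" using Q by (simp add: matrix_vector_mul_assoc P_def matrix_inv_cancel)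
  also have "\<dots> = t *\<^sub>R (Q *v (P *v (s *v (Q *v axis 2 1))))"
    by (simp add: t z_def s(2) matrix_vector_mult_scaleR matrix_vector_mul_assoc matrix_mul_assoc)
  also have "\<dots> = t *\<^sub>R (s *v y)"
    using Q by (simp add: Qy matrix_vector_mul_assoc P_def matrix_inv_cancel)
  finally have "matrix_inv s *v v = t *\<^sub>R y"
    using invertible[OF s(1)] by (simp add: matrix_vector_mult_scaleR matrix_vector_mul_assoc matrix_inv_cancel)
  then have pow: "\<exists>r\<in>H. r *v v = (l ^ n * t) *\<^sub>R y" for n
  proof (induction n)
    case 0
    then show ?case using inv_mem[OF s(1)] by auto
  next
    case (Suc n)
    then obtain r where r: "r \<in> H" "r *v v = (l ^ n * t) *\<^sub>R y" by blast
    have "(k ** r) *v v = k *v (r *v v)" by (simp add: matrix_vector_mul_assoc)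
    also have "\<dots> = (l ^ Suc n * t) *\<^sub>R y" by (simp add: r(2) matrix_vector_mult_scaleR y(2) mult_ac)
    finally show ?case using mult_mem[OF k(1) r(1)] by blast
  qed
  have "(\<lambda>n. norm ((l ^ n * t) *\<^sub>R y)) \<longlonglongrightarrow> norm ((0 * t) *\<^sub>R y)"
    using ml(2) by (intro tendsto_intros LIMSEQ_power_zero) auto
  then have "\<forall>\<^sub>F n in sequentially. norm ((l ^ n * t) *\<^sub>R y) < \<epsilon>"
    using \<epsilon> by (intro order_tendstoD(2)) auto
  then obtain n where "norm ((l ^ n * t) *\<^sub>R y) < \<epsilon>" by (auto simp: eventually_sequentially)
  then show ?thesis using pow[of n] by metis
qed

end

section \<open>Widths in cosets of contracting groups\<close>

lemma norm_orthogonal_column: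
  fixes k :: "real^2^2"
  assumes "orthogonal_matrix k"
  shows "norm (k *v axis 1 1) = 1"
proof -
  obtain a b c d where k: "k = mat2 a b c d" by (rule mat2_cases)
  have "transpose k = mat2 a c b d" by (simp add: k vec_eq_iff forall_2 transpose_def)
  then have "mat2 a c b d ** mat2 a b c d = mat 1" using assms by (simp add: orthogonal_matrix_def k)
  then have "a * a + c * c = 1" by (simp add: mat_1_eq_mat2 mat2_eq_iff)
  then have "(norm (k *v axis 1 1))\<^sup>2 = 1\<^sup>2"
    unfolding norm_vec2 k by (simp add: axis_def power2_eq_square)
  then show ?thesis by (rule power2_eq_imp_eq) simp_all
qed

locale contracting_SL2_group = connected_SL2_group +
  assumes contracting: "v \<noteq> 0 \<Longrightarrow> 0 < \<epsilon> \<Longrightarrow> \<exists>s\<in>H. norm (s *v v) < \<epsilon>"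
begin

text \<open>
  For each \<open>s\<close> the set of vectors that it shortens to less than \<open>1/2\<close> is open; together these sets cover the
  circle, so finitely many \<open>s\<close> suffice.
\<close>

lemma uniformly_contracting:
  obtains M where "1 \<le> M" "\<And>v. norm v = 1 \<Longrightarrow> \<exists>s\<in>H. norm s \<le> M \<and> norm (s *v v) < 1 / 2"
proof -
  define U where "U s = {v::real^2. norm (s *v v) < 1 / 2}" for s :: "real^2^2"
  have op: "open (U s)" for s
    unfolding U_def by (intro open_Collect_less continuous_intros linear_continuous_on) (simp add: matrix_vector_mul_bounded_linear)
  have "sphere 0 1 \<subseteq> \<Union> (U ` H)"
  proof
    fix v :: "real^2" assume "v \<in> sphere 0 1"
    then have "v \<noteq> 0" by auto
    then obtain s where "s \<in> H" "norm (s *v v) < 1 / 2" using contracting[of v "1 / 2"] by auto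
    then show "v \<in> \<Union> (U ` H)" by (auto simp: U_def)
  qed
  then obtain F where F: "F \<subseteq> H" "finite F" "sphere 0 1 \<subseteq> \<Union> (U ` F)"
    using compactE_image[OF compact_sphere[of "0::real^2" 1], of H U] op by metis
  define M where "M = Max (insert 1 (norm ` F))"
  show thesis
  proof
    show "1 \<le> M" unfolding M_def using F(2) by (intro Max_ge) auto
    fix v :: "real^2" assume "norm v = 1"
    then obtain s where s: "s \<in> F" "v \<in> U s" using F(3) by force
    moreover have "norm s \<le> M" unfolding M_def using F(2) s by (intro Max_ge) auto
    ultimately show "\<exists>s\<in>H. norm s \<le> M \<and> norm (s *v v) < 1 / 2" using F(1) by (auto simp: U_def)
  qed
qed

text \<open>
  If the width of \<open>g\<close> is large, \<open>g\<close> is close to a matrix of rank one with image spanned by some unit vector. An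
  element of bounded norm that halves this vector makes the norm of \<open>g\<close> smaller by a definite factor, and it
  preserves the determinant.
\<close>

lemma coset_shrinks:
  obtains C where "0 < C" "\<And>g. invertible g \<Longrightarrow> C * \<bar>det g\<bar> < (norm g)\<^sup>2 \<Longrightarrow>
    \<exists>s\<in>H. 2 * (norm (s ** g))\<^sup>2 \<le> (norm g)\<^sup>2"
proof -
  obtain M where M: "1 \<le> M" "\<And>v. norm v = 1 \<Longrightarrow> \<exists>s\<in>H. norm s \<le> M \<and> norm (s *v v) < 1 / 2"
    using uniformly_contracting by blast
  show thesis
  proof
    show "0 < 4 * M" using M(1) by simp
    fix g :: "real^2^2" assume g: "invertible g" and big: "4 * M * \<bar>det g\<bar> < (norm g)\<^sup>2"
    obtain k \<sigma> \<tau> k' where k: "orthogonal_matrix k" "orthogonal_matrix k'" and st: "0 < \<tau>" "\<tau> \<le> \<sigma>"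
      and gd: "g = k ** mat2 \<sigma> 0 0 \<tau> ** k'" by (rule singular_value_decomposition[OF g])
    have n: "(norm g)\<^sup>2 = \<sigma>\<^sup>2 + \<tau>\<^sup>2"
      unfolding gd norm_orthogonal_mult[OF k(1)] norm_orthogonal_mult[OF k(2)] norm_mat2 by simp
    have d: "\<bar>det g\<bar> = \<sigma> * \<tau>"
      unfolding gd det_mul abs_mult using abs_det_orthogonal k st by (simp add: abs_mult)
    have "\<tau>\<^sup>2 \<le> \<sigma>\<^sup>2" using st by (intro power_mono) auto
    then have "4 * M * (\<sigma> * \<tau>) < 2 * \<sigma>\<^sup>2" using big unfolding n d by linarith
    then have "\<sigma> * (2 * M * \<tau>) < \<sigma> * \<sigma>" by (simp add: power2_eq_square algebra_simps)
    then have "2 * M * \<tau> < \<sigma>" using st by simp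
    then have "(2 * M * \<tau>)\<^sup>2 \<le> \<sigma>\<^sup>2" using st M(1) by (intro power_mono) auto
    then have small: "4 * (M\<^sup>2 * \<tau>\<^sup>2) \<le> \<sigma>\<^sup>2" by (simp add: power_mult_distrib)
    obtain s where s: "s \<in> H" "norm s \<le> M" "norm (s *v (k *v axis 1 1)) < 1 / 2"
      using M(2)[OF norm_orthogonal_column[OF k(1)]] by blast
    obtain a b c e where sk: "s ** k = mat2 a b c e" by (rule mat2_cases)
    have "(norm (s *v (k *v axis 1 1)))\<^sup>2 \<le> (1 / 2)\<^sup>2" using s(3) by (intro power_mono) auto
    then have ac: "a\<^sup>2 + c\<^sup>2 \<le> 1 / 4"
      unfolding matrix_vector_mul_assoc sk norm_vec2 by (simp add: axis_def power2_eq_square)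
    have "(norm (s ** k))\<^sup>2 \<le> M\<^sup>2" unfolding norm_orthogonal_mult[OF k(1)] using s(2) by (intro power_mono) auto
    then have "a\<^sup>2 + b\<^sup>2 + c\<^sup>2 + e\<^sup>2 \<le> M\<^sup>2" unfolding sk norm_mat2 .
    then have be: "b\<^sup>2 + e\<^sup>2 \<le> M\<^sup>2" using zero_le_power2[of a] zero_le_power2[of c] by linarith
    have "s ** g = (s ** k) ** mat2 \<sigma> 0 0 \<tau> ** k'" by (simp add: gd matrix_mul_assoc)
    then have "(norm (s ** g))\<^sup>2 = (norm (mat2 (a * \<sigma>) (b * \<tau>) (c * \<sigma>) (e * \<tau>)))\<^sup>2"
      by (simp add: norm_orthogonal_mult[OF k(2)] sk)
    also have "\<dots> = (a\<^sup>2 + c\<^sup>2) * \<sigma>\<^sup>2 + (b\<^sup>2 + e\<^sup>2) * \<tau>\<^sup>2"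
      unfolding norm_mat2 by (simp add: power_mult_distrib algebra_simps)
    also have "\<dots> \<le> 1 / 4 * \<sigma>\<^sup>2 + M\<^sup>2 * \<tau>\<^sup>2"
      using ac be by (intro add_mono mult_right_mono) auto
    finally have "2 * (norm (s ** g))\<^sup>2 \<le> \<sigma>\<^sup>2" using small by linarith
    then have "2 * (norm (s ** g))\<^sup>2 \<le> (norm g)\<^sup>2" unfolding n using zero_le_power2[of \<tau>] by linarith
    then show "\<exists>s\<in>H. 2 * (norm (s ** g))\<^sup>2 \<le> (norm g)\<^sup>2" using s(1) by blast
  qed
qed

text \<open>
  Iteration of \<open>coset_shrinks\<close>: each step halves the squared norm, so that finitely many steps suffice.
\<close>

lemma coset_has_narrow_element:
  obtains C where "0 < C" "\<And>g. invertible g \<Longrightarrow> \<exists>s\<in>H. (norm (s ** g))\<^sup>2 \<le> C * \<bar>det g\<bar>"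
proof -
  obtain C where C: "0 < C" "\<And>g. invertible g \<Longrightarrow> C * \<bar>det g\<bar> < (norm g)\<^sup>2 \<Longrightarrow>
    \<exists>s\<in>H. 2 * (norm (s ** g))\<^sup>2 \<le> (norm g)\<^sup>2" using coset_shrinks by blast
  have "\<exists>s\<in>H. (norm (s ** g))\<^sup>2 \<le> C * \<bar>det g\<bar>"
    if "invertible g" "(norm g)\<^sup>2 \<le> 2 ^ n * (C * \<bar>det g\<bar>)" for n g
    using that
  proof (induction n arbitrary: g)
    case 0
    then show ?case using one_mem by (intro bexI[of _ "mat 1"]) auto
  next
    case (Suc n)
    show ?case
    proof (cases "C * \<bar>det g\<bar> < (norm g)\<^sup>2")
      case True
      then obtain s where s: "s \<in> H" "2 * (norm (s ** g))\<^sup>2 \<le> (norm g)\<^sup>2" using C(2) Suc.prems(1) by blast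
      have dsg: "det (s ** g) = det g" using det_1[OF s(1)] by (simp add: det_mul)
      have "2 * (norm (s ** g))\<^sup>2 \<le> 2 * (2 ^ n * (C * \<bar>det g\<bar>))" using s(2) Suc.prems(2) by simp
      then have "(norm (s ** g))\<^sup>2 \<le> 2 ^ n * (C * \<bar>det (s ** g)\<bar>)" unfolding dsg by linarith
      moreover have "invertible (s ** g)" using invertible[OF s(1)] Suc.prems(1) by (rule invertible_mult)
      ultimately obtain r where r: "r \<in> H" "(norm (r ** (s ** g)))\<^sup>2 \<le> C * \<bar>det (s ** g)\<bar>" using Suc.IH by blast
      then have "(norm ((r ** s) ** g))\<^sup>2 \<le> C * \<bar>det g\<bar>" by (simp add: dsg matrix_mul_assoc)
      then show ?thesis using mult_mem[OF r(1) s(1)] by blast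
    next
      case False
      then show ?thesis using one_mem by (intro bexI[of _ "mat 1"]) auto
    qed
  qed
  moreover have "\<exists>n. (norm g)\<^sup>2 \<le> 2 ^ n * (C * \<bar>det g\<bar>)" if "invertible g" for g :: "real^2^2"
  proof -
    have p: "0 < C * \<bar>det g\<bar>" using C(1) that by (simp add: invertible_det_nz)
    obtain n where "(norm g)\<^sup>2 / (C * \<bar>det g\<bar>) < 2 ^ n" using real_arch_pow[of 2] by auto
    then show ?thesis using p by (intro exI[of _ n]) (simp add: pos_divide_less_eq)
  qed
  ultimately show thesis using that C(1) by blast
qed

text \<open>
  If \<open>s\<close> makes the first column of \<open>s g\<close> very short, its second column must be long because the determinant is
  that of \<open>g\<close>.
\<close>

lemma coset_unbounded:
  assumes g: "invertible g"
  shows "\<exists>s\<in>H. q \<le> snd (cartan_mu (s ** g))"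
proof -
  have dg: "0 < \<bar>det g\<bar>" using g by (simp add: invertible_det_nz)
  define v where "v = g *v axis 1 1"
  have "matrix_inv g *v v = axis 1 1"
    unfolding v_def using g by (simp add: matrix_vector_mul_assoc matrix_inv_cancel)
  then have v: "v \<noteq> 0" by (metis axis_eq_0_iff matrix_vector_mult_0_right zero_neq_one)
  define \<epsilon> where "\<epsilon> = sqrt (\<bar>det g\<bar> / exp q)"
  have \<epsilon>: "0 < \<epsilon>" "\<epsilon>\<^sup>2 = \<bar>det g\<bar> / exp q" using dg by (simp_all add: \<epsilon>_def)
  obtain s where s: "s \<in> H" "norm (s *v v) < \<epsilon>" using contracting[OF v \<epsilon>(1)] by blast
  obtain a b c d where h: "s ** g = mat2 a b c d" by (rule mat2_cases)
  have dsg: "det (s ** g) = det g" using det_1[OF s(1)] by (simp add: det_mul)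
  have "(norm (s *v v))\<^sup>2 \<le> \<epsilon>\<^sup>2" using s(2) by (intro power_mono) auto
  then have ac: "a\<^sup>2 + c\<^sup>2 \<le> \<bar>det g\<bar> / exp q"
    unfolding \<epsilon>(2) v_def matrix_vector_mul_assoc h norm_vec2 by (simp add: axis_def)
  have "(det g)\<^sup>2 = (a * d - b * c)\<^sup>2" unfolding dsg[symmetric] h by simp
  also have "\<dots> \<le> (a\<^sup>2 + c\<^sup>2) * (b\<^sup>2 + d\<^sup>2)"
  proof -
    have "(a\<^sup>2 + c\<^sup>2) * (b\<^sup>2 + d\<^sup>2) - (a * d - b * c)\<^sup>2 = (a * b + c * d)\<^sup>2"
      by (simp add: power2_eq_square algebra_simps)
    then show ?thesis by (metis diff_ge_0_iff_ge zero_le_power2)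
  qed
  also have "\<dots> \<le> (\<bar>det g\<bar> / exp q) * (norm (s ** g))\<^sup>2"
    using ac dg unfolding h norm_mat2 by (intro mult_mono) auto
  finally have "\<bar>det g\<bar> * \<bar>det g\<bar> \<le> \<bar>det g\<bar> * ((norm (s ** g))\<^sup>2 / exp q)"
    by (simp add: power2_eq_square)
  then have "\<bar>det g\<bar> \<le> (norm (s ** g))\<^sup>2 / exp q" using dg by (simp only: mult_le_cancel_left_pos)
  then have "exp q \<le> (norm (s ** g))\<^sup>2 / \<bar>det (s ** g)\<bar>"
    unfolding dsg using dg by (simp add: pos_le_divide_eq mult.commute)
  then have "ln (exp q) \<le> ln ((norm (s ** g))\<^sup>2 / \<bar>det (s ** g)\<bar>)"
    using less_le_trans[OF exp_gt_zero] by (subst ln_le_cancel_iff) auto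
  then show ?thesis using s(1) by (intro bexI[of _ s]) (simp_all add: cartan_mu_def)
qed

text \<open>
  The width is continuous on the connected coset \<open>H g\<close>; it is small somewhere by \<open>coset_has_narrow_element\<close> and
  unbounded by \<open>coset_unbounded\<close>.
\<close>

lemma coset_attains_all_widths:
  obtains q0 where "\<And>g q. invertible g \<Longrightarrow> q0 \<le> q \<Longrightarrow> \<exists>s\<in>H. cartan_mu (s ** g) = (ln \<bar>det g\<bar>, q)"
proof -
  obtain C where C: "0 < C" "\<And>g. invertible g \<Longrightarrow> \<exists>s\<in>H. (norm (s ** g))\<^sup>2 \<le> C * \<bar>det g\<bar>"
    using coset_has_narrow_element by blast
  show thesis
  proof
    fix g :: "real^2^2" and q assume g: "invertible g" and q: "ln C \<le> q"
    have dg: "0 < \<bar>det g\<bar>" using g by (simp add: invertible_det_nz)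
    have dsg: "det (s ** g) = det g" if "s \<in> H" for s using det_1[OF that] by (simp add: det_mul)
    have isg: "invertible (s ** g)" if "s \<in> H" for s using invertible[OF that] g by (rule invertible_mult)
    define W where "W s = snd (cartan_mu (s ** g))" for s
    have W: "W s = ln ((norm (s ** g))\<^sup>2 / \<bar>det (s ** g)\<bar>)" for s by (simp add: W_def cartan_mu_def)
    have "continuous_on H W"
      unfolding W using isg invertible_norm_pos by (intro continuous_intros) (auto simp: invertible_det_nz)
    then have con: "connected (W ` H)" by (intro connected_continuous_image conn)
    obtain s where s: "s \<in> H" "(norm (s ** g))\<^sup>2 \<le> C * \<bar>det g\<bar>" using C(2)[OF g] by blast
    have "(norm (s ** g))\<^sup>2 / \<bar>det (s ** g)\<bar> \<le> C"
      unfolding dsg[OF s(1)] using s(2) dg by (simp add: pos_divide_le_eq)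
    moreover have "0 < (norm (s ** g))\<^sup>2 / \<bar>det (s ** g)\<bar>"
      unfolding dsg[OF s(1)] using dg invertible_norm_pos[OF isg[OF s(1)]] by simp
    ultimately have "W s \<le> ln C" unfolding W using C(1) by (subst ln_le_cancel_iff) auto
    then have lo: "W s \<le> q" using q by simp
    obtain t where t: "t \<in> H" "q \<le> W t" using coset_unbounded[OF g] unfolding W_def by blast
    have "q \<in> W ` H" using connectedD_interval[OF con _ _ lo t(2)] s(1) t(1) by blast
    then obtain r where r: "r \<in> H" "W r = q" by blast
    have "cartan_mu (r ** g) = (fst (cartan_mu (r ** g)), W r)" by (simp add: W_def)
    also have "\<dots> = (ln \<bar>det g\<bar>, q)" by (simp add: r(2) fst_cartan_mu dsg[OF r(1)])
    finally show "\<exists>s\<in>H. cartan_mu (s ** g) = (ln \<bar>det g\<bar>, q)" using r(1) by blast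
  qed
qed

end

section \<open>Irreducible non-abelian groups\<close>

context irreducible_matrix_group
begin

text \<open>
  Suppose that \<open>v\<close> spans a line invariant under the normal subgroup \<open>derived\<close>, and let \<open>s\<close> be a non-scalar
  element of it. Then \<open>h v\<close> is an eigenvector of \<open>s\<close> for every \<open>h \<in> H\<close>. Its eigenvalue depends continuously on
  \<open>h\<close> and takes at most two values, so it is constant. Therefore \<open>h v\<close> stays in one eigenspace of \<open>s\<close>, which is
  a line, and \<open>v\<close> spans a line invariant under \<open>H\<close>.
\<close>

lemma derived_irreducible:
  assumes nc: "g \<in> H" "h \<in> H" "g ** h \<noteq> h ** g"
  shows "irreducible_SL2_group derived"
proof -
  interpret D: connected_SL2_group derived
    using connected_matrix_group_derived det_derived
    by (simp add: connected_SL2_group_def connected_SL2_group_axioms_def)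
  have nontriv: "\<exists>s\<in>derived. \<not> scalar_matrix s"
  proof (rule ccontr)
    assume "\<not> ?thesis"
    then have "g ** h ** matrix_inv g ** matrix_inv h = mat 1"
      using D.scalar_mem_imp_one commutator_mem_derived[OF nc(1,2)] by blast
    then have "g ** h ** matrix_inv g ** matrix_inv h ** h ** g = h ** g" by simp
    then show False using nc invertible by (simp add: matrix_inv_cancel)
  qed
  then obtain s where s: "s \<in> derived" "\<not> scalar_matrix s" by blast
  show ?thesis
  proof
    fix v :: "real^2" assume v: "v \<noteq> 0"
    show "\<exists>g\<in>derived. \<forall>c. g *v v \<noteq> c *\<^sub>R v"
    proof (rule ccontr)
      assume "\<not> ?thesis"
      then have inv_line: "\<exists>c. t *v v = c *\<^sub>R v" if "t \<in> derived" for t using that by blast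
      have hv: "h *v v \<noteq> 0" if "h \<in> H" for h
      proof
        assume "h *v v = 0"
        then have "matrix_inv h *v (h *v v) = 0" by simp
        then show False using v invertible[OF that] by (simp add: matrix_vector_mul_assoc matrix_inv_cancel)
      qed
      have eig: "\<exists>c. s *v (h *v v) = c *\<^sub>R (h *v v)" if h: "h \<in> H" for h
      proof -
        have "matrix_inv h ** s ** matrix_inv (matrix_inv h) \<in> derived"
          by (rule derived_conj[OF s(1) inv_mem[OF h]])
        then have "matrix_inv h ** s ** h \<in> derived" using invertible[OF h] by (simp add: matrix_inv_inv)
        then obtain c where c: "(matrix_inv h ** s ** h) *v v = c *\<^sub>R v" using inv_line by blast
        have "s *v (h *v v) = h *v ((matrix_inv h ** s ** h) *v v)"
          using invertible[OF h] by (simp add: matrix_vector_mul_assoc matrix_mul_assoc matrix_inv_cancel)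
        also have "\<dots> = c *\<^sub>R (h *v v)" unfolding c by (simp add: matrix_vector_mult_scaleR)
        finally show ?thesis by blast
      qed
      define ev where "ev h = ((s *v (h *v v)) \<bullet> (h *v v)) / ((h *v v) \<bullet> (h *v v))" for h
      have ev: "s *v (h *v v) = ev h *\<^sub>R (h *v v)" if h: "h \<in> H" for h
      proof -
        obtain c where c: "s *v (h *v v) = c *\<^sub>R (h *v v)" using eig[OF h] by blast
        then have "ev h = c" using hv[OF h] by (simp add: ev_def)
        then show ?thesis using c by simp
      qed
      define l where "l = ev (mat 1)"
      define m where "m = s$1$1 + s$2$2 - l"
      have two: "ev h = l \<or> ev h = m" if h: "h \<in> H" for h
      proof -
        have charpoly: "c * c - (s$1$1 + s$2$2) * c + det s = 0" if "w \<noteq> 0" "s *v w = c *\<^sub>R w" for c and w :: "real^2"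
        proof -
          obtain a b d e where se: "s = mat2 a b d e" by (rule mat2_cases)
          have e1: "a * w$1 + b * w$2 = c * w$1" "d * w$1 + e * w$2 = c * w$2"
            using that(2) by (simp_all add: se vec_eq_iff forall_2)
          have "(c * c - (a + e) * c + (a * e - b * d)) * w$1 =
              (e - c) * (a * w$1 + b * w$2 - c * w$1) - b * (d * w$1 + e * w$2 - c * w$2)"
            "(c * c - (a + e) * c + (a * e - b * d)) * w$2 =
              (a - c) * (d * w$1 + e * w$2 - c * w$2) - d * (a * w$1 + b * w$2 - c * w$1)"
            by (simp_all add: algebra_simps)
          then have "(c * c - (a + e) * c + (a * e - b * d)) * w$1 = 0"
            "(c * c - (a + e) * c + (a * e - b * d)) * w$2 = 0" unfolding e1 by simp_all
          moreover have "w$1 \<noteq> 0 \<or> w$2 \<noteq> 0" using that(1) by (auto simp: vec_eq_iff forall_2)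
          ultimately show ?thesis unfolding se by auto
        qed
        have "ev h * ev h - (s$1$1 + s$2$2) * ev h + det s = 0" "l * l - (s$1$1 + s$2$2) * l + det s = 0"
          using charpoly[OF hv[OF h] ev[OF h]] charpoly[OF hv[OF one_mem] ev[OF one_mem]] by (simp_all add: l_def)
        then have "(ev h - l) * (ev h - m) = 0" by (simp add: m_def algebra_simps)
        then show ?thesis by simp
      qed
      have const: "ev h = l" if h: "h \<in> H" for h
      proof (cases "l = m")
        case False
        have cont: "continuous_on H (\<lambda>h. h *v v)"
          unfolding matrix_vector_mult_def by (intro continuous_intros)
        have "continuous_on H ev"
          unfolding ev_def using hv
          by (intro continuous_intros cont continuous_on_compose2[OF linear_continuous_on[OF matrix_vector_mul_bounded_linear] cont]) auto
        then have c: "continuous_on H (\<lambda>h. (ev h - (l + m) / 2) * (l - m))" by (intro continuous_intros)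
        have sq: "0 < (l - m) * (l - m)" using False by (simp add: zero_less_mult_iff) linarith
        have "0 < (ev h - (l + m) / 2) * (l - m)"
        proof (rule sign_constant[OF c _ _ h])
          show "0 < (ev (mat 1) - (l + m) / 2) * (l - m)"
            using sq unfolding l_def[symmetric] by (simp add: field_simps)
          show "(ev g - (l + m) / 2) * (l - m) \<noteq> 0" if "g \<in> H" for g
          proof -
            have "ev g \<noteq> (l + m) / 2" using two[OF that] False by auto
            then show ?thesis using False by simp
          qed
        qed
        moreover have "(ev h - (l + m) / 2) * (l - m) < 0" if "ev h = m"
          using sq unfolding that by (simp add: field_simps)
        ultimately show ?thesis using two[OF h] by fastforce
      qed (use two[OF h] in auto)
      have "\<exists>c. h *v v = c *\<^sub>R v" if h: "h \<in> H" for h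
        using eigenspace_line[OF s(2) v, of l "h *v v"] ev[OF h] ev[OF one_mem] const[OF h] by (simp add: l_def)
      then show False using irreducible[OF v] by blast
    qed
  qed
qed

text \<open>
  Otherwise \<open>derived\<close> consists of combinations of the identity and an elliptic matrix \<open>X\<close>. The conjugates of
  \<open>X\<close> by elements of \<open>H\<close> are such combinations with the same trace and determinant, which leaves \<open>X\<close> and \<open>X\<inverse>\<close>.
  By connectedness of \<open>H\<close> all conjugates equal \<open>X\<close>, so \<open>H\<close> commutes with \<open>X\<close> and is abelian.
\<close>

lemma derived_nonabelian:
  assumes nc: "g \<in> H" "h \<in> H" "g ** h \<noteq> h ** g"
  shows "\<exists>s\<in>derived. \<exists>t\<in>derived. s ** t \<noteq> t ** s"
proof (rule ccontr)
  assume "\<not> ?thesis"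
  then have ab: "s ** t = t ** s" if "s \<in> derived" "t \<in> derived" for s t using that by blast
  interpret D: irreducible_SL2_group derived by (rule derived_irreducible[OF nc])
  obtain X where X: "X \<in> derived" "\<not> scalar_matrix X" using D.nonscalar_exists by blast
  obtain p q r s where Xe: "X = mat2 p q r s" by (rule mat2_cases)
  have dX: "p * s - q * r = 1" using D.det_1[OF X(1)] by (simp add: Xe)
  have ell: "(p + s)\<^sup>2 < 4"
    using D.commuting_elliptic[OF ab[OF _ X(1)] X(2)] by (simp add: Xe dX)
  have q: "q \<noteq> 0"
  proof
    assume "q = 0"
    then have "p * s = 1" using dX by simp
    then have "(p + s)\<^sup>2 - 4 = (p - s)\<^sup>2" by (simp add: power2_eq_square algebra_simps)
    then show False using ell zero_le_power2[of "p - s"] by linarith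
  qed
  \<comment> \<open>The coefficient of \<open>X\<close> in its conjugate by \<open>k\<close>, which turns out to be \<open>\<plusminus>1\<close>.\<close>
  define f :: "real^2^2 \<Rightarrow> real" where "f k = (k ** X ** matrix_inv k)$1$2 / q" for k
  have Y: "k ** X ** matrix_inv k = X" if k: "k \<in> H" for k
  proof -
    have form: "\<exists>m. j ** X ** matrix_inv j = mat2 (m + f j * p) (f j * q) (f j * r) (m + f j * s) \<and> f j * f j = 1 \<and>
        2 * m + f j * (p + s) = p + s" if j: "j \<in> H" for j
    proof -
      define Y where "Y = j ** X ** matrix_inv j"
      have Yd: "Y \<in> derived" unfolding Y_def by (rule derived_conj[OF X(1) j])
      have "Y ** mat2 p q r s = mat2 p q r s ** Y" using ab[OF Yd X(1)] by (simp add: Xe)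
      then obtain m t where e: "Y = mat2 (m + t * p) (t * q) (t * r) (m + t * s)" using centralizer_mat2[OF q] by metis
      have t: "t = f j" using q by (simp add: f_def e flip: Y_def)
      have tr: "2 * m + t * (p + s) = p + s"
        using D.trace_conjugate[OF invertible[OF j], of X] unfolding Y_def[symmetric] by (simp add: e Xe algebra_simps)
      have "det Y = 1" by (rule D.det_1[OF Yd])
      then have "(m + t * p) * (m + t * s) - (t * q) * (t * r) = 1" by (simp add: e)
      then have "4 * ((m + t * p) * (m + t * s) - (t * q) * (t * r)) = 4" by simp
      moreover have "4 * ((m + t * p) * (m + t * s) - (t * q) * (t * r)) =
          (2 * m + t * (p + s))\<^sup>2 + t * t * (4 * (p * s - q * r) - (p + s)\<^sup>2)"
        by (simp add: power2_eq_square algebra_simps)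
      ultimately have "(p + s)\<^sup>2 + t * t * (4 - (p + s)\<^sup>2) = 4" unfolding tr dX by simp
      then have "(t * t - 1) * (4 - (p + s)\<^sup>2) = 0" by (simp add: algebra_simps)
      then have "t * t = 1" using ell by simp
      then show ?thesis using e tr unfolding t Y_def by blast
    qed
    have cont: "continuous_on H f"
      unfolding f_def using q invertible by (intro continuous_intros) auto
    have "0 < f k"
    proof (rule sign_constant[OF cont _ _ k])
      show "f j \<noteq> 0" if "j \<in> H" for j using form[OF that] by auto
      have "matrix_inv (mat 1 :: real^2^2) = mat 1" by (rule matrix_inv_unique) simp
      then show "0 < f (mat 1)" using q by (simp add: f_def Xe)
    qed
    moreover obtain m where m: "k ** X ** matrix_inv k = mat2 (m + f k * p) (f k * q) (f k * r) (m + f k * s)"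
      "f k * f k = 1" "2 * m + f k * (p + s) = p + s" using form[OF k] by blast
    ultimately have f1: "f k = 1" by (metis power2_eq_1_iff power2_eq_square less_asym neg_0_less_iff_less zero_less_one)
    then have "m = 0" using m(3) by simp
    then show ?thesis using m(1) f1 by (simp add: Xe)
  qed
  have comm: "k ** X = X ** k" if k: "k \<in> H" for k
  proof -
    have "k ** X ** matrix_inv k ** k = X ** k" by (simp add: Y[OF k])
    then show ?thesis using invertible[OF k] by (simp add: matrix_inv_cancel)
  qed
  obtain m t where ge: "g = mat2 (m + t * p) (t * q) (t * r) (m + t * s)"
    using centralizer_mat2[OF q] comm[OF nc(1)] Xe by metis
  obtain m' t' where he: "h = mat2 (m' + t' * p) (t' * q) (t' * r) (m' + t' * s)"
    using centralizer_mat2[OF q] comm[OF nc(2)] Xe by metis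
  have "g ** h = h ** g" unfolding ge he by (simp add: mat2_eq_iff algebra_simps)
  then show False using nc(3) by simp
qed

text \<open>
  Each coset of \<open>derived\<close> has constant determinant and attains all large widths, so \<open>\<mu>(H)\<close> is a union of
  vertical rays over the values of \<open>ln (det g)\<close>, up to a bounded error.
\<close>

theorem classified_irreducible: "classified H"
proof (cases "\<forall>g\<in>H. \<forall>h\<in>H. g ** h = h ** g")
  case True
  then show ?thesis using classified_abelian by blast
next
  case False
  then obtain g h where nc: "g \<in> H" "h \<in> H" "g ** h \<noteq> h ** g" by blast
  interpret D: irreducible_SL2_group derived by (rule derived_irreducible[OF nc])
  obtain k where k: "k \<in> derived" "4 < (k$1$1 + k$2$2)\<^sup>2"
    using derived_nonabelian[OF nc] D.nonabelian_imp_hyperbolic by blast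
  interpret D: contracting_SL2_group derived
    by unfold_locales (rule D.hyperbolic_imp_contracting[OF k])
  obtain q0 where q0: "\<And>g q. invertible g \<Longrightarrow> q0 \<le> q \<Longrightarrow> \<exists>s\<in>derived. cartan_mu (s ** g) = (ln \<bar>det g\<bar>, q)"
    using D.coset_attains_all_widths by blast
  define P :: "(real \<times> real) set" where "P = {(x, q) | x q. x \<in> (\<lambda>g. ln (det g)) ` H \<and> 0 \<le> q}"
  have "cartan_mu ` H \<subseteq> P"
  proof
    fix a assume "a \<in> cartan_mu ` H"
    then obtain g where g: "g \<in> H" "a = cartan_mu g" by blast
    have "a = (ln (det g), snd a)" using fst_cartan_mu_mem[OF g(1)] by (metis g(2) prod.collapse)
    moreover have "0 \<le> snd a" using snd_cartan_mu_nonneg[OF g(1)] by (simp add: g(2))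
    ultimately show "a \<in> P" using g(1) unfolding P_def by (metis (mono_tags, lifting) imageI mem_Collect_eq)
  qed
  moreover have "near P (cartan_mu ` H)"
  proof (rule nearI[of _ _ "\<bar>q0\<bar>"])
    fix a assume "a \<in> P"
    then obtain g q where g: "g \<in> H" "a = (ln (det g), q)" "0 \<le> q" by (auto simp: P_def)
    obtain s where s: "s \<in> derived" "cartan_mu (s ** g) = (ln \<bar>det g\<bar>, max q q0)"
      using q0[OF invertible[OF g(1)], of "max q q0"] by auto
    have "s ** g \<in> H" using s(1) derived_sub g(1) mult_mem by blast
    moreover have "dist a (cartan_mu (s ** g)) \<le> \<bar>q0\<bar>"
      unfolding s(2) g(2) using det_pos[OF g(1)] g(3) by (simp add: dist_same_fst max_def)
    ultimately show "\<exists>b\<in>cartan_mu ` H. dist a b \<le> \<bar>q0\<bar>" by blast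
  qed
  ultimately have "coarse_eq (cartan_mu ` H) P" by (simp add: coarse_eq_def near_subset)
  moreover have "P = plane_A 0 \<or> P = plane_G"
    using ln_det_image unfolding P_def plane_A_0 plane_G_def by auto
  ultimately show ?thesis using plane_models_mem(1,4) classifiedI by metis
qed

end

context connected_matrix_group
begin

theorem connected_group_classified: "classified H"
proof (cases "\<exists>v. v \<noteq> 0 \<and> (\<forall>g\<in>H. \<exists>c. g *v v = c *\<^sub>R v)")
  case True
  then show ?thesis using classified_reducible by blast
next
  case False
  then interpret irreducible_matrix_group H by unfold_locales blast
  show ?thesis by (rule classified_irreducible)
qed

end

section \<open>Connected subgroups up to compact sets\<close>

text \<open>
  The charts are homeomorphisms onto open sets for the manifold topology and continuous into the ambient space,
  so the manifold topology is finer than the subspace topology.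
\<close>

lemma immersed_submanifold_inclusion_continuous:
  fixes M :: "'a::euclidean_space set"
  assumes "immersed_submanifold M T"
  shows "continuous_map T euclidean (\<lambda>x. x)"
proof -
  have top: "topspace T = M" using assms by (simp add: immersed_submanifold_def)
  have "openin T {x \<in> topspace T. x \<in> U}" if U: "open U" for U
  proof (subst openin_subopen, intro ballI)
    fix p assume p: "p \<in> {x \<in> topspace T. x \<in> U}"
    obtain V W and \<phi> :: "'a \<Rightarrow> 'a" where \<phi>: "p \<in> \<phi> ` W" "openin T (\<phi> ` W)"
      "homeomorphic_map (top_of_set W) (subtopology T (\<phi> ` W)) \<phi>" "immersion_on V W \<phi>"
      using assms p top unfolding immersed_submanifold_def by blast
    have "continuous_on W \<phi>"
      using \<phi>(4) has_derivative_continuous unfolding immersion_on_def continuous_on_eq_continuous_within by blast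
    then have "openin (top_of_set W) (W \<inter> \<phi> -` U)"
      using U by (simp add: continuous_on_open_gen continuous_openin_preimage_gen)
    then have "openin (subtopology T (\<phi> ` W)) (\<phi> ` (W \<inter> \<phi> -` U))"
      using homeomorphic_imp_open_map[OF \<phi>(3)] unfolding open_map_def by blast
    then have "openin T (\<phi> ` (W \<inter> \<phi> -` U))" using \<phi>(2) by (rule openin_trans_full)
    moreover have "p \<in> \<phi> ` (W \<inter> \<phi> -` U)" using p \<phi>(1) by auto
    moreover have "\<phi> ` (W \<inter> \<phi> -` U) \<subseteq> {x \<in> topspace T. x \<in> U}"
      using openin_subset[OF \<phi>(2)] by auto
    ultimately show "\<exists>S. openin T S \<and> p \<in> S \<and> S \<subseteq> {x \<in> topspace T. x \<in> U}" by blast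
  qed
  then show ?thesis by (simp add: continuous_map_def)
qed

lemma connected_Lie_subgroup_imp_connected_matrix_group:
  assumes "connected_Lie_subgroup H"
  shows "connected_matrix_group H"
proof -
  obtain T where H: "subgroup H GL2" and T: "immersed_submanifold H T" "connected_space T"
    using assms by (auto simp: connected_Lie_subgroup_def)
  have top: "topspace T = H" using T(1) by (simp add: immersed_submanifold_def)
  have sub: "H \<subseteq> {g. invertible g}" using subgroup.subset[OF H] by simp
  have "connectedin euclidean ((\<lambda>x. x) ` topspace T)"
    using connectedin_continuous_map_image[OF immersed_submanifold_inclusion_continuous[OF T(1)]] T(2)
    by (simp add: connectedin_topspace)
  then have "connected H" by (simp add: top)
  moreover have "matrix_inv g \<in> H" if "g \<in> H" for g
    using subgroup.m_inv_closed[OF H that] inv_GL2 sub that by auto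
  ultimately show ?thesis
    using subgroup.one_closed[OF H] subgroup.m_closed[OF H] sub
    by unfold_locales auto
qed

lemma sim_GL2_iff_coarse_eq:
  "L \<subseteq> carrier GL2 \<Longrightarrow> H \<subseteq> carrier GL2 \<Longrightarrow> sim_GL2 L H \<longleftrightarrow> coarse_eq (cartan_mu ` L) (cartan_mu ` H)"
  by (simp only: sim_GL2_iff_near coarse_eq_def)

lemma cartan_mu_one: "coarse_eq (cartan_mu ` {\<one>\<^bsub>GL2\<^esub>}) plane_1"
proof -
  have e: "cartan_mu (mat 1) = (0, ln 2)"
    using cartan_mu_lower_triangular[of 0 0 0] by (simp add: mat_1_eq_mat2)
  show ?thesis
    unfolding coarse_eq_def
    by (intro conjI nearI[of _ _ "ln 2"]) (simp_all add: e plane_1_def dist_same_fst)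
qed

text \<open>
  Diagonal matrices with positive entries realize every point of the half-plane up to a bounded error.
\<close>

lemma cartan_mu_GL2: "coarse_eq (cartan_mu ` carrier GL2) plane_G"
proof -
  have "cartan_mu ` carrier GL2 \<subseteq> plane_G"
  proof
    fix a assume "a \<in> cartan_mu ` carrier GL2"
    then obtain g where g: "invertible g" "a = cartan_mu g" by auto
    have "0 < \<bar>det g\<bar>" using g(1) by (simp add: invertible_det_nz)
    moreover have "\<bar>det g\<bar> \<le> (norm g)\<^sup>2" using norm_mat2_det[of g] by linarith
    ultimately have "1 \<le> (norm g)\<^sup>2 / \<bar>det g\<bar>" by simp
    then show "a \<in> plane_G" by (simp add: g(2) cartan_mu_def plane_G_def)
  qed
  moreover have "near plane_G (cartan_mu ` carrier GL2)"
  proof (rule nearI[of _ _ "ln 2"])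
    fix a assume "a \<in> plane_G"
    then obtain x q where a: "a = (x, q)" "0 \<le> q" by (auto simp: plane_G_def)
    define g where "g = mat2 (exp ((x + q) / 2)) 0 0 (exp ((x - q) / 2))"
    have e: "(x + q) / 2 + (x - q) / 2 = x" "(x + q) / 2 - (x - q) / 2 = q" "(x - q) / 2 - (x + q) / 2 = - q"
      by (simp_all add: field_simps)
    have "cartan_mu g = (x, ln (exp q + exp (- q)))"
      unfolding g_def cartan_mu_lower_triangular e by simp
    then have "dist a (cartan_mu g) \<le> ln 2"
      using ln_cosh_between[of q] a(2) by (simp add: a(1) dist_same_fst abs_minus_commute)
    moreover have "g \<in> carrier GL2" by (simp add: g_def invertible_mat2)
    ultimately show "\<exists>b\<in>cartan_mu ` carrier GL2. dist a b \<le> ln 2" by blast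
  qed
  ultimately show ?thesis by (simp add: coarse_eq_def near_subset)
qed

lemma one_subset_GL2: "{\<one>\<^bsub>GL2\<^esub>} \<subseteq> carrier GL2"
  using group.is_monoid[OF group_GL2] monoid.one_closed by blast

lemma nontrivialI:
  assumes Lie: "connected_Lie_subgroup H" and P: "coarse_eq (cartan_mu ` H) P"
    and "\<not> bounded P" "\<not> near plane_G P"
  shows "nontrivial_connected_subgroup H"
proof -
  have H: "H \<subseteq> carrier GL2"
    using Lie subgroup.subset unfolding connected_Lie_subgroup_def by blast
  have "\<not> sim_GL2 H {\<one>\<^bsub>GL2\<^esub>}"
  proof
    assume "sim_GL2 H {\<one>\<^bsub>GL2\<^esub>}"
    then have "coarse_eq (cartan_mu ` H) (cartan_mu ` {\<one>\<^bsub>GL2\<^esub>})"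
      using H one_subset_GL2 sim_GL2_iff_coarse_eq by blast
    then have "coarse_eq P plane_1"
      using P cartan_mu_one coarse_eq_sym coarse_eq_trans by blast
    then have "near P plane_1" by (simp add: coarse_eq_def)
    moreover have "bounded plane_1" by (simp add: plane_1_def)
    ultimately show False using near_bounded \<open>\<not> bounded P\<close> by blast
  qed
  moreover have "\<not> sim_GL2 H (carrier GL2)"
  proof
    assume "sim_GL2 H (carrier GL2)"
    then have "coarse_eq (cartan_mu ` H) (cartan_mu ` carrier GL2)"
      using H sim_GL2_iff_coarse_eq by blast
    then have "coarse_eq P plane_G"
      using P cartan_mu_GL2 coarse_eq_sym coarse_eq_trans by blast
    then show False using \<open>\<not> near plane_G P\<close> by (simp add: coarse_eq_def)
  qed
  ultimately show ?thesis using Lie by (simp add: nontrivial_connected_subgroup_def)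
qed

lemma nontrivial_model_groups:
  "nontrivial_connected_subgroup Z_grp" "nontrivial_connected_subgroup U_grp"
  "nontrivial_connected_subgroup (A_grp \<alpha>)" "nontrivial_connected_subgroup (B_grp \<alpha>)"
  by (rule nontrivialI[OF connected_Lie_subgroup_Z cartan_mu_Z unbounded_plane(1) not_near_plane_G(1)]
      nontrivialI[OF connected_Lie_subgroup_U cartan_mu_U unbounded_plane(2) not_near_plane_G(2)]
      nontrivialI[OF connected_Lie_subgroup_A cartan_mu_A unbounded_plane(3) not_near_plane_G(3)]
      nontrivialI[OF connected_Lie_subgroup_B cartan_mu_B unbounded_plane(4) not_near_plane_G(4)])+

lemma model_groups_subset_GL2:
  "Z_grp \<subseteq> carrier GL2" "U_grp \<subseteq> carrier GL2" "A_grp \<alpha> \<subseteq> carrier GL2" "B_grp \<alpha> \<subseteq> carrier GL2"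
  by (rule subgroup.subset subgroup_Z_grp subgroup_U_grp subgroup_A_grp subgroup_B_grp)+

lemma nontrivial_connected_subgroup_classification:
  assumes "nontrivial_connected_subgroup H"
  shows "\<exists>K \<in> {Z_grp, U_grp} \<union> range A_grp \<union> range B_grp. sim_GL2 H K"
proof -
  have Lie: "connected_Lie_subgroup H" and ne: "\<not> sim_GL2 H {\<one>\<^bsub>GL2\<^esub>}" "\<not> sim_GL2 H (carrier GL2)"
    using assms by (simp_all add: nontrivial_connected_subgroup_def)
  have H: "H \<subseteq> carrier GL2"
    using Lie subgroup.subset unfolding connected_Lie_subgroup_def by blast
  interpret connected_matrix_group H by (rule connected_Lie_subgroup_imp_connected_matrix_group[OF Lie])
  obtain P where P: "P \<in> plane_models"
    "coarse_eq (cartan_mu ` H) P" using connected_group_classified[unfolded classified_def] by (rule bexE)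
  have simI: "sim_GL2 H K" if "K \<subseteq> carrier GL2" "coarse_eq (cartan_mu ` K) P" for K
    unfolding sim_GL2_iff_coarse_eq[OF H that(1)] by (rule coarse_eq_trans[OF P(2) coarse_eq_sym[OF that(2)]])
  have "P \<noteq> plane_1"
  proof
    assume "P = plane_1"
    then show False using simI[OF one_subset_GL2] cartan_mu_one ne(1) by blast
  qed
  moreover have "P \<noteq> plane_G" using simI[of "carrier GL2"] cartan_mu_GL2 ne(2) by blast
  ultimately consider "P = plane_Z" | "P = plane_U" | \<alpha> where "P = plane_A \<alpha>" | \<alpha> where "P = plane_B \<alpha>"
    using P(1) unfolding plane_models_def by blast
  then show ?thesis
  proof cases
    case 1
    then have "sim_GL2 H Z_grp" by (intro simI model_groups_subset_GL2) (simp add: cartan_mu_Z)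
    then show ?thesis by blast
  next
    case 2
    then have "sim_GL2 H U_grp" by (intro simI model_groups_subset_GL2) (simp add: cartan_mu_U)
    then show ?thesis by blast
  next
    case (3 \<alpha>)
    then have "sim_GL2 H (A_grp \<alpha>)" by (intro simI model_groups_subset_GL2) (simp add: cartan_mu_A)
    then show ?thesis by blast
  next
    case (4 \<alpha>)
    then have "sim_GL2 H (B_grp \<alpha>)" by (intro simI model_groups_subset_GL2) (simp add: cartan_mu_B)
    then show ?thesis by blast
  qed
qed

lemma proper_GL2_sym:
  "L \<subseteq> carrier GL2 \<Longrightarrow> H \<subseteq> carrier GL2 \<Longrightarrow> proper_GL2 L H \<longleftrightarrow> proper_GL2 H L"
  by (simp only: proper_GL2_iff_coarsely_proper) (blast intro: coarsely_proper_sym)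

lemma proper_GL2_via_plane:
  assumes "coarse_eq (cartan_mu ` L) A" "L \<subseteq> carrier GL2" "coarse_eq (cartan_mu ` H) B" "H \<subseteq> carrier GL2"
  shows "proper_GL2 L H \<longleftrightarrow> coarsely_proper A B"
  unfolding proper_GL2_iff_coarsely_proper[OF assms(2,4)] by (rule coarsely_proper_cong[OF assms(1,3)])

theorem theorem1p3:
  "(\<forall>K \<in> {Z_grp, U_grp} \<union> range A_grp \<union> range B_grp. nontrivial_connected_subgroup K) \<and>
   (\<forall>H. nontrivial_connected_subgroup H \<longrightarrow>
      (\<exists>K \<in> {Z_grp, U_grp} \<union> range A_grp \<union> range B_grp. sim_GL2 H K)) \<and>
   (\<forall>L H. L \<subseteq> carrier GL2 \<longrightarrow> H \<subseteq> carrier GL2 \<longrightarrow> (proper_GL2 L H \<longleftrightarrow> proper_GL2 H L)) \<and>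
   (\<forall>\<alpha> \<beta> :: real.
      \<not> proper_GL2 Z_grp Z_grp \<and>
      proper_GL2 Z_grp (A_grp \<beta>) \<and>
      proper_GL2 Z_grp U_grp \<and>
      proper_GL2 Z_grp (B_grp \<beta>) \<and>
      (proper_GL2 (A_grp \<alpha>) (A_grp \<beta>) \<longleftrightarrow> \<bar>\<alpha>\<bar> \<noteq> \<bar>\<beta>\<bar>) \<and>
      proper_GL2 (A_grp \<alpha>) U_grp \<and>
      (proper_GL2 (A_grp \<alpha>) (B_grp \<beta>) \<longleftrightarrow> \<bar>\<alpha>\<bar> > \<bar>\<beta>\<bar>) \<and>
      \<not> proper_GL2 U_grp U_grp \<and>
      proper_GL2 U_grp (B_grp \<beta>) \<and>
      \<not> proper_GL2 (B_grp \<alpha>) (B_grp \<beta>))"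
proof (intro conjI allI impI ballI)
  note Z = cartan_mu_Z model_groups_subset_GL2(1)
  note U = cartan_mu_U model_groups_subset_GL2(2)
  note A = cartan_mu_A model_groups_subset_GL2(3)
  note B = cartan_mu_B model_groups_subset_GL2(4)
  fix \<alpha> \<beta> :: real
  show "\<not> proper_GL2 Z_grp Z_grp" "\<not> proper_GL2 U_grp U_grp"
    unfolding proper_GL2_via_plane[OF Z Z] proper_GL2_via_plane[OF U U] by (rule not_coarsely_proper_refl)+
  show "proper_GL2 Z_grp (A_grp \<beta>)"
    unfolding proper_GL2_via_plane[OF Z A] by (rule coarsely_proper_Z_A)
  show "proper_GL2 Z_grp U_grp"
    unfolding proper_GL2_via_plane[OF Z U] by (rule coarsely_proper_Z_U)
  show "proper_GL2 Z_grp (B_grp \<beta>)"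
    unfolding proper_GL2_via_plane[OF Z B] by (rule coarsely_proper_Z_B)
  show "proper_GL2 (A_grp \<alpha>) (A_grp \<beta>) \<longleftrightarrow> \<bar>\<alpha>\<bar> \<noteq> \<bar>\<beta>\<bar>"
    unfolding proper_GL2_via_plane[OF A A] by (rule coarsely_proper_A_A)
  show "proper_GL2 (A_grp \<alpha>) U_grp"
    unfolding proper_GL2_via_plane[OF A U] by (rule coarsely_proper_A_U)
  show "proper_GL2 (A_grp \<alpha>) (B_grp \<beta>) \<longleftrightarrow> \<bar>\<alpha>\<bar> > \<bar>\<beta>\<bar>"
    unfolding proper_GL2_via_plane[OF A B] by (rule coarsely_proper_A_B)
  show "proper_GL2 U_grp (B_grp \<beta>)"
    unfolding proper_GL2_via_plane[OF U B] by (rule coarsely_proper_U_B)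
  show "\<not> proper_GL2 (B_grp \<alpha>) (B_grp \<beta>)"
    unfolding proper_GL2_via_plane[OF B B] by (rule not_coarsely_proper_B_B)
next
  fix K assume "K \<in> {Z_grp, U_grp} \<union> range A_grp \<union> range B_grp"
  then show "nontrivial_connected_subgroup K" using nontrivial_model_groups by blast
qed (fact nontrivial_connected_subgroup_classification, fact proper_GL2_sym)

end
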